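(* Let $\eta>0$, $t\in(0,d]$ and let $u\in\mathcal A_G^{\eta,t}$ be the solution for a right-hand side $0\neq f\in V^*$; let $\varepsilon\in(0,1)$ be the tolerance. Upon termination of the algorithm DYN-GAL$(\varepsilon)$, the iterate $u_{n+1}\in V_{\Lambda_{n+1}}$ and the set of active coefficients $\Lambda_{n+1}$ satisfy $$|||u-u_{n+1}|||\le\frac{\beta^*}{\sqrt{\alpha_*}}\|f\|_{\phi^*}\,\varepsilon$$ and $$|\Lambda_{n+1}|\le\omega_d\left(\frac1{\eta_*}\log\frac{C_*\,\|u\|_{\mathcal A_G^{\eta,t}}/\|f\|_{\phi^*}}{\varepsilon}\right)^{d/t_*},$$ with parameters $C_*>0$, $0<\eta_*<\eta$ and $0<t_*<t$. Moreover, if the number of arithmetic operations needed to solve a linear system scales linearly with its dimension, then the workload $\mathcal W_\varepsilon$ of DYN-GAL upon completion satisfies $$\mathcal W_\varepsilon\le\omega_d\left(\frac1{\eta^*}\log\frac{C^*\,\|u\|_{\mathcal A_G^{\eta,t}}/\|f\|_{\phi^*}}{\varepsilon^4\,\big|\log|\log\varepsilon|\big|^{-1}}\right)^{d/t_*},$$ where $0<\eta^*<\eta_*$ and $C^*>C_*$, but $t_*$ is the same as in the bound for $|\Lambda_{n+1}|$. The parameters $C_*,\eta_*,t_*,C^*,\eta^*$ do not depend on $f$, $u$ and $\varepsilon$ (while $C^*,\eta^*$ may depend on the linear solver).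
   Context: Problem. Let $d\ge1$, $\Omega\subset\mathbb R^d$ a rectangular domain, $V=H^1_0(\Omega)$ or $V=H^1_p(\Omega)$ (periodic functions), with dual $V^*$. Consider $Lu=-\nabla\cdot(\nu\nabla u)+\sigma u=f$ with $f\in V^*$ and sufficiently smooth real coefficients $0<\nu_*\le\nu\le\nu^*<\infty$, $0<\sigma_*\le\sigma\le\sigma^*<\infty$. Put $\alpha_*=\min(\nu_*,\sigma_* )$, $\alpha^*=\max(\nu^*,\sigma^* )$. Weak form: $u\in V$, $a(u,v)=\langle f,v\rangle$ for all $v\in V$, with $a(u,v)=\int_\Omega\nu\nabla u\cdot\nabla\bar v+\int_\Omega\sigma u\bar v$. The energy norm $|||v|||=\sqrt{a(v,v)}$ satisfies $\sqrt{\alpha_*}\|v\|_V\le|||v|||\le\sqrt{\alpha^*}\|v\|_V$. Basis. $\{\phi_k\}_{k\in\mathcal K}$, $\mathcal K\subset\mathbb Z^d$ infinite, is a Riesz basis of $V$: there are weights $d_k>0$ and constants $0<\beta_*\le\beta^*$ such that for $v=\sum_k\hat v_k\phi_k$, with $\|v\|_\phi^2:=\sum_k|\hat v_k|^2d_k$, one has $\beta_*\|v\|_V\le\|v\|_\phi\le\beta^*\|v\|_V$. With the dual basis $\{\phi_k^*\}$, $g\in V^*$ is written $g=\sum_k\hat g_k\phi_k^*$, $\hat g_k=\langle g,\phi_k\rangle$, and $\|g\|_{\phi^*}^2:=\sum_k|\hat g_k|^2d_k^{-1}$; hence $\frac1{\beta^*}\|g\|_{V^*}\le\|g\|_{\phi^*}\le\frac1{\beta_*}\|g\|_{V^*}$.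 For $\Lambda\subset\mathcal K$, $P_\Lambda v:=\sum_{k\in\Lambda}\hat v_k\phi_k$ and $P^*_\Lambda g:=\sum_{k\in\Lambda}\hat g_k\phi_k^*$. Matrix. $\mathbf A=(a_{\ell,k})_{\ell,k\in\mathcal K}$, $a_{\ell,k}=d_\ell^{-1/2}a(\phi_k,\phi_\ell)d_k^{-1/2}$, is a bounded invertible operator on $\ell^2(\mathcal K)$. Standing assumption: there are $c_L,\eta_L>0$ with $|a_{\ell,k}|\le c_Le^{-\eta_L|\ell-k|}$ for all $\ell,k$; the entries of $\mathbf A^{-1}$ satisfy a bound of the same type with some rate $\bar\eta_L\in(0,\eta_L]$; and there are constants $C_{\mathbf A^{-1}}>0$, $\tilde\eta_L\in(0,\bar\eta_L)$ such that for all $J\ge0$ $$\|\mathbf A^{-1}-(\mathbf A^{-1})_J\|\le C_{\mathbf A^{-1}}e^{-\tilde\eta_LJ}$$ in the operator norm of $\ell^2(\mathcal K)$, where $(\mathbf A^{-1})_J$ is obtained from $\mathbf A^{-1}$ by setting to zero the entries $(\ell,k)$ with $|\ell-k|>J$. Galerkin. For finite $\Lambda\subset\mathcal K$, $V_\Lambda=\mathrm{span}\{\phi_k:k\in\Lambda\}$, $u_\Lambda\in V_\Lambda$ solves $a(u_\Lambda,v)=\langle f,v\rangle$ for all $v\in V_\Lambda$, and the residual is $r(u_\Lambda)=f-Lu_\Lambda\in V^*$. Gevrey sparsity class. $\omega_d$ is the measure of the Euclidean unit ball in $\mathbb R^d$. For $v\in V$, $E_N(v)=\inf_{\Lambda\subset\mathcal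 K,|\Lambda|=N}\|v-P_\Lambda v\|_\phi$; for $\eta>0$, $0<t\le d$, $$\|v\|_{\mathcal A_G^{\eta,t}}:=\sup_{N\ge0}E_N(v)\exp\big(\eta\,\omega_d^{-t/d}N^{t/d}\big),\qquad \mathcal A_G^{\eta,t}:=\{v\in V:\|v\|_{\mathcal A_G^{\eta,t}}<\infty\}.$$ Algorithm DYN-GAL($\varepsilon$). Fix a constant $C_0$ with $0<C_0\le\frac14\sqrt{\alpha_*/\alpha^*}\,\beta_*/\beta^*$. Set $\Lambda_0=\emptyset$, $u_0=0$, $r_0=f$. For $n=0,1,2,\dots$: let $\theta_n=(1-C_0^2\|r_n\|_{\phi^*}^2/\|r_0\|_{\phi^*}^2)^{1/2}$. (i) (Dörfler marking) Let $\widetilde{\partial\Lambda}_n\subset\mathcal K$ be a set of minimal cardinality such that $\|P^*_{\widetilde{\partial\Lambda}_n}r_n\|_{\phi^*}\ge\theta_n\|r_n\|_{\phi^*}$. (ii) (Enrichment) Let $J=J(\theta_n)>0$ satisfy $C_{\mathbf A^{-1}}e^{-\tilde\eta_LJ}\le\sqrt{\frac{1-\theta_n^2}{\alpha_*\alpha^*}}$; specifically, $J(\theta_n)=-\frac1{\tilde\eta_L}\log\frac{\|r_n\|_{\phi^*}}{\|r_0\|_{\phi^*}}+K_1$ with $K_1=-\frac1{\tilde\eta_L}\log\Big(\frac1{\sqrt{\alpha_*\alpha^*}}\frac{C_0}{C_{\mathbf A^{-1}}}\Big)+\delta_n$ and $\delta_n\in[0,1)$. Let $\partial\Lambda_n=\{k\in\mathcal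 K:\ |k-\ell|\le J\text{ for some }\ell\in\widetilde{\partial\Lambda}_n\}$. (iii) Set $\Lambda_{n+1}=\Lambda_n\cup\partial\Lambda_n$, $u_{n+1}=u_{\Lambda_{n+1}}$ (Galerkin solution), $r_{n+1}=r(u_{n+1})$. Stop as soon as $\|r_{n+1}\|_{\phi^*}\le\varepsilon\|r_0\|_{\phi^*}$; $n+1$ then denotes the final index. All residuals are assumed to be computed exactly. Workload. The cost of finding and storing $u_{k+1}$ is taken to be $C_\#|\Lambda_{k+1}|$, with $C_\#$ a constant that may depend on the specific linear solver; the workload $\mathcal W_\varepsilon$ is the total of these costs over the iterations performed by DYN-GAL$(\varepsilon)$.
   Formalization: The workload bound fails for ε near 1/e, where log|log ε| vanishes (it is undefined at ε=1/e); it is proved for all ε in (0,1) with |log|log ε||≥ρ, for every ρ>0, with C^* and η^* allowed to depend on ρ. *)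

theory Defs
  imports "HOL-Analysis.Analysis"
begin

definition partial_deriv :: "'n \<Rightarrow> (real^'n::finite \<Rightarrow> complex) \<Rightarrow> real^'n \<Rightarrow> complex" where
  "partial_deriv i f x = frechet_derivative f (at x) (axis i 1)"

text \<open>The class \<open>C\<^sup>\<infinity>\<close> on the whole space: all iterated partial derivatives exist and are
  (totally) differentiable.\<close>

coinductive smooth :: "(real^'n::finite \<Rightarrow> complex) \<Rightarrow> bool" where
  "(\<And>x. f differentiable (at x)) \<Longrightarrow> (\<And>i. smooth (partial_deriv i f)) \<Longrightarrow> smooth f"

definition test_functions :: "(real^'n::finite) set \<Rightarrow> (real^'n \<Rightarrow> complex) set" where
  "test_functions \<Omega> = {\<psi>. smooth \<psi> \<and> compact (closure {x. \<psi> x \<noteq> 0}) \<and> closure {x. \<psi> x \<noteq> 0} \<subseteq> \<Omega>}"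

definition L2 :: "(real^'n::finite) set \<Rightarrow> (real^'n \<Rightarrow> complex) set" where
  "L2 \<Omega> = {v. v \<in> borel_measurable (lebesgue_on \<Omega>) \<and>
               integrable (lebesgue_on \<Omega>) (\<lambda>x. (cmod (v x))\<^sup>2)}"

definition weak_gradient ::
  "(real^'n::finite) set \<Rightarrow> (real^'n \<Rightarrow> complex) \<Rightarrow> (real^'n \<Rightarrow> complex^'n) \<Rightarrow> bool" where
  "weak_gradient \<Omega> v G \<longleftrightarrow>
     (\<forall>i. (\<lambda>x. G x $ i) \<in> L2 \<Omega> \<and>
          (\<forall>\<psi>\<in>test_functions \<Omega>.
             (LINT x|lebesgue_on \<Omega>. v x * partial_deriv i \<psi> x) =
             - (LINT x|lebesgue_on \<Omega>. G x $ i * \<psi> x)))"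

text \<open>Elements of the function spaces are representatives, i.e. functions rather than classes
  modulo null sets. Weak gradients are unique up to a null set, so the choice made by
  \<open>grad\<close> does not affect any of the integrals below.\<close>

definition H1 :: "(real^'n::finite) set \<Rightarrow> (real^'n \<Rightarrow> complex) set" where
  "H1 \<Omega> = {v \<in> L2 \<Omega>. \<exists>G. weak_gradient \<Omega> v G}"

definition grad :: "(real^'n::finite) set \<Rightarrow> (real^'n \<Rightarrow> complex) \<Rightarrow> real^'n \<Rightarrow> complex^'n" where
  "grad \<Omega> v = (SOME G. weak_gradient \<Omega> v G)"

definition H1_norm :: "(real^'n::finite) set \<Rightarrow> (real^'n \<Rightarrow> complex) \<Rightarrow> real" where
  "H1_norm \<Omega> v = sqrt ((LINT x|lebesgue_on \<Omega>. (cmod (v x))\<^sup>2) +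
                       (LINT x|lebesgue_on \<Omega>. (norm (grad \<Omega> v x))\<^sup>2))"

definition H1_zero :: "(real^'n::finite) set \<Rightarrow> (real^'n \<Rightarrow> complex) set" where
  "H1_zero \<Omega> = {v \<in> H1 \<Omega>. \<exists>\<psi>::nat \<Rightarrow> real^'n \<Rightarrow> complex.
      (\<forall>m. \<psi> m \<in> test_functions \<Omega>) \<and> (\<lambda>m. H1_norm \<Omega> (\<lambda>x. v x - \<psi> m x)) \<longlonglongrightarrow> 0}"

definition H1_periodic :: "real^'n::finite \<Rightarrow> real^'n \<Rightarrow> (real^'n \<Rightarrow> complex) set" where
  "H1_periodic a b = {v \<in> H1 (box a b). \<exists>\<psi>::nat \<Rightarrow> real^'n \<Rightarrow> complex.
      (\<forall>m. smooth (\<psi> m) \<and> (\<forall>x i. \<psi> m (x + axis i (b $ i - a $ i)) = \<psi> m x)) \<and>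
      (\<lambda>m. H1_norm (box a b) (\<lambda>x. v x - \<psi> m x)) \<longlonglongrightarrow> 0}"

definition bilinear_form ::
  "(real^'n::finite) set \<Rightarrow> (real^'n \<Rightarrow> real) \<Rightarrow> (real^'n \<Rightarrow> real) \<Rightarrow>
   (real^'n \<Rightarrow> complex) \<Rightarrow> (real^'n \<Rightarrow> complex) \<Rightarrow> complex" where
  "bilinear_form \<Omega> \<nu> \<sigma> u v =
     (LINT x|lebesgue_on \<Omega>.
        complex_of_real (\<nu> x) * (\<Sum>i\<in>UNIV. grad \<Omega> u x $ i * cnj (grad \<Omega> v x $ i))) +
     (LINT x|lebesgue_on \<Omega>. complex_of_real (\<sigma> x) * (u x * cnj (v x)))"

definition energy_norm ::
  "(real^'n::finite) set \<Rightarrow> (real^'n \<Rightarrow> real) \<Rightarrow> (real^'n \<Rightarrow> real) \<Rightarrow> (real^'n \<Rightarrow> complex) \<Rightarrow> real"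
  where "energy_norm \<Omega> \<nu> \<sigma> v = sqrt (Re (bilinear_form \<Omega> \<nu> \<sigma> v v))"

text \<open>Since the form is antilinear in its second argument, the pairing \<open>\<langle>g, v\<rangle> = g v\<close> is
  antilinear in \<open>v\<close>: the dual space consists of the bounded antilinear functionals on \<open>V\<close>.\<close>

type_synonym 'n functional = "(real^'n \<Rightarrow> complex) \<Rightarrow> complex"

definition dual_space ::
  "(real^'n::finite) set \<Rightarrow> (real^'n \<Rightarrow> complex) set \<Rightarrow> 'n functional set" where
  "dual_space \<Omega> V = {g.
     (\<forall>v\<in>V. \<forall>w\<in>V. g (\<lambda>x. v x + w x) = g v + g w) \<and>
     (\<forall>v\<in>V. \<forall>c. g (\<lambda>x. c * v x) = cnj c * g v) \<and>
     (\<exists>C. \<forall>v\<in>V. cmod (g v) \<le> C * H1_norm \<Omega> v)}"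

definition weak_solution ::
  "(real^'n::finite) set \<Rightarrow> (real^'n \<Rightarrow> complex) set \<Rightarrow> (real^'n \<Rightarrow> real) \<Rightarrow> (real^'n \<Rightarrow> real) \<Rightarrow>
   'n functional \<Rightarrow> (real^'n \<Rightarrow> complex) \<Rightarrow> bool" where
  "weak_solution \<Omega> V \<nu> \<sigma> f u \<longleftrightarrow> u \<in> V \<and> (\<forall>v\<in>V. bilinear_form \<Omega> \<nu> \<sigma> u v = f v)"

definition residual ::
  "(real^'n::finite) set \<Rightarrow> (real^'n \<Rightarrow> real) \<Rightarrow> (real^'n \<Rightarrow> real) \<Rightarrow> 'n functional \<Rightarrow>
   (real^'n \<Rightarrow> complex) \<Rightarrow> 'n functional" where
  "residual \<Omega> \<nu> \<sigma> f u = (\<lambda>v. f v - bilinear_form \<Omega> \<nu> \<sigma> u v)"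

type_synonym 'n idx = "int^'n"

definition expansion ::
  "(real^'n::finite) set \<Rightarrow> 'n idx set \<Rightarrow> ('n idx \<Rightarrow> real^'n \<Rightarrow> complex) \<Rightarrow>
   ('n idx \<Rightarrow> complex) \<Rightarrow> (real^'n \<Rightarrow> complex) \<Rightarrow> bool" where
  "expansion \<Omega> K \<phi> c v \<longleftrightarrow>
     (\<forall>k. k \<notin> K \<longrightarrow> c k = 0) \<and>
     ((\<lambda>F. H1_norm \<Omega> (\<lambda>x. v x - (\<Sum>k\<in>F. c k * \<phi> k x))) \<longlongrightarrow> 0) (finite_subsets_at_top K)"

definition coeffs ::
  "(real^'n::finite) set \<Rightarrow> 'n idx set \<Rightarrow> ('n idx \<Rightarrow> real^'n \<Rightarrow> complex) \<Rightarrow>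
   (real^'n \<Rightarrow> complex) \<Rightarrow> 'n idx \<Rightarrow> complex" where
  "coeffs \<Omega> K \<phi> v = (THE c. expansion \<Omega> K \<phi> c v)"

definition phi_norm ::
  "(real^'n::finite) set \<Rightarrow> 'n idx set \<Rightarrow> ('n idx \<Rightarrow> real^'n \<Rightarrow> complex) \<Rightarrow> ('n idx \<Rightarrow> real) \<Rightarrow>
   (real^'n \<Rightarrow> complex) \<Rightarrow> real" where
  "phi_norm \<Omega> K \<phi> d v = sqrt (\<Sum>\<^sub>\<infinity>k\<in>K. (cmod (coeffs \<Omega> K \<phi> v k))\<^sup>2 * d k)"

text \<open>Summability is required explicitly because \<open>infsum\<close> is zero on non-summable families.\<close>

definition riesz_basis ::
  "(real^'n::finite) set \<Rightarrow> (real^'n \<Rightarrow> complex) set \<Rightarrow> 'n idx set \<Rightarrow>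
   ('n idx \<Rightarrow> real^'n \<Rightarrow> complex) \<Rightarrow> ('n idx \<Rightarrow> real) \<Rightarrow> real \<Rightarrow> real \<Rightarrow> bool" where
  "riesz_basis \<Omega> V K \<phi> d \<beta>_lo \<beta>_hi \<longleftrightarrow>
     (\<forall>k\<in>K. \<phi> k \<in> V) \<and> (\<forall>k\<in>K. 0 < d k) \<and> 0 < \<beta>_lo \<and> \<beta>_lo \<le> \<beta>_hi \<and>
     (\<forall>v\<in>V. (\<exists>!c. expansion \<Omega> K \<phi> c v) \<and>
             (\<lambda>k. (cmod (coeffs \<Omega> K \<phi> v k))\<^sup>2 * d k) summable_on K \<and>
             \<beta>_lo * H1_norm \<Omega> v \<le> phi_norm \<Omega> K \<phi> d v \<and>
             phi_norm \<Omega> K \<phi> d v \<le> \<beta>_hi * H1_norm \<Omega> v)"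

definition dual_phi_norm ::
  "'n idx set \<Rightarrow> ('n idx \<Rightarrow> real^'n::finite \<Rightarrow> complex) \<Rightarrow> ('n idx \<Rightarrow> real) \<Rightarrow> 'n functional \<Rightarrow> real"
  where "dual_phi_norm K \<phi> d g = sqrt (\<Sum>\<^sub>\<infinity>k\<in>K. (cmod (g (\<phi> k)))\<^sup>2 / d k)"

definition dual_basis ::
  "(real^'n::finite) set \<Rightarrow> 'n idx set \<Rightarrow> ('n idx \<Rightarrow> real^'n \<Rightarrow> complex) \<Rightarrow> 'n idx \<Rightarrow> 'n functional"
  where "dual_basis \<Omega> K \<phi> k = (\<lambda>v. cnj (coeffs \<Omega> K \<phi> v k))"

text \<open>The two projections are used for finite \<open>\<Lambda>\<close> only.\<close>

definition proj ::
  "(real^'n::finite) set \<Rightarrow> 'n idx set \<Rightarrow> ('n idx \<Rightarrow> real^'n \<Rightarrow> complex) \<Rightarrow> 'n idx set \<Rightarrow>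
   (real^'n \<Rightarrow> complex) \<Rightarrow> real^'n \<Rightarrow> complex" where
  "proj \<Omega> K \<phi> \<Lambda> v = (\<lambda>x. \<Sum>k\<in>\<Lambda>. coeffs \<Omega> K \<phi> v k * \<phi> k x)"

definition dual_proj ::
  "(real^'n::finite) set \<Rightarrow> 'n idx set \<Rightarrow> ('n idx \<Rightarrow> real^'n \<Rightarrow> complex) \<Rightarrow> 'n idx set \<Rightarrow>
   'n functional \<Rightarrow> 'n functional" where
  "dual_proj \<Omega> K \<phi> \<Lambda> g = (\<lambda>v. \<Sum>k\<in>\<Lambda>. g (\<phi> k) * dual_basis \<Omega> K \<phi> k v)"

definition idx_dist :: "'n::finite idx \<Rightarrow> 'n idx \<Rightarrow> real" where
  "idx_dist k l = norm (\<chi> i. real_of_int (k $ i - l $ i))"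

definition l2 :: "'i set \<Rightarrow> ('i \<Rightarrow> complex) set" where
  "l2 K = {x. (\<lambda>k. (cmod (x k))\<^sup>2) summable_on K}"

definition l2_norm :: "'i set \<Rightarrow> ('i \<Rightarrow> complex) \<Rightarrow> real" where
  "l2_norm K x = sqrt (\<Sum>\<^sub>\<infinity>k\<in>K. (cmod (x k))\<^sup>2)"

definition mat_app :: "'i set \<Rightarrow> ('i \<Rightarrow> 'i \<Rightarrow> complex) \<Rightarrow> ('i \<Rightarrow> complex) \<Rightarrow> 'i \<Rightarrow> complex" where
  "mat_app K M x = (\<lambda>l. \<Sum>\<^sub>\<infinity>k\<in>K. M l k * x k)"

definition l2_bounded :: "'i set \<Rightarrow> ('i \<Rightarrow> 'i \<Rightarrow> complex) \<Rightarrow> bool" where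
  "l2_bounded K M \<longleftrightarrow>
     (\<forall>x\<in>l2 K. (\<forall>l\<in>K. (\<lambda>k. M l k * x k) summable_on K) \<and> mat_app K M x \<in> l2 K) \<and>
     (\<exists>C. \<forall>x\<in>l2 K. l2_norm K (mat_app K M x) \<le> C * l2_norm K x)"

definition l2_opnorm :: "'i set \<Rightarrow> ('i \<Rightarrow> 'i \<Rightarrow> complex) \<Rightarrow> real" where
  "l2_opnorm K M = (SUP x\<in>{x \<in> l2 K. l2_norm K x \<le> 1}. l2_norm K (mat_app K M x))"

definition l2_inverse :: "'i set \<Rightarrow> ('i \<Rightarrow> 'i \<Rightarrow> complex) \<Rightarrow> ('i \<Rightarrow> 'i \<Rightarrow> complex) \<Rightarrow> bool" where
  "l2_inverse K A B \<longleftrightarrow> l2_bounded K A \<and> l2_bounded K B \<and>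
     (\<forall>x\<in>l2 K. \<forall>k\<in>K. mat_app K B (mat_app K A x) k = x k \<and>
                      mat_app K A (mat_app K B x) k = x k)"

definition band :: "real \<Rightarrow> ('n::finite idx \<Rightarrow> 'n idx \<Rightarrow> complex) \<Rightarrow> 'n idx \<Rightarrow> 'n idx \<Rightarrow> complex" where
  "band J M = (\<lambda>l k. if idx_dist l k > J then 0 else M l k)"

definition stiffness ::
  "(real^'n::finite) set \<Rightarrow> (real^'n \<Rightarrow> real) \<Rightarrow> (real^'n \<Rightarrow> real) \<Rightarrow>
   ('n idx \<Rightarrow> real^'n \<Rightarrow> complex) \<Rightarrow> ('n idx \<Rightarrow> real) \<Rightarrow> 'n idx \<Rightarrow> 'n idx \<Rightarrow> complex" where
  "stiffness \<Omega> \<nu> \<sigma> \<phi> d = (\<lambda>l k.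
     complex_of_real (1 / sqrt (d l)) * bilinear_form \<Omega> \<nu> \<sigma> (\<phi> k) (\<phi> l) *
     complex_of_real (1 / sqrt (d k)))"

definition galerkin_space ::
  "('n idx \<Rightarrow> real^'n::finite \<Rightarrow> complex) \<Rightarrow> 'n idx set \<Rightarrow> (real^'n \<Rightarrow> complex) set" where
  "galerkin_space \<phi> \<Lambda> = {v. \<exists>c. v = (\<lambda>x. \<Sum>k\<in>\<Lambda>. c k * \<phi> k x)}"

definition galerkin_solution ::
  "(real^'n::finite) set \<Rightarrow> (real^'n \<Rightarrow> real) \<Rightarrow> (real^'n \<Rightarrow> real) \<Rightarrow>
   ('n idx \<Rightarrow> real^'n \<Rightarrow> complex) \<Rightarrow> 'n functional \<Rightarrow> 'n idx set \<Rightarrow> (real^'n \<Rightarrow> complex) \<Rightarrow> bool"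
  where "galerkin_solution \<Omega> \<nu> \<sigma> \<phi> f \<Lambda> u \<longleftrightarrow>
     finite \<Lambda> \<and> u \<in> galerkin_space \<phi> \<Lambda> \<and>
     (\<forall>v\<in>galerkin_space \<phi> \<Lambda>. bilinear_form \<Omega> \<nu> \<sigma> u v = f v)"

definition best_error ::
  "(real^'n::finite) set \<Rightarrow> 'n idx set \<Rightarrow> ('n idx \<Rightarrow> real^'n \<Rightarrow> complex) \<Rightarrow> ('n idx \<Rightarrow> real) \<Rightarrow>
   nat \<Rightarrow> (real^'n \<Rightarrow> complex) \<Rightarrow> real" where
  "best_error \<Omega> K \<phi> d N v =
     (INF \<Lambda>\<in>{\<Lambda>. \<Lambda> \<subseteq> K \<and> finite \<Lambda> \<and> card \<Lambda> = N}.
        phi_norm \<Omega> K \<phi> d (\<lambda>x. v x - proj \<Omega> K \<phi> \<Lambda> v x))"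

definition ball_measure :: "'n::finite itself \<Rightarrow> real" where
  "ball_measure _ = measure lebesgue (ball (0::real^'n) 1)"

definition gevrey_quantity ::
  "(real^'n::finite) set \<Rightarrow> 'n idx set \<Rightarrow> ('n idx \<Rightarrow> real^'n \<Rightarrow> complex) \<Rightarrow> ('n idx \<Rightarrow> real) \<Rightarrow>
   real \<Rightarrow> real \<Rightarrow> (real^'n \<Rightarrow> complex) \<Rightarrow> nat \<Rightarrow> real" where
  "gevrey_quantity \<Omega> K \<phi> d \<eta> t v N =
     best_error \<Omega> K \<phi> d N v *
     exp (\<eta> * ball_measure TYPE('n) powr (- t / real CARD('n)) * real N powr (t / real CARD('n)))"

definition gevrey_norm ::
  "(real^'n::finite) set \<Rightarrow> 'n idx set \<Rightarrow> ('n idx \<Rightarrow> real^'n \<Rightarrow> complex) \<Rightarrow> ('n idx \<Rightarrow> real) \<Rightarrow>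
   real \<Rightarrow> real \<Rightarrow> (real^'n \<Rightarrow> complex) \<Rightarrow> real" where
  "gevrey_norm \<Omega> K \<phi> d \<eta> t v = (SUP N. gevrey_quantity \<Omega> K \<phi> d \<eta> t v N)"

definition gevrey_class ::
  "(real^'n::finite) set \<Rightarrow> (real^'n \<Rightarrow> complex) set \<Rightarrow> 'n idx set \<Rightarrow>
   ('n idx \<Rightarrow> real^'n \<Rightarrow> complex) \<Rightarrow> ('n idx \<Rightarrow> real) \<Rightarrow> real \<Rightarrow> real \<Rightarrow> (real^'n \<Rightarrow> complex) set"
  where "gevrey_class \<Omega> V K \<phi> d \<eta> t =
     {v \<in> V. bdd_above (range (gevrey_quantity \<Omega> K \<phi> d \<eta> t v))}"

definition doerfler_marking ::
  "(real^'n::finite) set \<Rightarrow> 'n idx set \<Rightarrow> ('n idx \<Rightarrow> real^'n \<Rightarrow> complex) \<Rightarrow> ('n idx \<Rightarrow> real) \<Rightarrow>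
   real \<Rightarrow> 'n functional \<Rightarrow> 'n idx set \<Rightarrow> bool" where
  "doerfler_marking \<Omega> K \<phi> d \<theta> r S \<longleftrightarrow>
     S \<subseteq> K \<and> finite S \<and>
     dual_phi_norm K \<phi> d (dual_proj \<Omega> K \<phi> S r) \<ge> \<theta> * dual_phi_norm K \<phi> d r"

definition minimal_doerfler_marking ::
  "(real^'n::finite) set \<Rightarrow> 'n idx set \<Rightarrow> ('n idx \<Rightarrow> real^'n \<Rightarrow> complex) \<Rightarrow> ('n idx \<Rightarrow> real) \<Rightarrow>
   real \<Rightarrow> 'n functional \<Rightarrow> 'n idx set \<Rightarrow> bool" where
  "minimal_doerfler_marking \<Omega> K \<phi> d \<theta> r S \<longleftrightarrow>
     doerfler_marking \<Omega> K \<phi> d \<theta> r S \<and>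
     (\<forall>T. doerfler_marking \<Omega> K \<phi> d \<theta> r T \<longrightarrow> card S \<le> card T)"

definition enrich :: "'n::finite idx set \<Rightarrow> real \<Rightarrow> 'n idx set \<Rightarrow> 'n idx set" where
  "enrich K J S = {k \<in> K. \<exists>l\<in>S. idx_dist k l \<le> J}"

text \<open>A terminated run with final index \<open>n + 1\<close>: step \<open>i\<close> uses the residual \<open>r i\<close>, the marked
  set \<open>M i\<close>, the shift \<open>\<delta> i\<close> and the enrichment radius \<open>J i\<close>. The algorithm is not deterministic
  (minimal markings and the shifts may be chosen freely), hence a relation.\<close>

definition dyn_gal_run ::
  "(real^'n::finite) set \<Rightarrow> (real^'n \<Rightarrow> real) \<Rightarrow> (real^'n \<Rightarrow> real) \<Rightarrow> real \<Rightarrow> real \<Rightarrow>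
   'n idx set \<Rightarrow> ('n idx \<Rightarrow> real^'n \<Rightarrow> complex) \<Rightarrow> ('n idx \<Rightarrow> real) \<Rightarrow>
   real \<Rightarrow> real \<Rightarrow> real \<Rightarrow> 'n functional \<Rightarrow> real \<Rightarrow>
   nat \<Rightarrow> (nat \<Rightarrow> 'n idx set) \<Rightarrow> (nat \<Rightarrow> 'n idx set) \<Rightarrow> (nat \<Rightarrow> real) \<Rightarrow> (nat \<Rightarrow> real) \<Rightarrow>
   (nat \<Rightarrow> real^'n \<Rightarrow> complex) \<Rightarrow> (nat \<Rightarrow> 'n functional) \<Rightarrow> bool" where
  "dyn_gal_run \<Omega> \<nu> \<sigma> \<alpha>_lo \<alpha>_hi K \<phi> d C_Ainv \<eta>_tilde C0 f \<epsilon> n \<Lambda> M \<delta> J u r \<longleftrightarrow>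
     \<Lambda> 0 = {} \<and> u 0 = (\<lambda>x. 0) \<and> r 0 = f \<and>
     (\<forall>i\<le>n.
        let R0 = dual_phi_norm K \<phi> d (r 0);
            R = dual_phi_norm K \<phi> d (r i);
            \<theta> = sqrt (1 - C0\<^sup>2 * R\<^sup>2 / R0\<^sup>2);
            K1 = - (1 / \<eta>_tilde) * ln ((1 / sqrt (\<alpha>_lo * \<alpha>_hi)) * (C0 / C_Ainv)) + \<delta> i
        in minimal_doerfler_marking \<Omega> K \<phi> d \<theta> (r i) (M i) \<and>
           0 \<le> \<delta> i \<and> \<delta> i < 1 \<and>
           0 < J i \<and>
           J i = - (1 / \<eta>_tilde) * ln (R / R0) + K1 \<and>
           C_Ainv * exp (- \<eta>_tilde * J i) \<le> sqrt ((1 - \<theta>\<^sup>2) / (\<alpha>_lo * \<alpha>_hi)) \<and>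
           \<Lambda> (Suc i) = \<Lambda> i \<union> enrich K (J i) (M i) \<and>
           galerkin_solution \<Omega> \<nu> \<sigma> \<phi> f (\<Lambda> (Suc i)) (u (Suc i)) \<and>
           r (Suc i) = residual \<Omega> \<nu> \<sigma> f (u (Suc i))) \<and>
     (\<forall>i<n. dual_phi_norm K \<phi> d (r (Suc i)) > \<epsilon> * dual_phi_norm K \<phi> d (r 0)) \<and>
     dual_phi_norm K \<phi> d (r (Suc n)) \<le> \<epsilon> * dual_phi_norm K \<phi> d (r 0)"

text \<open>The linear solver enters through the cost constant \<open>C_sharp\<close> only.\<close>

definition workload :: "real \<Rightarrow> nat \<Rightarrow> (nat \<Rightarrow> 'i set) \<Rightarrow> real" where
  "workload C_sharp n \<Lambda> = (\<Sum>i\<le>n. C_sharp * real (card (\<Lambda> (Suc i))))"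

end

theory Submission
  imports Defs "HOL-Computational_Algebra.Polynomial"
begin

text \<open>
  All constants may be generous, so it suffices to bound \<open>|\<Lambda>|\<close> and the number of iterations by
  powers of \<open>ln (C X / \<epsilon>)\<close>; a small \<open>t_low\<close> and small \<open>\<eta>_low\<close>, \<open>\<eta>_upp\<close> absorb the degree and the constants.

  Iterations: \<open>\<Lambda> (Suc i)\<close> contains the marked set and the marking parameter is at least
  \<open>sqrt (15/16)\<close>, so already the classical Doerfler argument gives linear convergence of the energy
  error and \<open>O(1 + ln (1 / \<epsilon>))\<close> iterations; the radii \<open>J i\<close> are of the same order.

  Marked sets: for \<open>T\<close> a best \<open>N\<close>-term index set of \<open>u\<close>, a Combes--Thomas argument (testing the
  Galerkin equation with the iterate multiplied by an exponential weight in the distance from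
  \<open>T\<close>) shows that the residual of every Galerkin solution is exponentially small away from \<open>T\<close>. Hence a
  neighbourhood of \<open>T\<close> of cardinality polynomial in \<open>ln (C X / \<epsilon>)\<close> satisfies the Doerfler
  condition, and by minimality it bounds the size of the marked set.

  On the side of function spaces, this needs that weak gradients are unique almost everywhere
  and that \<open>V\<close> is a vector space, hence that smooth functions have their classical gradient as
  weak gradient.
\<close>

section \<open>Smooth functions\<close>

text \<open>The marking parameter depends on the current residual: \<open>1 - \<theta>^2\<close>
  equals \<open>(C0 * R / R0)^2\<close>, so the part of the residual left unmarked may only have
  size \<open>C0 * R^2 / R0\<close>. Before termination \<open>R\<close> exceeds
  \<open>\<epsilon> * R0\<close>, hence this tolerance is at least
  \<open>C0 * \<epsilon>^2 * R0\<close>. Since the residual tail is exponentially small, replacing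
  \<epsilon> by its square costs at most one more summand \<open>ln (1 / \<epsilon>)\<close> in the
  logarithm, and therefore a single scale \<open>y = ln (C_low * X / \<epsilon>)\<close> controls
  marked sets, radii and iteration numbers alike.

  Every estimate ends as a constant times a power of \<open>y\<close>. Because \<open>X\<close> is
  bounded below by a constant of the setting, \<open>C_low\<close> can be chosen so that
  \<open>y\<close> is at least 1; then a small factor in the denominator absorbs the constant and a
  large exponent \<open>d / t_low\<close> absorbs the degree. Summing the costs over the iterations
  adds one power of \<open>y\<close>, which is reserved in \<open>t_low\<close> from the start, so
  that both cardinality and workload share it. The logarithm in the workload bound then only has to
  dominate \<open>y\<close>.\<close>

lemma partial_deriv_eqI: "(f has_derivative f') (at x) \<Longrightarrow> partial_deriv i f x = f' (axis i 1)"
  unfolding partial_deriv_def by (metis frechet_derivative_at)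

lemma partial_deriv_const: "partial_deriv i (\<lambda>x. c) = (\<lambda>x. 0)"
  using partial_deriv_eqI[OF has_derivative_const] by fastforce

lemma partial_deriv_add:
  assumes "f differentiable (at x)" "g differentiable (at x)"
  shows "partial_deriv i (\<lambda>x. f x + g x) x = partial_deriv i f x + partial_deriv i g x"
  using partial_deriv_eqI[OF has_derivative_add[OF assms[unfolded frechet_derivative_works]]]
  by (simp add: partial_deriv_def)

lemma partial_deriv_mult:
  assumes "f differentiable (at x)" "g differentiable (at x)"
  shows "partial_deriv i (\<lambda>x. f x * g x) x = f x * partial_deriv i g x + partial_deriv i f x * g x"
  using partial_deriv_eqI[OF has_derivative_mult[OF assms[unfolded frechet_derivative_works]]]
  by (simp add: partial_deriv_def)

lemma smooth_differentiable: "smooth f \<Longrightarrow> f differentiable (at x)"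
  by (erule smooth.cases) auto

lemma smooth_partial_deriv: "smooth f \<Longrightarrow> smooth (partial_deriv i f)"
  by (erule smooth.cases) auto

text \<open>Coinduction for \<open>smooth\<close> needs a family closed under partial derivatives.
  By the Leibniz rule a product leaves the family of its factors, but the generated algebra stays
  invariant as soon as the derivatives of the generators lie in it: coinduction up to sums and
  products.\<close>

inductive algebra_hull :: "((real^'n::finite \<Rightarrow> complex) \<Rightarrow> bool) \<Rightarrow> (real^'n \<Rightarrow> complex) \<Rightarrow> bool"
  for P where
  base: "P f \<Longrightarrow> algebra_hull P f"
| const: "algebra_hull P (\<lambda>x. c)"
| add: "algebra_hull P f \<Longrightarrow> algebra_hull P g \<Longrightarrow> algebra_hull P (\<lambda>x. f x + g x)"
| mult: "algebra_hull P f \<Longrightarrow> algebra_hull P g \<Longrightarrow> algebra_hull P (\<lambda>x. f x * g x)"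

lemma algebra_hull_smooth:
  fixes P :: "(real^'n::finite \<Rightarrow> complex) \<Rightarrow> bool"
  assumes diff: "\<And>f x. P f \<Longrightarrow> f differentiable (at x)"
    and pd: "\<And>f i. P f \<Longrightarrow> algebra_hull P (partial_deriv i f)"
    and "algebra_hull P f"
  shows "smooth f"
proof -
  have step: "(\<forall>x. f differentiable (at x)) \<and> (\<forall>i. algebra_hull P (partial_deriv i f))"
    if "algebra_hull P f" for f
    using that
  proof induction
    case (base f)
    then show ?case using diff pd by auto
  next
    case (const c)
    then show ?case by (auto simp: partial_deriv_const intro: algebra_hull.const)
  next
    case (add f g)
    then have "partial_deriv i (\<lambda>x. f x + g x) = (\<lambda>x. partial_deriv i f x + partial_deriv i g x)" for i
      by (auto simp: partial_deriv_add)
    then show ?case using add by (auto intro: algebra_hull.add)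
  next
    case (mult f g)
    then have "partial_deriv i (\<lambda>x. f x * g x)
        = (\<lambda>x. f x * partial_deriv i g x + partial_deriv i f x * g x)" for i
      by (auto simp: partial_deriv_mult)
    then show ?case using mult by (auto intro!: algebra_hull.add algebra_hull.mult)
  qed
  show ?thesis using assms(3)
  proof (coinduction arbitrary: f)
    case smooth
    then show ?case using step by blast
  qed
qed

lemma smooth_const: "smooth (\<lambda>x::real^'n::finite. c)"
  and smooth_add: "smooth f \<Longrightarrow> smooth g \<Longrightarrow> smooth (\<lambda>x::real^'n::finite. f x + g x)"
  and smooth_mult: "smooth f \<Longrightarrow> smooth g \<Longrightarrow> smooth (\<lambda>x::real^'n::finite. f x * g x)"
proof -
  have hull: "smooth h" if "algebra_hull smooth h" for h :: "real^'n \<Rightarrow> complex"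
  proof (rule algebra_hull_smooth[OF _ _ that])
    show "f differentiable (at x)" if "smooth f" for f :: "real^'n \<Rightarrow> complex" and x
      using that by (rule smooth_differentiable)
    show "algebra_hull smooth (partial_deriv i f)" if "smooth f" for f :: "real^'n \<Rightarrow> complex" and i
      by (rule algebra_hull.base) (rule smooth_partial_deriv[OF that])
  qed
  fix f g :: "real^'n \<Rightarrow> complex" and c
  show "smooth (\<lambda>x::real^'n. c)"
    by (rule hull[OF algebra_hull.const])
  assume "smooth f" "smooth g"
  then have "algebra_hull smooth f" "algebra_hull smooth g"
    using algebra_hull.base[of smooth f] algebra_hull.base[of smooth g] by auto
  then show "smooth (\<lambda>x. f x + g x)" "smooth (\<lambda>x. f x * g x)"
    by (auto intro: hull algebra_hull.add algebra_hull.mult)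
qed

lemma smooth_cmult: "smooth f \<Longrightarrow> smooth (\<lambda>x. c * f x)"
  by (intro smooth_mult smooth_const)

lemma smooth_prod: "(\<And>i. i \<in> A \<Longrightarrow> smooth (f i)) \<Longrightarrow> smooth (\<lambda>x. \<Prod>i\<in>A. f i x)"
  by (induction A rule: infinite_finite_induct) (auto intro: smooth_const smooth_mult)

lemma smooth_continuous: "smooth f \<Longrightarrow> continuous_on A f"
  by (meson continuous_at_imp_continuous_on differentiable_imp_continuous_within smooth_differentiable)

lemma smooth_borel: "smooth f \<Longrightarrow> f \<in> borel_measurable borel"
  by (rule borel_measurable_continuous_onI[OF smooth_continuous])

text \<open>The classical flat function \<open>exp (- 1 / s)\<close>, extended by zero, together
  with all polynomial factors in \<open>1 / s\<close> that its derivatives produce. The polynomial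
  as a parameter makes the family closed under differentiation.\<close>

definition flat :: "real poly \<Rightarrow> real \<Rightarrow> real" where
  "flat p s = (if 0 < s then poly p (1 / s) * exp (- (1 / s)) else 0)"

lemma flat_tendsto_0: "(flat p \<longlongrightarrow> 0) (at 0)"
proof -
  have "((\<lambda>y. \<Sum>i\<le>degree p. coeff p i * (y ^ i / exp y)) \<longlongrightarrow> (\<Sum>i\<le>degree p. coeff p i * 0)) at_top"
    by (intro tendsto_intros tendsto_power_div_exp_0)
  moreover have "(\<Sum>i\<le>degree p. coeff p i * (y ^ i / exp y)) = poly p y * exp (- y)" for y
    by (simp add: poly_altdef sum_distrib_right exp_minus divide_inverse mult.assoc)
  ultimately have "((\<lambda>y. poly p y * exp (- y)) \<longlongrightarrow> 0) at_top"
    by simp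
  from filterlim_compose[OF this filterlim_inverse_at_top_right]
  have "((\<lambda>s. poly p (1 / s) * exp (- (1 / s))) \<longlongrightarrow> 0) (at_right 0)"
    by (simp add: divide_inverse)
  then have "(flat p \<longlongrightarrow> 0) (at_right 0)"
    by (rule Lim_transform_eventually) (auto simp: eventually_at_right_field flat_def intro: exI[of _ 1])
  moreover have "(flat p \<longlongrightarrow> 0) (at_left 0)"
    by (rule Lim_transform_eventually[OF tendsto_const])
      (auto simp: eventually_at_left_field flat_def intro: exI[of _ "-1"])
  ultimately show ?thesis
    using filterlim_split_at by blast
qed

text \<open>With \<open>y = 1 / s\<close> the derivative of \<open>p(y) * exp (- y)\<close> in
  \<open>s\<close> is \<open>y^2 * (p(y) - p'(y)) * exp (- y)\<close>, which is the member of the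
  family for the polynomial \<open>X^2 * (p - p')\<close>.\<close>

lemma flat_has_derivative:
  "(flat p has_real_derivative flat ([:0, 0, 1:] * (p - pderiv p)) s) (at s)"
proof -
  consider "s < 0" | "s = 0" | "0 < s" by linarith
  then show ?thesis
  proof cases
    case 1
    have "((\<lambda>s. 0) has_real_derivative 0) (at s)" by simp
    then have "(flat p has_real_derivative 0) (at s)"
      by (rule DERIV_cong_ev[THEN iffD1, rotated -1])
        (use 1 eventually_nhds_in_open[of "{..<0}" s] in \<open>auto simp: flat_def elim!: eventually_mono\<close>)
    then show ?thesis using 1 by (simp add: flat_def)
  next
    case 2
    have "((\<lambda>h. (flat p (0 + h) - flat p 0) / h) \<longlongrightarrow> 0) (at 0)"
      \<comment> \<open>Dividing by \<open>h\<close> multiplies the polynomial by its variable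
        \<open>1 / h\<close>, so the difference quotient at 0 is again a flat function, namely the
        one for \<open>pCons 0 p\<close>.\<close>
      by (rule Lim_transform_eventually[OF flat_tendsto_0[of "pCons 0 p"]])
        (auto simp: flat_def eventually_at_filter)
    then show ?thesis using 2 by (simp add: DERIV_def flat_def)
  next
    case 3
    have "((\<lambda>s. poly p (1 / s) * exp (- (1 / s))) has_real_derivative
        flat ([:0, 0, 1:] * (p - pderiv p)) s) (at s)"
      using 3 by (auto intro!: derivative_eq_intros DERIV_chain'[OF _ poly_DERIV]
          simp: flat_def field_simps power2_eq_square)
    then show ?thesis
      by (rule DERIV_cong_ev[THEN iffD1, rotated -1])
        (use 3 eventually_nhds_in_open[of "{0<..}" s] in \<open>auto simp: flat_def elim!: eventually_mono\<close>)
  qed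
qed

text \<open>A partial derivative of a flat function of one affine coordinate is a constant times
  another such function; the constant vanishes unless the direction is \<open>j\<close>. Hence the
  algebra generated by them is invariant.\<close>

lemma smooth_flat: "smooth (\<lambda>x::real^'n::finite. complex_of_real (flat p (\<alpha> * x $ j + \<beta>)))"
proof -
  define B where "B p = (\<lambda>x::real^'n. complex_of_real (flat p (\<alpha> * x $ j + \<beta>)))" for p
  have der: "(B p has_derivative (\<lambda>h. complex_of_real
      (\<alpha> * h $ j * flat ([:0, 0, 1:] * (p - pderiv p)) (\<alpha> * x $ j + \<beta>)))) (at x)" for p x
  proof -
    have "((\<lambda>x. flat p (\<alpha> * x $ j + \<beta>)) has_derivative
        (\<lambda>h. \<alpha> * h $ j * flat ([:0, 0, 1:] * (p - pderiv p)) (\<alpha> * x $ j + \<beta>))) (at x)"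
    proof -
      have "((\<lambda>x. \<alpha> * x $ j + \<beta>) has_derivative (\<lambda>h. \<alpha> * h $ j)) (at x)"
        by (auto intro!: derivative_eq_intros bounded_linear.has_derivative[OF bounded_linear_vec_nth])
      from has_derivative_compose[OF this flat_has_derivative[unfolded has_field_derivative_def], of p]
      show ?thesis
        by (simp only: mult.commute)
    qed
    then show ?thesis
      unfolding B_def by (rule bounded_linear.has_derivative[OF bounded_linear_of_real])
  qed
  let ?P = "\<lambda>f. \<exists>p. f = B p"
  have "smooth (B p)"
  proof (rule algebra_hull_smooth[of ?P])
    fix f i assume "?P f"
    then obtain p where f: "f = B p" by blast
    have "partial_deriv i f = (\<lambda>x. complex_of_real (\<alpha> * axis i 1 $ j) * B ([:0, 0, 1:] * (p - pderiv p)) x)"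
      using partial_deriv_eqI[OF der] by (auto simp: f B_def)
    moreover have "algebra_hull ?P (\<lambda>x. complex_of_real (\<alpha> * axis i 1 $ j) * B ([:0, 0, 1:] * (p - pderiv p)) x)"
      by (intro algebra_hull.mult algebra_hull.const algebra_hull.base exI[of _ "[:0, 0, 1:] * (p - pderiv p)"]) (rule refl)
    ultimately show "algebra_hull ?P (partial_deriv i f)" by simp
  next
    show "algebra_hull ?P (B p)" by (rule algebra_hull.base) blast
  next
    fix f x assume "?P f"
    then show "f differentiable (at x)" using der unfolding differentiable_def by blast
  qed
  then show ?thesis by (simp add: B_def)
qed

section \<open>Smooth functions have weak gradients\<close>

lemma directional_difference_quotient:
  fixes F :: "'a::real_normed_vector \<Rightarrow> 'b::real_normed_vector"
  assumes F: "(F has_derivative D) (at x)" and h: "h \<longlonglongrightarrow> (0::real)" "\<And>m. 0 < h m"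
  shows "(\<lambda>m. (F (x + h m *\<^sub>R e) - F x) /\<^sub>R h m) \<longlonglongrightarrow> D e"
proof -
  have "((\<lambda>t. F (x + t *\<^sub>R e)) has_derivative (\<lambda>t. D (t *\<^sub>R e))) (at 0)"
  proof (rule has_derivative_compose[of "\<lambda>t. x + t *\<^sub>R e" "\<lambda>t. t *\<^sub>R e" 0 UNIV F D])
    show "((\<lambda>t. x + t *\<^sub>R e) has_derivative (\<lambda>t. t *\<^sub>R e)) (at 0)"
      by (auto intro!: derivative_eq_intros)
  qed (use F in simp)
  then have "((\<lambda>t. (F (x + t *\<^sub>R e) - F x - D (t *\<^sub>R e)) /\<^sub>R norm t) \<longlongrightarrow> 0) (at 0)"
    by (simp add: has_derivative_at_within)
  moreover have "filterlim h (at 0) sequentially"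
    using h by (auto simp: filterlim_at intro!: always_eventually) (metis less_irrefl)
  ultimately have "(\<lambda>m. (F (x + h m *\<^sub>R e) - F x - D (h m *\<^sub>R e)) /\<^sub>R norm (h m)) \<longlonglongrightarrow> 0"
    by (rule filterlim_compose)
  moreover have "(F (x + h m *\<^sub>R e) - F x - D (h m *\<^sub>R e)) /\<^sub>R norm (h m)
      = (F (x + h m *\<^sub>R e) - F x) /\<^sub>R h m - D e" for m
    using h(2)[of m] linear_cmul[OF has_derivative_linear[OF F]] by (simp add: algebra_simps)
  ultimately show ?thesis
    by (simp add: LIM_zero_iff)
qed

lemma integral_lborel_translation:
  fixes F :: "'a::euclidean_space \<Rightarrow> 'b::{banach, second_countable_topology}"
  assumes "F \<in> borel_measurable borel"
  shows "(LINT x|lborel. F (x + c)) = (LINT x|lborel. F x)"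
proof -
  have "(LINT x|lborel. F x) = (LINT x|distr lborel borel ((+) c). F x)"
    by (simp add: lborel_distr_plus)
  also have "\<dots> = (LINT x|lborel. F (c + x))"
    using assms by (intro integral_distr) auto
  finally show ?thesis by (simp add: add.commute)
qed

lemma partial_deriv_eq_0:
  assumes "closed S" "\<And>x. x \<notin> S \<Longrightarrow> F x = 0" "x \<notin> S"
  shows "partial_deriv i F x = 0"
proof -
  have "(F has_derivative (\<lambda>h. 0)) (at x)"
    by (rule has_derivative_transform_within_open[where s="- S" and f="\<lambda>_. 0"]) (use assms in auto)
  then show ?thesis by (rule partial_deriv_eqI)
qed

lemma integrable_compact_support:
  fixes F :: "'a::euclidean_space \<Rightarrow> 'b::{banach, second_countable_topology}"
  assumes "continuous_on UNIV F" "compact S" "\<And>x. x \<notin> S \<Longrightarrow> F x = 0"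
  shows "integrable lborel F"
proof -
  have "integrable lborel (\<lambda>x. indicator S x *\<^sub>R F x)"
    using assms continuous_on_subset[OF assms(1)] by (intro borel_integrable_compact) auto
  moreover have "(\<lambda>x. indicator S x *\<^sub>R F x) = F"
    using assms(3) by (auto simp: indicator_def)
  ultimately show ?thesis by simp
qed

text \<open>By translation invariance the difference quotients of \<open>F\<close> have integral zero.\<close>

lemma integral_partial_deriv_eq_0:
  assumes F: "smooth F" and S: "compact S" "\<And>x. x \<notin> S \<Longrightarrow> F x = 0"
  shows "(LINT x|lborel. partial_deriv i F x) = 0"
proof -
  define G where "G = partial_deriv i F"
  have G: "continuous_on UNIV G" "\<And>x. x \<notin> S \<Longrightarrow> G x = 0"
    using smooth_continuous[OF smooth_partial_deriv[OF F]]
      partial_deriv_eq_0[OF compact_imp_closed[OF S(1)] S(2)]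
    by (auto simp: G_def)
  obtain L where L: "\<And>x. norm (G x) \<le> L"
  proof -
    have "bounded (G ` S)"
      using G(1) S(1) by (meson compact_continuous_image compact_imp_bounded continuous_on_subset subset_UNIV)
    then obtain B where "\<And>x. x \<in> S \<Longrightarrow> norm (G x) \<le> B"
      by (auto simp: bounded_iff)
    then have "norm (G x) \<le> max B 0" for x
      using G(2) by (cases "x \<in> S") (auto simp: le_max_iff_disj)
    then show ?thesis using that by blast
  qed
  obtain R where R: "\<And>x. x \<in> S \<Longrightarrow> norm x \<le> R"
    using compact_imp_bounded[OF S(1)] by (auto simp: bounded_iff)
  define e :: "real^'a" where "e = axis i 1"
  have e: "norm e = 1" by (simp add: e_def norm_axis_1)
  define h where "h m = 1 / real (Suc m)" for m
  have h: "h \<longlonglongrightarrow> 0" "\<And>m. 0 < h m" "\<And>m. h m \<le> 1"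
    using LIMSEQ_inverse_real_of_nat by (auto simp: h_def[abs_def] inverse_eq_divide)
  define D where "D m x = (F (x + h m *\<^sub>R e) - F x) /\<^sub>R h m" for m x
  have diff: "(F has_derivative (frechet_derivative F (at x))) (at x)" for x
    using smooth_differentiable[OF F] frechet_derivative_works by blast
  have lim: "(\<lambda>m. D m x) \<longlonglongrightarrow> G x" for x
    using directional_difference_quotient[OF diff h(1,2)]
    unfolding D_def G_def partial_deriv_def e_def .
  \<comment> \<open>Majorant for dominated convergence: the mean value theorem gives the bound
    \<open>L\<close>, and since the shifts have length at most 1, both values of \<open>F\<close>
    vanish outside the ball of radius \<open>R + 1\<close>.\<close>
  have bound: "norm (D m x) \<le> L * indicator (cball 0 (R + 1)) x" for m x
  proof (cases "norm x \<le> R + 1")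
    case True
    have "norm (F (x + h m *\<^sub>R e) - F (x + 0 *\<^sub>R e)) \<le> L * norm (h m - 0)"
    proof (rule differentiable_bound)
      fix t :: real
      show "((\<lambda>t. F (x + t *\<^sub>R e)) has_derivative (\<lambda>s. s *\<^sub>R G (x + t *\<^sub>R e))) (at t within UNIV)"
      proof -
        have "((\<lambda>t. x + t *\<^sub>R e) has_derivative (\<lambda>s. s *\<^sub>R e)) (at t)"
          by (auto intro!: derivative_eq_intros)
        from has_derivative_compose[OF this diff]
        show ?thesis
          using linear_cmul[OF has_derivative_linear[OF diff]]
          by (simp add: G_def partial_deriv_def e_def)
      qed
      show "onorm (\<lambda>s. s *\<^sub>R G (x + t *\<^sub>R e)) \<le> L"
        by (rule onorm_le) (use L in \<open>simp add: mult.commute[of L] mult_left_mono\<close>)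
    qed auto
    moreover have "norm (D m x) = norm (F (x + h m *\<^sub>R e) - F x) / h m"
      using h(2)[of m] by (simp add: D_def divide_inverse mult.commute)
    ultimately show ?thesis
      using True h(2)[of m] by (simp add: pos_divide_le_eq)
  next
    case False
    have "norm x - norm (h m *\<^sub>R e) \<le> norm (x + h m *\<^sub>R e)"
      by (metis add.commute norm_diff_ineq)
    then have "norm (x + h m *\<^sub>R e) > R"
      using False h(2)[of m] h(3)[of m] e by simp
    then have "F (x + h m *\<^sub>R e) = 0" "F x = 0"
      using False R S(2) by (force, force)
    then show ?thesis
      using False by (simp add: D_def)
  qed
  have int: "integrable lborel F"
    by (rule integrable_compact_support[OF smooth_continuous[OF F] S])
  have meas: "F \<in> borel_measurable borel"
    by (rule smooth_borel[OF F])
  have "(LINT x|lborel. D m x) = 0" for m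
  proof -
    have "integrable lborel (\<lambda>x. F (x + h m *\<^sub>R e))"
    proof (rule integrable_compact_support)
      show "continuous_on UNIV (\<lambda>x. F (x + h m *\<^sub>R e))"
        by (intro continuous_on_compose2[OF smooth_continuous[OF F, of UNIV]] continuous_intros) auto
      show "compact ((\<lambda>x. x - h m *\<^sub>R e) ` S)"
        by (intro compact_continuous_image continuous_intros S)
      show "F (x + h m *\<^sub>R e) = 0" if "x \<notin> (\<lambda>x. x - h m *\<^sub>R e) ` S" for x
        by (rule S(2)) (use that in \<open>auto simp: image_iff algebra_simps\<close>)
    qed
    then show ?thesis
      using int integral_lborel_translation[OF meas] unfolding D_def by simp
  qed
  moreover have "(\<lambda>m. LINT x|lborel. D m x) \<longlonglongrightarrow> (LINT x|lborel. G x)"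
  proof (rule integral_dominated_convergence[where w="\<lambda>x. L * indicator (cball 0 (R + 1)) x"])
    show "integrable lborel (\<lambda>x. L * indicator (cball 0 (R + 1)) x)"
      by (intro integrable_mult_right integrable_real_indicator) (use emeasure_lborel_cball_finite[of 0 "R + 1"] in simp_all)
    show "G \<in> borel_measurable lborel"
      using borel_measurable_continuous_onI[OF G(1)] by simp
    show "D m \<in> borel_measurable lborel" for m
      using meas unfolding D_def by measurable
  qed (use lim bound in auto)
  ultimately show ?thesis
    by (simp add: G_def LIMSEQ_const_iff)
qed

section \<open>Square-integrable functions and integration by parts\<close>

lemma L2_integrable_mult:
  assumes "f \<in> L2 \<Omega>" "g \<in> L2 \<Omega>"
  shows "integrable (lebesgue_on \<Omega>) (\<lambda>x. f x * g x)"
proof (rule Bochner_Integration.integrable_bound)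
  show "integrable (lebesgue_on \<Omega>) (\<lambda>x. (cmod (f x))\<^sup>2 + (cmod (g x))\<^sup>2)"
    using assms by (auto simp: L2_def)
  show "(\<lambda>x. f x * g x) \<in> borel_measurable (lebesgue_on \<Omega>)"
    using assms by (auto simp: L2_def)
  have "cmod (f x) * cmod (g x) \<le> (cmod (f x))\<^sup>2 + (cmod (g x))\<^sup>2" for x
    using sum_squares_bound[of "cmod (f x)" "cmod (g x)"]
      mult_nonneg_nonneg[of "cmod (f x)" "cmod (g x)"] by (simp del: mult_nonneg_nonneg)
  then show "AE x in lebesgue_on \<Omega>. norm (f x * g x) \<le> norm ((cmod (f x))\<^sup>2 + (cmod (g x))\<^sup>2)"
    by (auto simp: norm_mult)
qed

lemma L2_cnj: "f \<in> L2 \<Omega> \<Longrightarrow> (\<lambda>x. cnj (f x)) \<in> L2 \<Omega>"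
  using measurable_compose[OF _ borel_measurable_continuous_onI[of cnj], of f]
  by (auto simp: L2_def intro: continuous_intros)

lemma L2_cmult: "f \<in> L2 \<Omega> \<Longrightarrow> (\<lambda>x. c * f x) \<in> L2 \<Omega>"
  by (auto simp: L2_def norm_mult power_mult_distrib)

lemma L2_add:
  assumes f: "f \<in> L2 \<Omega>" and g: "g \<in> L2 \<Omega>"
  shows "(\<lambda>x. f x + g x) \<in> L2 \<Omega>"
proof -
  have *: "(cmod (f x + g x))\<^sup>2 = (cmod (f x))\<^sup>2 + (cmod (g x))\<^sup>2 + 2 * Re (f x * cnj (g x))" for x
    unfolding cmod_power2 by (simp add: power2_eq_square algebra_simps)
  have "integrable (lebesgue_on \<Omega>) (\<lambda>x. Re (f x * cnj (g x)))"
    by (rule integrable_Re[OF L2_integrable_mult[OF f L2_cnj[OF g]]])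
  then show ?thesis
    unfolding L2_def mem_Collect_eq *
    using f g by (intro conjI Bochner_Integration.integrable_add integrable_mult_right borel_measurable_add) (auto simp: L2_def)
qed

lemma L2_smooth:
  assumes "smooth f" shows "f \<in> L2 (box a b)"
proof -
  have cont: "continuous_on S f" for S by (rule smooth_continuous[OF assms])
  have meas: "f \<in> borel_measurable (lebesgue_on (box a b))"
    by (rule continuous_imp_measurable_on_sets_lebesgue[OF cont]) simp
  obtain B where B: "\<And>x. x \<in> cbox a b \<Longrightarrow> cmod (f x) \<le> B"
    using compact_imp_bounded[OF compact_continuous_image[OF cont compact_cbox]]
    by (fastforce simp: bounded_iff)
  have "integrable (lebesgue_on (box a b)) (\<lambda>x. (cmod (f x))\<^sup>2)"
  proof (rule finite_measure.integrable_const_bound[where B="B\<^sup>2"])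
    show "finite_measure (lebesgue_on (box a b))"
      by (rule finite_measure_lebesgue_on) simp
    show "AE x in lebesgue_on (box a b). norm ((cmod (f x))\<^sup>2) \<le> B\<^sup>2"
      by (rule AE_I2) (use B box_subset_cbox[of a b] in \<open>auto simp: space_restrict_space intro!: power_mono\<close>)
  qed (use meas in measurable)
  with meas show ?thesis by (simp add: L2_def)
qed

text \<open>Integration by parts: the product with a test function has compact support inside the
  box, so the integral of its partial derivative over the box is an integral over the whole space,
  and that vanishes.\<close>

lemma weak_gradient_smooth:
  assumes \<psi>: "smooth \<psi>"
  shows "weak_gradient (box a b) \<psi> (\<lambda>x. \<chi> i. partial_deriv i \<psi> x)"
  unfolding weak_gradient_def
proof (intro allI conjI ballI)
  fix i
  show "(\<lambda>x. (\<chi> i. partial_deriv i \<psi> x) $ i) \<in> L2 (box a b)"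
    by (simp add: L2_smooth[OF smooth_partial_deriv[OF \<psi>]])
  fix w assume "w \<in> test_functions (box a b)"
  define S where "S = closure {x. w x \<noteq> 0}"
  have w: "smooth w" and S: "compact S" "S \<subseteq> box a b" and S0: "\<And>x. x \<notin> S \<Longrightarrow> w x = 0"
    using \<open>w \<in> _\<close> closure_subset[of "{x. w x \<noteq> 0}"] by (auto simp: test_functions_def S_def)
  let ?M = "lebesgue_on (box a b)"
  let ?F = "\<lambda>x. \<psi> x * w x"
  have F: "smooth ?F" by (rule smooth_mult[OF \<psi> w])
  have pd: "partial_deriv i ?F x = \<psi> x * partial_deriv i w x + partial_deriv i \<psi> x * w x" for x
    by (simp add: partial_deriv_mult smooth_differentiable \<psi> w)
  have zero: "partial_deriv i ?F x = 0" if "x \<notin> S" for x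
    by (rule partial_deriv_eq_0[OF compact_imp_closed[OF S(1)] _ that]) (simp add: S0)
  have "(LINT x|?M. \<psi> x * partial_deriv i w x) + (LINT x|?M. partial_deriv i \<psi> x * w x)
      = (LINT x|?M. partial_deriv i ?F x)"
    unfolding pd by (intro Bochner_Integration.integral_add[symmetric] L2_integrable_mult L2_smooth
        smooth_partial_deriv \<psi> w)
  also have "\<dots> = (LINT x|lebesgue. indicator (box a b) x *\<^sub>R partial_deriv i ?F x)"
    by (rule integral_restrict_space) simp
  also have "\<dots> = (LINT x|lebesgue. partial_deriv i ?F x)"
    by (rule Bochner_Integration.integral_cong) (use zero S(2) in \<open>auto simp: indicator_def\<close>)
  also have "\<dots> = (LINT x|lborel. partial_deriv i ?F x)"
    by (rule integral_completion) (simp add: smooth_borel[OF smooth_partial_deriv[OF F]])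
  also have "\<dots> = 0"
    by (rule integral_partial_deriv_eq_0[OF F S(1)]) (simp add: S0)
  finally show "(LINT x|?M. \<psi> x * partial_deriv i w x)
      = - (LINT x|?M. (\<chi> i. partial_deriv i \<psi> x) $ i * w x)"
    by (simp add: eq_neg_iff_add_eq_0)
qed

lemma smooth_H1: "smooth \<psi> \<Longrightarrow> \<psi> \<in> H1 (box a b)"
  unfolding H1_def using L2_smooth weak_gradient_smooth by blast

section \<open>Uniqueness of weak gradients\<close>

text \<open>The shift by \<open>1\<close> keeps the support in a compact subset of the open box \<open>box c d\<close>.\<close>

definition box_bump :: "real^'n::finite \<Rightarrow> real^'n \<Rightarrow> nat \<Rightarrow> real^'n \<Rightarrow> complex" where
  "box_bump c d m x = (\<Prod>i\<in>UNIV.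
     complex_of_real (flat 1 (real (Suc m) * x $ i + (- real (Suc m) * c $ i - 1))) *
     complex_of_real (flat 1 (- real (Suc m) * x $ i + (real (Suc m) * d $ i - 1))))"

lemma flat_1: "flat 1 s = (if 0 < s then exp (- (1 / s)) else 0)"
  by (simp add: flat_def)

lemma flat_1_bounds: "0 \<le> flat 1 s" "flat 1 s \<le> 1"
  by (auto simp: flat_1)

lemma flat_1_tendsto:
  assumes "0 < \<tau>"
  shows "(\<lambda>m. flat 1 (real (Suc m) * \<tau> - 1)) \<longlonglongrightarrow> 1"
proof -
  have lim: "filterlim (\<lambda>m. real (Suc m) * \<tau> - 1) at_top sequentially"
  proof -
    have "filterlim (\<lambda>m. \<tau> * real (Suc m)) at_top sequentially"
      by (rule filterlim_tendsto_pos_mult_at_top[OF tendsto_const assms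
            filterlim_compose[OF filterlim_real_sequentially filterlim_Suc]])
    from filterlim_tendsto_add_at_top[OF tendsto_const[of "- 1"] this]
    show ?thesis by (simp add: algebra_simps)
  qed
  have "((\<lambda>s::real. exp (- inverse s)) \<longlongrightarrow> exp (- 0)) at_top"
    by (intro tendsto_intros tendsto_inverse_0_at_top filterlim_ident)
  then have "((\<lambda>s::real. exp (- (1 / s))) \<longlongrightarrow> 1) at_top"
    by (simp add: inverse_eq_divide)
  then have "(flat 1 \<longlongrightarrow> 1) at_top"
    by (rule Lim_transform_eventually)
      (use eventually_gt_at_top[of "0::real"] in \<open>auto simp: flat_1 elim!: eventually_mono\<close>)
  from filterlim_compose[OF this lim] show ?thesis .
qed

lemma box_bump_bound: "cmod (box_bump c d m x) \<le> 1"
  unfolding box_bump_def prod_norm[symmetric]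
  by (rule prod_le_1) (use flat_1_bounds in \<open>auto simp: norm_mult abs_of_nonneg intro!: mult_le_one\<close>)

text \<open>Inside the box all arguments of the factors tend to infinity, where
  \<open>flat 1\<close> tends to 1. Outside, one coordinate violates a bound, and the corresponding
  argument is at most -1, so the product is zero for every \<open>m\<close>.\<close>

lemma box_bump_tendsto: "(\<lambda>m. box_bump c d m x) \<longlonglongrightarrow> indicator (box c d) x"
proof (cases "x \<in> box c d")
  case True
  have "(\<lambda>m. complex_of_real (flat 1 (real (Suc m) * (x $ i - c $ i) - 1)) *
      complex_of_real (flat 1 (real (Suc m) * (d $ i - x $ i) - 1))) \<longlonglongrightarrow> of_real 1 * of_real 1" for i
    using True by (intro tendsto_mult tendsto_of_real flat_1_tendsto) (auto simp: mem_box_cart)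
  then have "(\<lambda>m. box_bump c d m x) \<longlonglongrightarrow> (\<Prod>i\<in>(UNIV::'a set). of_real 1 * of_real 1)"
    unfolding box_bump_def by (intro tendsto_prod) (auto simp: algebra_simps)
  then show ?thesis using True by simp
next
  case False
  then obtain i where i: "x $ i \<le> c $ i \<or> d $ i \<le> x $ i"
    by (auto simp: mem_box_cart not_less)
  have "box_bump c d m x = 0" for m
  proof -
    have "real (Suc m) * x $ i + (- real (Suc m) * c $ i - 1) \<le> 0 \<or>
        - real (Suc m) * x $ i + (real (Suc m) * d $ i - 1) \<le> 0"
      using i
    proof
      assume "x $ i \<le> c $ i"
      from mult_left_mono[OF this of_nat_0_le_iff[of "Suc m"]] show ?thesis by linarith
    next
      assume "d $ i \<le> x $ i"
      from mult_left_mono[OF this of_nat_0_le_iff[of "Suc m"]] show ?thesis by linarith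
    qed
    then show ?thesis
      unfolding box_bump_def by (intro prod_zero bexI[of _ i]) (auto simp: flat_1 simp del: of_nat_Suc)
  qed
  then show ?thesis using False by simp
qed

lemma box_bump_test_function:
  assumes "box c d \<subseteq> \<Omega>"
  shows "box_bump c d m \<in> test_functions \<Omega>"
proof -
  \<comment> \<open>A nonzero product forces every coordinate to keep distance more than
    \<open>1 / (m + 1)\<close> from both faces, so the support lies in the box shrunk by this
    amount.\<close>
  let ?s = "1 / real (Suc m)"
  let ?S = "cbox (\<chi> i. c $ i + ?s) (\<chi> i. d $ i - ?s)"
  have "x \<in> ?S" if "box_bump c d m x \<noteq> 0" for x
  proof -
    have "0 < real (Suc m) * x $ i + (- real (Suc m) * c $ i - 1)"
      "0 < - real (Suc m) * x $ i + (real (Suc m) * d $ i - 1)" for i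
      using that by (auto simp: box_bump_def flat_1 simp del: of_nat_Suc split: if_splits)
    then show ?thesis
      by (auto simp: mem_box_cart field_simps less_imp_le simp del: of_nat_Suc)
  qed
  then have S: "closure {x. box_bump c d m x \<noteq> 0} \<subseteq> ?S"
    by (intro closure_minimal) auto
  moreover have "?S \<subseteq> box c d"
  proof
    fix x assume "x \<in> ?S"
    then have "c $ i + ?s \<le> x $ i" "x $ i \<le> d $ i - ?s" for i
      by (simp_all add: mem_box_cart)
    moreover have "0 < ?s" by simp
    ultimately have "c $ i < x $ i" "x $ i < d $ i" for i
      by (smt (verit))+
    then show "x \<in> box c d"
      by (simp add: mem_box_cart)
  qed
  moreover have "compact (closure {x. box_bump c d m x \<noteq> 0})"
    using S by (meson bounded_cbox bounded_subset closed_closure compact_eq_bounded_closed)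
  moreover have "smooth (box_bump c d m)"
    unfolding box_bump_def by (intro smooth_prod smooth_mult smooth_flat)
  ultimately show ?thesis
    using assms by (simp add: test_functions_def)
qed

text \<open>Boxes form an intersection-stable generator of the Borel sets, and the sets over which
  the integral vanishes form a Dynkin system; complements use that the total integral is a box
  integral because \<open>H\<close> vanishes off \<open>box a b\<close>. The argument lives on Borel
  sets, hence the passage to a Borel version \<open>g\<close> of \<open>H\<close>.\<close>

lemma AE_0_if_box_integrals_0:
  fixes H :: "'a::euclidean_space \<Rightarrow> real"
  assumes H: "integrable lebesgue H" and out: "\<And>x. x \<notin> box a b \<Longrightarrow> H x = 0"
    and box: "\<And>c d. box c d \<subseteq> box a b \<Longrightarrow> (LINT x|lebesgue. indicator (box c d) x *\<^sub>R H x) = 0"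
  shows "AE x in lebesgue. H x = 0"
proof -
  obtain g where g: "g \<in> borel_measurable lborel" and AE: "AE x in lborel. H x = g x"
    using completion_ex_borel_measurable_real[of H lborel] H by auto
  have gint: "integrable lborel g"
    using H g integrable_completion[of g lborel] integrable_cong_AE[of H lebesgue g] AE_completion[OF AE]
    by (metis borel_measurable_integrable measurable_completion)
  have eq: "(LINT x:A|lborel. g x) = (LINT x|lebesgue. indicator A x *\<^sub>R H x)" if "A \<in> sets borel" for A
  proof -
    have "(LINT x:A|lborel. g x) = (LINT x|lebesgue. indicator A x *\<^sub>R g x)"
      unfolding set_lebesgue_integral_def by (rule integral_completion[symmetric]) (use g that in measurable)
    also have "\<dots> = (LINT x|lebesgue. indicator A x *\<^sub>R H x)"
    proof (rule integral_cong_AE)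
      show "(\<lambda>x. indicat_real A x *\<^sub>R g x) \<in> borel_measurable lebesgue"
        by (rule measurable_completion) (use g that in measurable)
      show "(\<lambda>x. indicat_real A x *\<^sub>R H x) \<in> borel_measurable lebesgue"
        using borel_measurable_integrable[OF H] that
        by (intro borel_measurable_scaleR borel_measurable_indicator) auto
      show "AE x in lebesgue. indicat_real A x *\<^sub>R g x = indicat_real A x *\<^sub>R H x"
        using AE_completion[OF AE] by eventually_elim simp
    qed
    finally show ?thesis .
  qed
  have boxes: "(LINT x:box c d|lborel. g x) = 0" for c d
  proof -
    obtain c' d' where cd: "box c d \<inter> box a b = box c' d'"
      by (simp add: box_Int_box)
    have "(LINT x:box c d|lborel. g x) = (LINT x|lebesgue. indicator (box c d) x *\<^sub>R H x)"
      by (rule eq) simp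
    also have "\<dots> = (LINT x|lebesgue. indicator (box c' d') x *\<^sub>R H x)"
      by (rule Bochner_Integration.integral_cong)
        (use out in \<open>auto simp: cd[symmetric] indicator_def\<close>)
    also have "\<dots> = 0" by (rule box) (use cd in blast)
    finally show ?thesis .
  qed
  have total: "(LINT x|lborel. g x) = 0"
  proof -
    have "(LINT x|lborel. g x) = (LINT x:UNIV|lborel. g x)"
      by (simp add: set_lebesgue_integral_def)
    also have "\<dots> = (LINT x|lebesgue. indicator UNIV x *\<^sub>R H x)"
      by (rule eq) simp
    also have "\<dots> = (LINT x|lebesgue. indicator (box a b) x *\<^sub>R H x)"
      by (rule Bochner_Integration.integral_cong) (use out in \<open>auto simp: indicator_def\<close>)
    also have "\<dots> = 0" by (rule box) simp
    finally show ?thesis .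
  qed
  have sint: "set_integrable lborel A g" if "A \<in> sets borel" for A
    unfolding set_integrable_def using gint that by (intro integrable_mult_indicator) auto
  have "AE x in lborel. g x = 0"
  proof (rule sigma_finite_measure.density_zero[OF sigma_finite_lborel gint])
    fix A :: "'a set" assume "A \<in> sets lborel"
    then have A: "A \<in> sigma_sets UNIV (range (\<lambda>(a, b). box a b))"
      by (simp add: borel_eq_box)
    have "Int_stable (range (\<lambda>(a, b). box a b :: 'a set))"
      by (auto simp: Int_stable_def box_Int_box)
    moreover have "range (\<lambda>(a, b). box a b :: 'a set) \<subseteq> Pow UNIV" by auto
    ultimately show "(LINT x:A|lborel. g x) = 0"
      using A
    proof (induction rule: sigma_sets_induct_disjoint)
      case (basic A)
      then show ?case using boxes by auto
    next
      case empty
      then show ?case by (simp add: set_lebesgue_integral_def)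
    next
      case (compl A)
      then have A: "A \<in> sets borel" by (simp add: borel_eq_box)
      have "(LINT x:A \<union> (UNIV - A)|lborel. g x) = (LINT x:A|lborel. g x) + (LINT x:UNIV - A|lborel. g x)"
        by (rule set_integral_Un) (use sint A in auto)
      then show ?case using compl total by (simp add: set_lebesgue_integral_def)
    next
      case (union A)
      then have A: "\<And>i. A i \<in> sets borel" by (simp add: borel_eq_box subset_eq)
      have "(LINT x:(\<Union>i. A i)|lborel. g x) = (\<Sum>i. (LINT x:(A i)|lborel. g x))"
        by (rule lebesgue_integral_countable_add)
          (use A union(1) sint in \<open>auto simp: disjoint_family_on_def\<close>)
      then show ?case using union by simp
    qed
  qed
  with AE have "AE x in lborel. H x = 0" by eventually_elim simp
  then show ?thesis by (rule AE_completion)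
qed

text \<open>The bumps converge boundedly to the indicator of any sub-box, so dominated convergence
  with majorant \<open>cmod (h x)\<close> makes all box integrals of \<open>h\<close> vanish; real
  and imaginary part are then treated separately.\<close>

lemma fundamental_lemma_calculus_of_variations:
  assumes h: "integrable (lebesgue_on (box a b)) h"
    and zero: "\<And>\<psi>. \<psi> \<in> test_functions (box a b) \<Longrightarrow> (LINT x|lebesgue_on (box a b). h x * \<psi> x) = 0"
  shows "AE x in lebesgue_on (box a b). h x = 0"
proof -
  let ?M = "lebesgue_on (box a b)"
  define H where "H x = indicator (box a b) x *\<^sub>R h x" for x
  have H: "integrable lebesgue H"
    using h unfolding H_def by (simp add: integrable_restrict_space)
  have box: "(LINT x|lebesgue. indicator (box c d) x *\<^sub>R H x) = 0" if cd: "box c d \<subseteq> box a b" for c d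
  proof -
    have bump: "box_bump c d m \<in> test_functions (box a b)" for m
      by (rule box_bump_test_function[OF cd])
    have "(\<lambda>m. LINT x|?M. h x * box_bump c d m x) \<longlonglongrightarrow> (LINT x|?M. h x * indicator (box c d) x)"
    proof (rule integral_dominated_convergence[where w="\<lambda>x. cmod (h x)"])
      show "(\<lambda>x. h x * box_bump c d m x) \<in> borel_measurable ?M" for m
      proof (rule borel_measurable_times)
        show "box_bump c d m \<in> borel_measurable ?M"
          using bump[of m] by (intro continuous_imp_measurable_on_sets_lebesgue smooth_continuous)
            (auto simp: test_functions_def)
      qed (use h in auto)
      show "(\<lambda>x. h x * indicator (box c d) x) \<in> borel_measurable ?M"
        using h by (intro borel_measurable_times borel_measurable_indicator)
          (use cd in \<open>auto simp: sets_restrict_space intro!: image_eqI[of _ _ "box c d"]\<close>)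
      show "AE x in ?M. (\<lambda>m. h x * box_bump c d m x) \<longlonglongrightarrow> h x * indicator (box c d) x"
        by (intro AE_I2 tendsto_mult tendsto_const box_bump_tendsto)
      show "AE x in ?M. norm (h x * box_bump c d m x) \<le> cmod (h x)" for m
        using box_bump_bound[of c d m] by (intro AE_I2) (simp add: norm_mult mult_left_le)
    qed (use h in auto)
    then have "(LINT x|?M. h x * indicator (box c d) x) = 0"
      using zero[OF bump] by (simp add: LIMSEQ_const_iff)
    moreover have "(LINT x|?M. h x * indicator (box c d) x) = (LINT x|lebesgue. indicator (box c d) x *\<^sub>R H x)"
      by (subst integral_restrict_space)
        (auto simp: H_def indicator_def intro!: Bochner_Integration.integral_cong)
    ultimately show ?thesis by simp
  qed
  have int: "integrable lebesgue (\<lambda>x. indicator (box c d) x *\<^sub>R H x)" for c d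
    by (rule integrable_mult_indicator[OF _ H]) simp
  have "AE x in lebesgue. Re (H x) = 0" "AE x in lebesgue. Im (H x) = 0"
  proof -
    show "AE x in lebesgue. Re (H x) = 0"
    proof (rule AE_0_if_box_integrals_0[OF integrable_Re[OF H]])
      show "Re (H x) = 0" if "x \<notin> box a b" for x using that by (simp add: H_def)
      show "(LINT x|lebesgue. indicator (box c d) x *\<^sub>R Re (H x)) = 0" if "box c d \<subseteq> box a b" for c d
        using arg_cong[OF box[OF that], of Re] integral_Re[OF int[of c d]] by simp
    qed
    show "AE x in lebesgue. Im (H x) = 0"
    proof (rule AE_0_if_box_integrals_0[OF integrable_Im[OF H]])
      show "Im (H x) = 0" if "x \<notin> box a b" for x using that by (simp add: H_def)
      show "(LINT x|lebesgue. indicator (box c d) x *\<^sub>R Im (H x)) = 0" if "box c d \<subseteq> box a b" for c d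
        using arg_cong[OF box[OF that], of Im] integral_Im[OF int[of c d]] by simp
    qed
  qed
  then have "AE x in lebesgue. H x = 0"
    by eventually_elim (simp add: complex_eq_iff)
  then have "AE x in lebesgue. x \<in> box a b \<longrightarrow> h x = 0"
    by eventually_elim (auto simp: H_def)
  then show ?thesis
    by (subst AE_restrict_space_iff) auto
qed

text \<open>Since \<open>grad\<close> is an arbitrary choice among weak gradients, its additivity
  and homogeneity, and with them the sesquilinearity of the form, hold only through this
  uniqueness.\<close>

lemma weak_gradient_unique:
  assumes "weak_gradient (box a b) v G" "weak_gradient (box a b) v G'"
  shows "AE x in lebesgue_on (box a b). G x = G' x"
proof -
  let ?M = "lebesgue_on (box a b)"
  have "AE x in ?M. G x $ i - G' x $ i = 0" for i
  proof (rule fundamental_lemma_calculus_of_variations)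
    have G: "(\<lambda>x. G x $ i) \<in> L2 (box a b)" "(\<lambda>x. G' x $ i) \<in> L2 (box a b)"
      using assms by (auto simp: weak_gradient_def)
    have int: "integrable ?M (\<lambda>x. G x $ i * \<psi> x)" "integrable ?M (\<lambda>x. G' x $ i * \<psi> x)"
      if "smooth \<psi>" for \<psi>
      by (intro L2_integrable_mult G L2_smooth that)+
    show "integrable ?M (\<lambda>x. G x $ i - G' x $ i)"
      using int[OF smooth_const[of 1]] by auto
    fix \<psi> assume \<psi>: "\<psi> \<in> test_functions (box a b)"
    have "- (LINT x|?M. G x $ i * \<psi> x) = - (LINT x|?M. G' x $ i * \<psi> x)"
      using assms \<psi> unfolding weak_gradient_def by simp
    then show "(LINT x|?M. (G x $ i - G' x $ i) * \<psi> x) = 0"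
      using int[of \<psi>] \<psi> by (simp add: test_functions_def left_diff_distrib)
  qed
  then have "AE x in ?M. \<forall>i\<in>UNIV. G x $ i = G' x $ i"
    by (intro AE_finite_allI) auto
  then show ?thesis
    by eventually_elim (simp add: vec_eq_iff)
qed

section \<open>Hermitian forms and the energy space\<close>

lemma of_real_cmod_square: "(complex_of_real (cmod z))\<^sup>2 = z * cnj z"
  by (metis complex_norm_square of_real_power)

text \<open>Instantiated with unit coefficients for the Sobolev norm and with the given coefficients
  for the energy. The form is only semidefinite because elements are functions rather than classes.
  Symmetry is imposed on all functions since integration commutes with conjugation even where an
  integral does not exist.\<close>

locale hermitian_form =
  fixes V :: "('x \<Rightarrow> complex) set" and B :: "('x \<Rightarrow> complex) \<Rightarrow> ('x \<Rightarrow> complex) \<Rightarrow> complex"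
  assumes zero_mem: "(\<lambda>x. 0) \<in> V"
    and add_mem: "\<And>v w. v \<in> V \<Longrightarrow> w \<in> V \<Longrightarrow> (\<lambda>x. v x + w x) \<in> V"
    and cmult_mem: "\<And>c v. v \<in> V \<Longrightarrow> (\<lambda>x. c * v x) \<in> V"
    and add_left: "\<And>u v w. u \<in> V \<Longrightarrow> v \<in> V \<Longrightarrow> w \<in> V \<Longrightarrow> B (\<lambda>x. u x + v x) w = B u w + B v w"
    and cmult_left: "\<And>c u v. u \<in> V \<Longrightarrow> v \<in> V \<Longrightarrow> B (\<lambda>x. c * u x) v = c * B u v"
    and hermitian: "\<And>u v. B v u = cnj (B u v)"
    and nonneg: "\<And>v. v \<in> V \<Longrightarrow> 0 \<le> Re (B v v)"
begin

lemma add_right: "u \<in> V \<Longrightarrow> v \<in> V \<Longrightarrow> w \<in> V \<Longrightarrow> B w (\<lambda>x. u x + v x) = B w u + B w v"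
  by (metis add_left complex_cnj_add hermitian)

lemma cmult_right: "u \<in> V \<Longrightarrow> v \<in> V \<Longrightarrow> B v (\<lambda>x. c * u x) = cnj c * B v u"
  by (metis cmult_left complex_cnj_mult hermitian)

lemma diff_mem: "v \<in> V \<Longrightarrow> w \<in> V \<Longrightarrow> (\<lambda>x. v x - w x) \<in> V"
  using add_mem[OF _ cmult_mem[of w "-1"]] by simp

lemma sum_mem: "(\<And>k. k \<in> F \<Longrightarrow> f k \<in> V) \<Longrightarrow> (\<lambda>x. \<Sum>k\<in>F. c k * f k x) \<in> V"
  by (induction F rule: infinite_finite_induct) (simp_all add: zero_mem add_mem cmult_mem)

lemma diff_left: "u \<in> V \<Longrightarrow> v \<in> V \<Longrightarrow> w \<in> V \<Longrightarrow> B (\<lambda>x. u x - v x) w = B u w - B v w"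
  using add_left[of u "\<lambda>x. -1 * v x" w] cmult_left[of v w "-1"] cmult_mem[of v "-1"] by simp

lemma diff_right: "u \<in> V \<Longrightarrow> v \<in> V \<Longrightarrow> w \<in> V \<Longrightarrow> B w (\<lambda>x. u x - v x) = B w u - B w v"
  by (metis complex_cnj_diff diff_left hermitian)

lemma zero_left: "v \<in> V \<Longrightarrow> B (\<lambda>x. 0) v = 0"
  using cmult_left[OF zero_mem, of v 0] by simp

lemma sum_left:
  assumes "\<And>k. k \<in> F \<Longrightarrow> f k \<in> V" "v \<in> V"
  shows "B (\<lambda>x. \<Sum>k\<in>F. c k * f k x) v = (\<Sum>k\<in>F. c k * B (f k) v)"
  using assms
proof (induction F rule: infinite_finite_induct)
  case (insert k F)
  have "B (\<lambda>x. c k * f k x + (\<Sum>k\<in>F. c k * f k x)) v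
      = B (\<lambda>x. c k * f k x) v + B (\<lambda>x. \<Sum>k\<in>F. c k * f k x) v"
    using insert.prems by (intro add_left cmult_mem sum_mem) auto
  then show ?case
    using insert by (simp add: cmult_left)
qed (simp_all add: zero_left)

lemma sum_right:
  assumes "\<And>k. k \<in> F \<Longrightarrow> f k \<in> V" "v \<in> V"
  shows "B v (\<lambda>x. \<Sum>k\<in>F. c k * f k x) = (\<Sum>k\<in>F. cnj (c k) * B v (f k))"
proof -
  have "B v (\<lambda>x. \<Sum>k\<in>F. c k * f k x) = cnj (\<Sum>k\<in>F. c k * B (f k) v)"
    by (subst hermitian) (simp add: sum_left assms)
  also have "\<dots> = (\<Sum>k\<in>F. cnj (c k) * B v (f k))"
    by (simp add: hermitian[symmetric])
  finally show ?thesis .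
qed

text \<open>Expanding the form at \<open>u - s * z * v\<close> with \<open>z = B u v\<close> and
  real \<open>s\<close> gives a nonnegative real polynomial in \<open>s\<close>. Its value at
  \<open>1 / B v v\<close> is the claim; if \<open>B v v\<close> vanishes, the polynomial is affine
  and forces \<open>z = 0\<close>.\<close>

lemma Cauchy_Schwarz_square:
  assumes u: "u \<in> V" and v: "v \<in> V"
  shows "(cmod (B u v))\<^sup>2 \<le> Re (B u u) * Re (B v v)"
proof -
  define z where "z = B u v"
  have quad: "0 \<le> Re (B u u) - 2 * s * (cmod z)\<^sup>2 + s\<^sup>2 * (cmod z)\<^sup>2 * Re (B v v)" for s :: real
  proof -
    define w where "w = (\<lambda>x. complex_of_real s * z * v x)"
    have w: "w \<in> V" unfolding w_def using cmult_mem[OF v, of "complex_of_real s * z"] by simp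
    have uw: "B u w = complex_of_real (s * (cmod z)\<^sup>2)"
      using cmult_right[OF v u, of "complex_of_real s * z"]
      by (simp add: w_def z_def[symmetric] of_real_cmod_square mult_ac)
    have wv: "B w w = complex_of_real (s\<^sup>2 * (cmod z)\<^sup>2) * B v v"
    proof -
      have "B w w = cnj (complex_of_real s * z) * B w v"
        using cmult_right[OF v w, of "complex_of_real s * z"] by (simp only: w_def)
      also have "B w v = complex_of_real s * z * B v v"
        using cmult_left[OF v v, of "complex_of_real s * z"] by (simp only: w_def)
      finally show ?thesis
        by (simp add: power2_eq_square[of "complex_of_real s"] of_real_cmod_square mult_ac)
    qed
    have "0 \<le> Re (B (\<lambda>x. u x - w x) (\<lambda>x. u x - w x))"
      by (intro nonneg diff_mem u w)
    also have "B (\<lambda>x. u x - w x) (\<lambda>x. u x - w x) = B u u - B u w - cnj (B u w) + B w w"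
      using u w by (simp add: diff_left diff_right diff_mem hermitian[of w u])
    finally show ?thesis by (simp add: uw wv)
  qed
  show ?thesis
  proof (cases "Re (B v v) = 0")
    case True
    have "z = 0"
    proof (rule ccontr)
      assume "z \<noteq> 0"
      \<comment> \<open>For this value of \<open>s\<close> the affine polynomial equals -1.\<close>
      then have "2 * ((Re (B u u) + 1) / (2 * (cmod z)\<^sup>2)) * (cmod z)\<^sup>2 = Re (B u u) + 1" by simp
      then show False using quad[of "(Re (B u u) + 1) / (2 * (cmod z)\<^sup>2)"] True by simp
    qed
    then show ?thesis using True by (simp add: z_def)
  next
    case False
    then have pos: "0 < Re (B v v)" using nonneg[OF v] by simp
    have "0 \<le> Re (B u u) - (cmod z)\<^sup>2 / Re (B v v)"
      using quad[of "1 / Re (B v v)"] pos by (simp add: power2_eq_square field_simps)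
    then show ?thesis using pos by (simp add: z_def field_simps)
  qed
qed

abbreviation form_norm :: "('x \<Rightarrow> complex) \<Rightarrow> real" where
  "form_norm v \<equiv> sqrt (Re (B v v))"

lemma Cauchy_Schwarz:
  assumes "u \<in> V" "v \<in> V"
  shows "cmod (B u v) \<le> form_norm u * form_norm v"
proof -
  have "sqrt ((cmod (B u v))\<^sup>2) \<le> sqrt (Re (B u u) * Re (B v v))"
    by (rule real_sqrt_le_mono[OF Cauchy_Schwarz_square[OF assms]])
  then show ?thesis by (simp add: real_sqrt_mult)
qed

lemma form_norm_cmult: "v \<in> V \<Longrightarrow> form_norm (\<lambda>x. c * v x) = cmod c * form_norm v"
proof -
  assume v: "v \<in> V"
  have "B (\<lambda>x. c * v x) (\<lambda>x. c * v x) = complex_of_real ((cmod c)\<^sup>2) * B v v"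
    using v by (simp add: cmult_left cmult_right cmult_mem of_real_cmod_square mult_ac)
  then show ?thesis by (simp add: real_sqrt_mult)
qed

lemma form_norm_triangle:
  assumes "u \<in> V" "v \<in> V"
  shows "form_norm (\<lambda>x. u x + v x) \<le> form_norm u + form_norm v"
proof (rule real_le_lsqrt)
  have "B (\<lambda>x. u x + v x) (\<lambda>x. u x + v x) = B u u + B u v + cnj (B u v) + B v v"
    using assms by (simp add: add_left add_right add_mem hermitian[of v u])
  then have "Re (B (\<lambda>x. u x + v x) (\<lambda>x. u x + v x)) = Re (B u u) + 2 * Re (B u v) + Re (B v v)"
    by simp
  also have "\<dots> \<le> (form_norm u)\<^sup>2 + 2 * (form_norm u * form_norm v) + (form_norm v)\<^sup>2"
    using Cauchy_Schwarz[OF assms] complex_Re_le_cmod[of "B u v"] nonneg assms by simp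
  finally show "Re (B (\<lambda>x. u x + v x) (\<lambda>x. u x + v x)) \<le> (form_norm u + form_norm v)\<^sup>2"
    by (simp add: power2_eq_square algebra_simps)
qed (use assms nonneg in simp)

end

section \<open>Linearity of weak gradients and the form on the Sobolev space\<close>

lemma weak_gradient_add:
  assumes v: "v \<in> L2 (box a b)" "weak_gradient (box a b) v G"
    and w: "w \<in> L2 (box a b)" "weak_gradient (box a b) w G'"
  shows "weak_gradient (box a b) (\<lambda>x. v x + w x) (\<lambda>x. G x + G' x)"
proof -
  have G: "(\<lambda>x. G x $ i) \<in> L2 (box a b)" "(\<lambda>x. G' x $ i) \<in> L2 (box a b)" for i
    using v w by (auto simp: weak_gradient_def)
  have int: "integrable (lebesgue_on (box a b)) (\<lambda>x. f x * \<psi> x)"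
    if "f \<in> L2 (box a b)" "smooth \<psi>" for f \<psi>
    by (rule L2_integrable_mult[OF that(1) L2_smooth[OF that(2)]])
  show ?thesis
    unfolding weak_gradient_def
  proof (intro allI conjI ballI)
    fix i
    show "(\<lambda>x. (G x + G' x) $ i) \<in> L2 (box a b)"
      using L2_add[OF G] by simp
    fix \<psi> assume \<psi>: "\<psi> \<in> test_functions (box a b)"
    then have s: "smooth \<psi>" by (simp add: test_functions_def)
    show "(LINT x|lebesgue_on (box a b). (v x + w x) * partial_deriv i \<psi> x) =
        - (LINT x|lebesgue_on (box a b). (G x + G' x) $ i * \<psi> x)"
      using v w \<psi> int[OF v(1) smooth_partial_deriv[OF s]] int[OF w(1) smooth_partial_deriv[OF s]]
        int[OF G(1) s] int[OF G(2) s]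
      by (simp add: distrib_right weak_gradient_def)
  qed
qed

lemma weak_gradient_cmult:
  assumes "weak_gradient \<Omega> v G"
  shows "weak_gradient \<Omega> (\<lambda>x. c * v x) (\<lambda>x. c *s G x)"
  using assms by (auto simp: weak_gradient_def L2_cmult mult.assoc)

lemma weak_gradient_grad:
  assumes "v \<in> H1 \<Omega>"
  shows "weak_gradient \<Omega> v (grad \<Omega> v)"
proof -
  have "\<exists>G. weak_gradient \<Omega> v G" using assms by (simp add: H1_def)
  then show ?thesis unfolding grad_def by (rule someI_ex)
qed

lemma H1_imp_L2: "v \<in> H1 \<Omega> \<Longrightarrow> v \<in> L2 \<Omega>"
  by (simp add: H1_def)

lemma grad_L2: "v \<in> H1 \<Omega> \<Longrightarrow> (\<lambda>x. grad \<Omega> v x $ i) \<in> L2 \<Omega>"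
  using weak_gradient_grad by (auto simp: weak_gradient_def)

lemma H1_add: "v \<in> H1 (box a b) \<Longrightarrow> w \<in> H1 (box a b) \<Longrightarrow> (\<lambda>x. v x + w x) \<in> H1 (box a b)"
  unfolding H1_def using weak_gradient_add L2_add by blast

lemma H1_cmult: "v \<in> H1 \<Omega> \<Longrightarrow> (\<lambda>x. c * v x) \<in> H1 \<Omega>"
  unfolding H1_def using weak_gradient_cmult L2_cmult by blast

lemma grad_add:
  assumes "v \<in> H1 (box a b)" "w \<in> H1 (box a b)"
  shows "AE x in lebesgue_on (box a b). grad (box a b) (\<lambda>x. v x + w x) x = grad (box a b) v x + grad (box a b) w x"
  using assms by (intro weak_gradient_unique[OF weak_gradient_grad weak_gradient_add] H1_add
      H1_imp_L2 weak_gradient_grad)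

lemma grad_cmult:
  assumes "v \<in> H1 (box a b)"
  shows "AE x in lebesgue_on (box a b). grad (box a b) (\<lambda>x. c * v x) x = c *s grad (box a b) v x"
  using assms by (intro weak_gradient_unique[OF weak_gradient_grad weak_gradient_cmult] H1_cmult
      weak_gradient_grad)

locale form_coefficients =
  fixes a b :: "real^'n::finite" and \<nu> \<sigma> :: "real^'n \<Rightarrow> real" and \<Omega> and C
  defines "\<Omega> \<equiv> box a b"
  assumes meas: "\<nu> \<in> borel_measurable (lebesgue_on \<Omega>)" "\<sigma> \<in> borel_measurable (lebesgue_on \<Omega>)"
    and bounds: "\<And>x. x \<in> \<Omega> \<Longrightarrow> 0 \<le> \<nu> x \<and> \<nu> x \<le> C" "\<And>x. x \<in> \<Omega> \<Longrightarrow> 0 \<le> \<sigma> x \<and> \<sigma> x \<le> C"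
begin

lemma weighted_integrable:
  assumes \<tau>: "\<tau> \<in> borel_measurable (lebesgue_on \<Omega>)" "\<And>x. x \<in> \<Omega> \<Longrightarrow> 0 \<le> \<tau> x \<and> \<tau> x \<le> C"
    and f: "f \<in> L2 \<Omega>" and g: "g \<in> L2 \<Omega>"
  shows "integrable (lebesgue_on \<Omega>) (\<lambda>x. complex_of_real (\<tau> x) * (f x * cnj (g x)))"
proof (rule Bochner_Integration.integrable_bound)
  have int: "integrable (lebesgue_on \<Omega>) (\<lambda>x. f x * cnj (g x))"
    by (rule L2_integrable_mult[OF f L2_cnj[OF g]])
  then show "integrable (lebesgue_on \<Omega>) (\<lambda>x. complex_of_real C * (f x * cnj (g x)))"
    by simp
  show "(\<lambda>x. complex_of_real (\<tau> x) * (f x * cnj (g x))) \<in> borel_measurable (lebesgue_on \<Omega>)"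
    using \<tau>(1) by (intro borel_measurable_times[OF _ borel_measurable_integrable[OF int]]) auto
  show "AE x in lebesgue_on \<Omega>. norm (complex_of_real (\<tau> x) * (f x * cnj (g x)))
      \<le> norm (complex_of_real C * (f x * cnj (g x)))"
    by (rule AE_I2) (use \<tau>(2) in \<open>auto simp: norm_mult space_restrict_space \<Omega>_def intro!: mult_right_mono intro: order_trans[OF _ abs_ge_self]\<close>)
qed

lemma grad_part_integrable:
  assumes "u \<in> H1 \<Omega>" "v \<in> H1 \<Omega>"
  shows "integrable (lebesgue_on \<Omega>)
    (\<lambda>x. complex_of_real (\<nu> x) * (\<Sum>i\<in>UNIV. grad \<Omega> u x $ i * cnj (grad \<Omega> v x $ i)))"
  unfolding sum_distrib_left
  by (intro Bochner_Integration.integrable_sum weighted_integrable meas bounds grad_L2 assms)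

lemma value_part_integrable:
  assumes "u \<in> H1 \<Omega>" "v \<in> H1 \<Omega>"
  shows "integrable (lebesgue_on \<Omega>) (\<lambda>x. complex_of_real (\<sigma> x) * (u x * cnj (v x)))"
  by (intro weighted_integrable meas bounds H1_imp_L2 assms)

lemma form_add_left:
  assumes u: "u \<in> H1 \<Omega>" and v: "v \<in> H1 \<Omega>" and w: "w \<in> H1 \<Omega>"
  shows "bilinear_form \<Omega> \<nu> \<sigma> (\<lambda>x. u x + v x) w = bilinear_form \<Omega> \<nu> \<sigma> u w + bilinear_form \<Omega> \<nu> \<sigma> v w"
proof -
  let ?g = "\<lambda>u x. complex_of_real (\<nu> x) * (\<Sum>i\<in>UNIV. grad \<Omega> u x $ i * cnj (grad \<Omega> w x $ i))"
  have uv: "(\<lambda>x. u x + v x) \<in> H1 \<Omega>"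
    using H1_add u v unfolding \<Omega>_def by blast
  have "(LINT x|lebesgue_on \<Omega>. ?g (\<lambda>x. u x + v x) x) = (LINT x|lebesgue_on \<Omega>. ?g u x + ?g v x)"
  proof (rule integral_cong_AE)
    show "AE x in lebesgue_on \<Omega>. ?g (\<lambda>x. u x + v x) x = ?g u x + ?g v x"
      using grad_add[of u a b v] u v unfolding \<Omega>_def[symmetric]
      by (auto elim!: eventually_mono simp: algebra_simps sum.distrib)
  qed (use grad_part_integrable u v w uv in auto)
  also have "\<dots> = (LINT x|lebesgue_on \<Omega>. ?g u x) + (LINT x|lebesgue_on \<Omega>. ?g v x)"
    by (intro Bochner_Integration.integral_add grad_part_integrable u v w)
  finally show ?thesis
    using value_part_integrable[OF u w] value_part_integrable[OF v w]
    by (simp add: bilinear_form_def distrib_left distrib_right)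
qed

lemma form_cmult_left:
  assumes u: "u \<in> H1 \<Omega>" and w: "w \<in> H1 \<Omega>"
  shows "bilinear_form \<Omega> \<nu> \<sigma> (\<lambda>x. c * u x) w = c * bilinear_form \<Omega> \<nu> \<sigma> u w"
proof -
  let ?g = "\<lambda>u x. complex_of_real (\<nu> x) * (\<Sum>i\<in>UNIV. grad \<Omega> u x $ i * cnj (grad \<Omega> w x $ i))"
  have "(LINT x|lebesgue_on \<Omega>. ?g (\<lambda>x. c * u x) x) = (LINT x|lebesgue_on \<Omega>. c * ?g u x)"
  proof (rule integral_cong_AE)
    show "AE x in lebesgue_on \<Omega>. ?g (\<lambda>x. c * u x) x = c * ?g u x"
      using grad_cmult[of u a b c] u unfolding \<Omega>_def[symmetric]
      by (auto elim!: eventually_mono simp: sum_distrib_left mult_ac)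
  qed (use grad_part_integrable u w H1_cmult[OF u] in auto)
  moreover have "(LINT x|lebesgue_on \<Omega>. complex_of_real (\<sigma> x) * (c * u x * cnj (w x)))
      = (LINT x|lebesgue_on \<Omega>. c * (complex_of_real (\<sigma> x) * (u x * cnj (w x))))"
    by (intro Bochner_Integration.integral_cong refl) (simp only: mult_ac)
  ultimately show ?thesis
    by (simp add: bilinear_form_def distrib_left)
qed

lemma form_hermitian: "bilinear_form \<Omega> \<nu> \<sigma> v u = cnj (bilinear_form \<Omega> \<nu> \<sigma> u v)"
proof -
  have "cnj (complex_of_real (\<nu> x) * (\<Sum>i\<in>UNIV. grad \<Omega> u x $ i * cnj (grad \<Omega> v x $ i)))
      = complex_of_real (\<nu> x) * (\<Sum>i\<in>UNIV. grad \<Omega> v x $ i * cnj (grad \<Omega> u x $ i))"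
    "cnj (complex_of_real (\<sigma> x) * (u x * cnj (v x))) = complex_of_real (\<sigma> x) * (v x * cnj (u x))" for x
    by (simp_all add: mult.commute)
  then have "bilinear_form \<Omega> \<nu> \<sigma> v u =
      (LINT x|lebesgue_on \<Omega>. cnj (complex_of_real (\<nu> x) * (\<Sum>i\<in>UNIV. grad \<Omega> u x $ i * cnj (grad \<Omega> v x $ i)))) +
      (LINT x|lebesgue_on \<Omega>. cnj (complex_of_real (\<sigma> x) * (u x * cnj (v x))))"
    unfolding bilinear_form_def by (simp only:)
  then show ?thesis
    unfolding bilinear_form_def Bochner_Integration.integral_cnj by simp
qed

lemma form_diag:
  assumes v: "v \<in> H1 \<Omega>"
  shows "integrable (lebesgue_on \<Omega>) (\<lambda>x. \<nu> x * (norm (grad \<Omega> v x))\<^sup>2)"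
    and "integrable (lebesgue_on \<Omega>) (\<lambda>x. \<sigma> x * (cmod (v x))\<^sup>2)"
    and "Re (bilinear_form \<Omega> \<nu> \<sigma> v v) =
      (LINT x|lebesgue_on \<Omega>. \<nu> x * (norm (grad \<Omega> v x))\<^sup>2) + (LINT x|lebesgue_on \<Omega>. \<sigma> x * (cmod (v x))\<^sup>2)"
proof -
  have "complex_of_real (\<nu> x) * (\<Sum>i\<in>UNIV. grad \<Omega> v x $ i * cnj (grad \<Omega> v x $ i))
      = complex_of_real (\<nu> x * (norm (grad \<Omega> v x))\<^sup>2)" for x
    by (simp add: norm_vec_def L2_set_def real_sqrt_pow2 sum_nonneg of_real_cmod_square)
  moreover have "complex_of_real (\<sigma> x) * (v x * cnj (v x)) = complex_of_real (\<sigma> x * (cmod (v x))\<^sup>2)" for x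
    by (simp add: of_real_cmod_square)
  ultimately show "integrable (lebesgue_on \<Omega>) (\<lambda>x. \<nu> x * (norm (grad \<Omega> v x))\<^sup>2)"
    "integrable (lebesgue_on \<Omega>) (\<lambda>x. \<sigma> x * (cmod (v x))\<^sup>2)"
    "Re (bilinear_form \<Omega> \<nu> \<sigma> v v) =
      (LINT x|lebesgue_on \<Omega>. \<nu> x * (norm (grad \<Omega> v x))\<^sup>2) + (LINT x|lebesgue_on \<Omega>. \<sigma> x * (cmod (v x))\<^sup>2)"
    using grad_part_integrable[OF v v] value_part_integrable[OF v v]
    unfolding bilinear_form_def by (simp_all only: complex_of_real_integrable_eq integral_complex_of_real plus_complex.sel Re_complex_of_real)
qed

sublocale hermitian_form "H1 \<Omega>" "bilinear_form \<Omega> \<nu> \<sigma>"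
proof
  show "(\<lambda>x. 0) \<in> H1 \<Omega>"
    unfolding \<Omega>_def by (rule smooth_H1[OF smooth_const])
  show "(\<lambda>x. v x + w x) \<in> H1 \<Omega>" if "v \<in> H1 \<Omega>" "w \<in> H1 \<Omega>" for v w
    using that unfolding \<Omega>_def by (rule H1_add)
  show "0 \<le> Re (bilinear_form \<Omega> \<nu> \<sigma> v v)" if "v \<in> H1 \<Omega>" for v
    unfolding form_diag(3)[OF that]
    using bounds by (intro add_nonneg_nonneg integral_nonneg_AE AE_I2)
      (auto simp: space_restrict_space \<Omega>_def)
qed (fact H1_cmult form_add_left form_cmult_left form_hermitian)+

end

lemma form_coefficients_one: "form_coefficients a b (\<lambda>x. 1) (\<lambda>x. 1) 1"
  by unfold_locales auto

lemma H1_norm_eq_form: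
  assumes "v \<in> H1 (box a b)"
  shows "H1_norm (box a b) v = sqrt (Re (bilinear_form (box a b) (\<lambda>x. 1) (\<lambda>x. 1) v v))"
  by (simp add: H1_norm_def form_coefficients.form_diag(3)[OF form_coefficients_one assms])

text \<open>Triangle inequality and homogeneity of \<open>H1_norm\<close> become instances of the
  abstract facts, since it is the form norm for both coefficients equal to 1.\<close>

interpretation H1: hermitian_form "H1 (box a b)" "bilinear_form (box a b) (\<lambda>x. 1) (\<lambda>x. 1)" for a b
proof -
  interpret form_coefficients a b "\<lambda>x. 1" "\<lambda>x. 1" "box a b" 1
    using form_coefficients_one by auto
  show "hermitian_form (H1 (box a b)) (bilinear_form (box a b) (\<lambda>x. 1) (\<lambda>x. 1))"
    by (rule hermitian_form_axioms)
qed

lemma H1_norm_nonneg: "0 \<le> H1_norm \<Omega> v"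
  unfolding H1_norm_def by (intro real_sqrt_ge_zero add_nonneg_nonneg integral_nonneg_AE AE_I2) auto

lemma H1_norm_add:
  "v \<in> H1 (box a b) \<Longrightarrow> w \<in> H1 (box a b) \<Longrightarrow>
    H1_norm (box a b) (\<lambda>x. v x + w x) \<le> H1_norm (box a b) v + H1_norm (box a b) w"
  by (simp add: H1_norm_eq_form H1_add H1.form_norm_triangle)

lemma H1_norm_cmult:
  "v \<in> H1 (box a b) \<Longrightarrow> H1_norm (box a b) (\<lambda>x. c * v x) = cmod c * H1_norm (box a b) v"
  by (simp add: H1_norm_eq_form H1_cmult H1.form_norm_cmult)

lemma (in form_coefficients) form_bounds:
  assumes v: "v \<in> H1 \<Omega>"
    and lo: "\<And>x. x \<in> \<Omega> \<Longrightarrow> \<alpha> \<le> \<nu> x" "\<And>x. x \<in> \<Omega> \<Longrightarrow> \<alpha> \<le> \<sigma> x"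
    and hi: "\<And>x. x \<in> \<Omega> \<Longrightarrow> \<nu> x \<le> \<alpha>'" "\<And>x. x \<in> \<Omega> \<Longrightarrow> \<sigma> x \<le> \<alpha>'"
  shows "\<alpha> * (H1_norm \<Omega> v)\<^sup>2 \<le> Re (bilinear_form \<Omega> \<nu> \<sigma> v v)"
    and "Re (bilinear_form \<Omega> \<nu> \<sigma> v v) \<le> \<alpha>' * (H1_norm \<Omega> v)\<^sup>2"
proof -
  have one: "integrable (lebesgue_on \<Omega>) (\<lambda>x. (norm (grad \<Omega> v x))\<^sup>2)"
    "integrable (lebesgue_on \<Omega>) (\<lambda>x. (cmod (v x))\<^sup>2)"
    using form_coefficients.form_diag(1,2)[OF form_coefficients_one v[unfolded \<Omega>_def]] by (simp_all add: \<Omega>_def)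
  have N: "(H1_norm \<Omega> v)\<^sup>2 = (LINT x|lebesgue_on \<Omega>. (norm (grad \<Omega> v x))\<^sup>2) + (LINT x|lebesgue_on \<Omega>. (cmod (v x))\<^sup>2)"
    unfolding H1_norm_def by (simp add: add.commute)
  have "\<alpha> * (LINT x|lebesgue_on \<Omega>. (norm (grad \<Omega> v x))\<^sup>2) \<le> (LINT x|lebesgue_on \<Omega>. \<nu> x * (norm (grad \<Omega> v x))\<^sup>2)"
    "\<alpha> * (LINT x|lebesgue_on \<Omega>. (cmod (v x))\<^sup>2) \<le> (LINT x|lebesgue_on \<Omega>. \<sigma> x * (cmod (v x))\<^sup>2)"
    "(LINT x|lebesgue_on \<Omega>. \<nu> x * (norm (grad \<Omega> v x))\<^sup>2) \<le> \<alpha>' * (LINT x|lebesgue_on \<Omega>. (norm (grad \<Omega> v x))\<^sup>2)"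
    "(LINT x|lebesgue_on \<Omega>. \<sigma> x * (cmod (v x))\<^sup>2) \<le> \<alpha>' * (LINT x|lebesgue_on \<Omega>. (cmod (v x))\<^sup>2)"
    unfolding integral_mult_right_zero[symmetric]
    using one form_diag(1,2)[OF v] lo hi
    by (intro integral_mono integrable_mult_right mult_right_mono; simp add: space_restrict_space \<Omega>_def)+
  then show "\<alpha> * (H1_norm \<Omega> v)\<^sup>2 \<le> Re (bilinear_form \<Omega> \<nu> \<sigma> v v)"
    "Re (bilinear_form \<Omega> \<nu> \<sigma> v v) \<le> \<alpha>' * (H1_norm \<Omega> v)\<^sup>2"
    unfolding N form_diag(3)[OF v] distrib_left by linarith+
qed

text \<open>One predicate \<open>S\<close> on approximating functions covers both energy spaces:
  test functions for zero boundary values, smooth periodic functions for the periodic case. Vector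
  space operations are applied to the approximating sequences.\<close>

lemma smooth_limits_subspace:
  assumes S: "\<And>\<psi>. S \<psi> \<Longrightarrow> smooth \<psi>" "\<And>\<psi> \<psi>'. S \<psi> \<Longrightarrow> S \<psi>' \<Longrightarrow> S (\<lambda>x. \<psi> x + \<psi>' x)"
    "\<And>\<psi> c. S \<psi> \<Longrightarrow> S (\<lambda>x. c * \<psi> x)" "S (\<lambda>x. 0)"
    and V: "V = {v \<in> H1 (box a b). \<exists>\<psi>. (\<forall>m::nat. S (\<psi> m)) \<and> (\<lambda>m. H1_norm (box a b) (\<lambda>x. v x - \<psi> m x)) \<longlonglongrightarrow> 0}"
  shows "(\<lambda>x. 0) \<in> V" and "\<And>v w. v \<in> V \<Longrightarrow> w \<in> V \<Longrightarrow> (\<lambda>x. v x + w x) \<in> V"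
    and "\<And>v c. v \<in> V \<Longrightarrow> (\<lambda>x. c * v x) \<in> V"
proof -
  let ?\<Omega> = "box a b"
  have zero: "(\<lambda>x. 0) \<in> H1 ?\<Omega>" by (rule smooth_H1[OF smooth_const])
  have "H1_norm ?\<Omega> (\<lambda>x. 0) = 0"
    using H1_norm_cmult[OF zero, of 0] by simp
  then show "(\<lambda>x. 0) \<in> V"
    unfolding V using zero S(4) by (auto intro!: exI[of _ "\<lambda>m x. 0"])
  fix v c assume "v \<in> V"
  then obtain \<psi> where v: "v \<in> H1 ?\<Omega>" and \<psi>: "\<And>m. S (\<psi> m)" "(\<lambda>m. H1_norm ?\<Omega> (\<lambda>x. v x - \<psi> m x)) \<longlonglongrightarrow> 0"
    unfolding V by blast
  have d: "(\<lambda>x. v x - \<psi> m x) \<in> H1 ?\<Omega>" for m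
    by (intro H1.diff_mem v smooth_H1 S(1) \<psi>(1))
  have "H1_norm ?\<Omega> (\<lambda>x. c * v x - c * \<psi> m x) = cmod c * H1_norm ?\<Omega> (\<lambda>x. v x - \<psi> m x)" for m
    using H1_norm_cmult[OF d, of c m] by (simp add: right_diff_distrib)
  then have "(\<lambda>m. H1_norm ?\<Omega> (\<lambda>x. c * v x - c * \<psi> m x)) \<longlonglongrightarrow> 0"
    using tendsto_mult_right_zero[OF \<psi>(2), of "cmod c"] by simp
  then show "(\<lambda>x. c * v x) \<in> V"
    unfolding V using H1_cmult[OF v] S(3)[OF \<psi>(1)] by (intro CollectI conjI exI[of _ "\<lambda>m x. c * \<psi> m x"]) auto
  fix w assume "w \<in> V"
  then obtain \<psi>' where w: "w \<in> H1 ?\<Omega>" and \<psi>': "\<And>m. S (\<psi>' m)" "(\<lambda>m. H1_norm ?\<Omega> (\<lambda>x. w x - \<psi>' m x)) \<longlonglongrightarrow> 0"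
    unfolding V by blast
  have d': "(\<lambda>x. w x - \<psi>' m x) \<in> H1 ?\<Omega>" for m
    by (intro H1.diff_mem w smooth_H1 S(1) \<psi>'(1))
  have "H1_norm ?\<Omega> (\<lambda>x. v x + w x - (\<psi> m x + \<psi>' m x))
      \<le> H1_norm ?\<Omega> (\<lambda>x. v x - \<psi> m x) + H1_norm ?\<Omega> (\<lambda>x. w x - \<psi>' m x)" for m
    using H1_norm_add[OF d d', of m m] by (simp add: add_diff_add)
  then have "(\<lambda>m. H1_norm ?\<Omega> (\<lambda>x. v x + w x - (\<psi> m x + \<psi>' m x))) \<longlonglongrightarrow> 0"
    by (intro tendsto_sandwich[OF always_eventually always_eventually tendsto_const
        tendsto_add_zero[OF \<psi>(2) \<psi>'(2)]] allI H1_norm_nonneg)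
  then show "(\<lambda>x. v x + w x) \<in> V"
    unfolding V using H1_add[OF v w] S(2)[OF \<psi>(1) \<psi>'(1)]
    by (intro CollectI conjI exI[of _ "\<lambda>m x. \<psi> m x + \<psi>' m x"]) auto
qed

lemma test_functions_closed:
  shows "(\<lambda>x. 0) \<in> test_functions \<Omega>"
    and "\<psi> \<in> test_functions \<Omega> \<Longrightarrow> (\<lambda>x. c * \<psi> x) \<in> test_functions \<Omega>"
    and "\<psi> \<in> test_functions \<Omega> \<Longrightarrow> \<psi>' \<in> test_functions \<Omega> \<Longrightarrow> (\<lambda>x. \<psi> x + \<psi>' x) \<in> test_functions \<Omega>"
proof -
  have sub: "compact (closure A) \<and> closure A \<subseteq> \<Omega>" if "A \<subseteq> S" "compact (closure S)" "closure S \<subseteq> \<Omega>"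
    for A S :: "(real^'a) set"
    using that closure_mono[OF that(1)] by (meson bounded_closure bounded_subset closed_closure compact_eq_bounded_closed subset_trans)
  show "(\<lambda>x. 0) \<in> test_functions \<Omega>"
    by (simp add: test_functions_def smooth_const)
  assume "\<psi> \<in> test_functions \<Omega>"
  then have \<psi>: "smooth \<psi>" "compact (closure {x. \<psi> x \<noteq> 0})" "closure {x. \<psi> x \<noteq> 0} \<subseteq> \<Omega>"
    by (auto simp: test_functions_def)
  show "(\<lambda>x. c * \<psi> x) \<in> test_functions \<Omega>"
    using sub[OF _ \<psi>(2,3), of "{x. c * \<psi> x \<noteq> 0}"] smooth_cmult[OF \<psi>(1)] by (auto simp: test_functions_def)
  assume "\<psi>' \<in> test_functions \<Omega>"
  then have \<psi>': "smooth \<psi>'" "compact (closure {x. \<psi>' x \<noteq> 0})" "closure {x. \<psi>' x \<noteq> 0} \<subseteq> \<Omega>"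
    by (auto simp: test_functions_def)
  have "compact (closure {x. \<psi> x + \<psi>' x \<noteq> 0}) \<and> closure {x. \<psi> x + \<psi>' x \<noteq> 0} \<subseteq> \<Omega>"
    by (rule sub[of _ "{x. \<psi> x \<noteq> 0} \<union> {x. \<psi>' x \<noteq> 0}"])
      (use \<psi> \<psi>' in \<open>auto simp: closure_Un simp del: compact_closure intro: compact_Un\<close>)
  then show "(\<lambda>x. \<psi> x + \<psi>' x) \<in> test_functions \<Omega>"
    using smooth_add[OF \<psi>(1) \<psi>'(1)] by (auto simp: test_functions_def)
qed

lemma energy_space_subspace:
  assumes "V = H1_zero (box a b) \<or> V = H1_periodic a b"
  shows "V \<subseteq> H1 (box a b)" and "(\<lambda>x. 0) \<in> V"
    and "\<And>v w. v \<in> V \<Longrightarrow> w \<in> V \<Longrightarrow> (\<lambda>x. v x + w x) \<in> V"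
    and "\<And>v c. v \<in> V \<Longrightarrow> (\<lambda>x. c * v x) \<in> V"
proof -
  let ?S0 = "\<lambda>\<psi>. \<psi> \<in> test_functions (box a b)"
  let ?Sp = "\<lambda>\<psi>. smooth \<psi> \<and> (\<forall>x i. \<psi> (x + axis i (b $ i - a $ i)) = \<psi> x)"
  show "V \<subseteq> H1 (box a b)"
    using assms by (auto simp: H1_zero_def H1_periodic_def)
  consider "V = H1_zero (box a b)" | "V = H1_periodic a b" using assms by blast
  then have "(\<lambda>x. 0) \<in> V \<and> (\<forall>v\<in>V. \<forall>w\<in>V. (\<lambda>x. v x + w x) \<in> V) \<and> (\<forall>v\<in>V. \<forall>c. (\<lambda>x. c * v x) \<in> V)"
  proof cases
    case 1
    note * = smooth_limits_subspace[of ?S0, OF _ test_functions_closed(3,2,1) 1[unfolded H1_zero_def]]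
    show ?thesis using * by (auto simp: test_functions_def)
  next
    case 2
    have "smooth \<psi>" if "?Sp \<psi>" for \<psi> using that by simp
    moreover have "?Sp (\<lambda>x. \<psi> x + \<psi>' x)" if "?Sp \<psi>" "?Sp \<psi>'" for \<psi> \<psi>'
      using that by (simp add: smooth_add)
    moreover have "?Sp (\<lambda>x. c * \<psi> x)" if "?Sp \<psi>" for \<psi> c
      using that by (simp add: smooth_cmult)
    moreover have "?Sp (\<lambda>x. 0)" by (simp add: smooth_const)
    ultimately have *: "(\<lambda>x. 0) \<in> V" "\<And>v w. v \<in> V \<Longrightarrow> w \<in> V \<Longrightarrow> (\<lambda>x. v x + w x) \<in> V"
      "\<And>v c. v \<in> V \<Longrightarrow> (\<lambda>x. c * v x) \<in> V"
      using smooth_limits_subspace[of ?Sp V a b] 2[unfolded H1_periodic_def] by blast+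
    show ?thesis using * by blast
  qed
  then show "(\<lambda>x. 0) \<in> V" "\<And>v w. v \<in> V \<Longrightarrow> w \<in> V \<Longrightarrow> (\<lambda>x. v x + w x) \<in> V"
    "\<And>v c. v \<in> V \<Longrightarrow> (\<lambda>x. c * v x) \<in> V" by auto
qed

section \<open>Kernels with exponential decay on the index lattice\<close>

text \<open>The embedding turns \<open>idx_dist\<close> into a metric distance, so that
  \<open>infdist\<close> and its Lipschitz property become available.\<close>

definition idx_embed :: "'n::finite idx \<Rightarrow> real^'n" where
  "idx_embed k = (\<chi> i. real_of_int (k $ i))"

lemma idx_dist_eq_dist: "idx_dist k l = dist (idx_embed k) (idx_embed l)"
  unfolding idx_dist_def idx_embed_def dist_norm by (rule arg_cong[of _ _ norm]) (simp add: vec_eq_iff)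

lemma idx_dist_nonneg: "0 \<le> idx_dist k l"
  and idx_dist_commute: "idx_dist k l = idx_dist l k"
  and idx_dist_self: "idx_dist k k = 0"
  by (simp_all add: idx_dist_eq_dist dist_commute)

lemma idx_dist_component: "\<bar>real_of_int (k $ i) - real_of_int (l $ i)\<bar> \<le> idx_dist k l"
  using component_le_norm_cart[of "\<chi> i. real_of_int (k $ i - l $ i)" i] by (simp add: idx_dist_def)

text \<open>The Euclidean ball is contained in a cube of integer points with
  \<open>2 * floor J + 1\<close> points per side.\<close>

lemma idx_ball_card:
  fixes l :: "'n::finite idx"
  assumes "0 \<le> J"
  shows "finite {k. idx_dist k l \<le> J}"
    and "real (card {k. idx_dist k l \<le> J}) \<le> (2 * J + 1) ^ CARD('n)"
proof -
  let ?P = "PiE (UNIV :: 'n set) (\<lambda>i. {l $ i - \<lfloor>J\<rfloor>..l $ i + \<lfloor>J\<rfloor>})"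
  have inj: "inj_on (\<lambda>k. ($) k) {k::'n idx. idx_dist k l \<le> J}"
    by (auto simp: inj_on_def vec_eq_iff)
  have sub: "(\<lambda>k. ($) k) ` {k. idx_dist k l \<le> J} \<subseteq> ?P"
  proof -
    have "k $ i \<in> {l $ i - \<lfloor>J\<rfloor>..l $ i + \<lfloor>J\<rfloor>}" if "idx_dist k l \<le> J" for k :: "'n idx" and i
    proof -
      have "real_of_int \<bar>k $ i - l $ i\<bar> \<le> J"
        using idx_dist_component[of k i l] that by simp
      then have "\<bar>k $ i - l $ i\<bar> \<le> \<lfloor>J\<rfloor>" by (simp add: le_floor_iff)
      then show ?thesis by auto
    qed
    then show ?thesis by auto
  qed
  have fin: "finite ?P" by (intro finite_PiE) auto
  show "finite {k. idx_dist k l \<le> J}"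
    using inj_on_finite[OF inj sub fin] .
  have "card {k. idx_dist k l \<le> J} \<le> card ?P"
    using card_inj_on_le[OF inj sub fin] .
  also have "card ?P = nat (2 * \<lfloor>J\<rfloor> + 1) ^ CARD('n)"
    by (simp add: card_PiE)
  finally have "real (card {k. idx_dist k l \<le> J}) \<le> real (nat (2 * \<lfloor>J\<rfloor> + 1)) ^ CARD('n)"
    by (metis of_nat_le_iff of_nat_power)
  also have "\<dots> \<le> (2 * J + 1) ^ CARD('n)"
  proof (rule power_mono)
    have "0 \<le> 2 * \<lfloor>J\<rfloor> + 1" using assms by simp
    then have "real (nat (2 * \<lfloor>J\<rfloor> + 1)) = 2 * real_of_int \<lfloor>J\<rfloor> + 1" by simp
    also have "\<dots> \<le> 2 * J + 1" by simp
    finally show "real (nat (2 * \<lfloor>J\<rfloor> + 1)) \<le> 2 * J + 1" .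
  qed simp
  finally show "real (card {k. idx_dist k l \<le> J}) \<le> (2 * J + 1) ^ CARD('n)" .
qed

lemma enrich_card:
  fixes T :: "'n::finite idx set"
  assumes "finite T" "0 \<le> J"
  shows "finite (enrich K J T)" and "real (card (enrich K J T)) \<le> real (card T) * (2 * J + 1) ^ CARD('n)"
proof -
  have sub: "enrich K J T \<subseteq> (\<Union>l\<in>T. {k. idx_dist k l \<le> J})"
    by (auto simp: enrich_def)
  have fin: "finite (\<Union>l\<in>T. {k. idx_dist k l \<le> J})"
    using assms idx_ball_card(1) by blast
  show "finite (enrich K J T)" by (rule finite_subset[OF sub fin])
  have "card (enrich K J T) \<le> card (\<Union>l\<in>T. {k. idx_dist k l \<le> J})"
    by (rule card_mono[OF fin sub])
  also have "\<dots> \<le> (\<Sum>l\<in>T. card {k. idx_dist k l \<le> J})"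
    by (rule card_UN_le[OF assms(1)])
  finally have "real (card (enrich K J T)) \<le> (\<Sum>l\<in>T. real (card {k. idx_dist k l \<le> J}))"
    by (metis of_nat_le_iff of_nat_sum)
  also have "\<dots> \<le> (\<Sum>l\<in>T. (2 * J + 1) ^ CARD('n))"
    by (intro sum_mono idx_ball_card(2) assms)
  finally show "real (card (enrich K J T)) \<le> real (card T) * (2 * J + 1) ^ CARD('n)"
    by simp
qed

text \<open>Two geometric series, one for each sign, with the index 0 counted in both.\<close>

lemma sum_exp_abs_int:
  assumes "0 < \<eta>"
  shows "(\<Sum>j = -int m..int m. exp (- \<eta> * \<bar>real_of_int j\<bar>)) \<le> 2 / (1 - exp (- \<eta>))"
proof -
  let ?f = "\<lambda>j. exp (- \<eta> * \<bar>real_of_int j\<bar>)"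
  let ?A = "int ` {..m}" and ?B = "(\<lambda>j. - int j) ` {..m}"
  have "{- int m..int m} \<subseteq> ?A \<union> ?B"
  proof
    fix j assume "j \<in> {- int m..int m}"
    then show "j \<in> ?A \<union> ?B"
      by (cases "0 \<le> j") (auto intro: image_eqI[of _ _ "nat j"] image_eqI[of _ _ "nat (- j)"])
  qed
  then have "sum ?f {- int m..int m} \<le> sum ?f (?A \<union> ?B)"
    by (intro sum_mono2) auto
  also have "\<dots> \<le> sum ?f ?A + sum ?f ?B"
    by (subst sum_Un) (auto intro: sum_nonneg)
  also have "\<dots> = 2 * (\<Sum>j\<le>m. exp (- \<eta>) ^ j)"
    by (simp add: sum.reindex inj_on_def exp_of_nat_mult[symmetric] mult_ac)
  also have "(\<Sum>j\<le>m. exp (- \<eta>) ^ j) \<le> 1 / (1 - exp (- \<eta>))"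
    using assms by (simp add: sum_gp0 divide_right_mono)
  finally show ?thesis by simp
qed

text \<open>The sum of the coordinate distances is at most the dimension times the Euclidean
  distance; at the reduced rate \<open>\<eta>'\<close> the kernel is therefore dominated by a
  product over the coordinates, whose sum over a cube factorises. The bound depends neither on the
  centre nor on the finite set, as a Schur test requires.\<close>

lemma sum_exp_idx_dist:
  assumes "0 < \<eta>"
  shows "\<exists>S>0. \<forall>F (l::'n::finite idx). finite F \<longrightarrow> (\<Sum>k\<in>F. exp (- \<eta> * idx_dist l k)) \<le> S"
proof -
  define \<eta>' where "\<eta>' = \<eta> / real CARD('n)"
  have \<eta>': "0 < \<eta>'" using assms by (simp add: \<eta>'_def)
  let ?S = "2 / (1 - exp (- \<eta>'))"
  have S: "0 < ?S" using \<eta>' by simp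
  have "(\<Sum>k\<in>F. exp (- \<eta> * idx_dist l k)) \<le> ?S ^ CARD('n)" if F: "finite F" for F and l :: "'n idx"
  proof -
    \<comment> \<open>A cube around \<open>l\<close> large enough to contain the finite set
      \<open>F\<close>; the final bound does not depend on \<open>m\<close>.\<close>
    obtain m :: nat where m: "\<And>k i. k \<in> F \<Longrightarrow> \<bar>k $ i - l $ i\<bar> \<le> int m"
    proof -
      have "finite ((\<lambda>(k, i). nat \<bar>k $ i - l $ i\<bar>) ` (F \<times> UNIV))" using F by simp
      then obtain m where "\<And>x. x \<in> (\<lambda>(k, i). nat \<bar>k $ i - l $ i\<bar>) ` (F \<times> UNIV) \<Longrightarrow> x \<le> m"
        by (meson finite_nat_set_iff_bounded_le)
      note m = this
      have "\<bar>k $ i - l $ i\<bar> \<le> int m" if "k \<in> F" for k i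
      proof -
        have "nat \<bar>k $ i - l $ i\<bar> \<le> m"
          by (rule m, rule image_eqI[of _ _ "(k, i)"]) (use that in auto)
        then show ?thesis by linarith
      qed
      then show ?thesis using that by blast
    qed
    let ?P = "PiE (UNIV :: 'n set) (\<lambda>i. {- int m..int m})"
    let ?g = "\<lambda>k::'n idx. \<lambda>i. k $ i - l $ i"
    let ?h = "\<lambda>g. \<Prod>i\<in>(UNIV::'n set). exp (- \<eta>' * \<bar>real_of_int (g i)\<bar>)"
    have "(\<Sum>k\<in>F. exp (- \<eta> * idx_dist l k)) \<le> (\<Sum>k\<in>F. ?h (?g k))"
    proof (rule sum_mono)
      fix k
      have "(\<Sum>i\<in>UNIV. \<bar>real_of_int (?g k i)\<bar>) \<le> real CARD('n) * idx_dist l k"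
        using sum_bounded_above[of UNIV "\<lambda>i. \<bar>real_of_int (?g k i)\<bar>" "idx_dist l k"]
          idx_dist_component[of k _ l] by (simp add: idx_dist_commute[of l k])
      then have "\<eta>' * (\<Sum>i\<in>UNIV. \<bar>real_of_int (?g k i)\<bar>) \<le> \<eta> * idx_dist l k"
        using mult_left_mono[of _ _ \<eta>'] \<eta>' by (fastforce simp: \<eta>'_def)
      then have "exp (- \<eta> * idx_dist l k) \<le> exp (\<Sum>i\<in>UNIV. - \<eta>' * \<bar>real_of_int (?g k i)\<bar>)"
        by (simp add: sum_distrib_left sum_negf)
      then show "exp (- \<eta> * idx_dist l k) \<le> ?h (?g k)"
        by (simp add: exp_sum)
    qed
    also have "\<dots> = (\<Sum>g\<in>?g ` F. ?h g)"
      by (rule sum.reindex_cong[symmetric, of ?g]) (auto simp: inj_on_def vec_eq_iff fun_eq_iff)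
    also have "\<dots> \<le> (\<Sum>g\<in>?P. ?h g)"
    proof (rule sum_mono2)
      show "finite ?P" by (intro finite_PiE) auto
      show "?g ` F \<subseteq> ?P"
        using m by (auto simp: abs_le_iff) (smt (verit))+
    qed (auto intro: prod_nonneg)
    also have "\<dots> = (\<Prod>i\<in>(UNIV::'n set). \<Sum>j = -int m..int m. exp (- \<eta>' * \<bar>real_of_int j\<bar>))"
      by (rule prod_sum_PiE[symmetric]) auto
    also have "\<dots> \<le> ?S ^ CARD('n)"
      using sum_exp_abs_int[OF \<eta>', of m] by (auto intro!: power_mono sum_nonneg)
    finally show ?thesis .
  qed
  then show ?thesis using S by (intro exI[of _ "?S ^ CARD('n)"]) auto
qed

text \<open>Cauchy-Schwarz with the majorant split as \<open>sqrt s * sqrt s\<close>: one half is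
  summed along rows, the other stays with \<open>z\<close> and is summed along columns after
  exchanging the sums.\<close>

lemma Schur_test:
  fixes m :: "'i \<Rightarrow> 'j \<Rightarrow> complex"
  assumes s: "\<And>l k. l \<in> F \<Longrightarrow> k \<in> G \<Longrightarrow> cmod (m l k) \<le> s l k"
    and row: "\<And>l. l \<in> F \<Longrightarrow> (\<Sum>k\<in>G. s l k) \<le> S"
    and col: "\<And>k. k \<in> G \<Longrightarrow> (\<Sum>l\<in>F. s l k) \<le> S"
    and S: "0 \<le> S"
  shows "L2_set (\<lambda>l. cmod (\<Sum>k\<in>G. m l k * z k)) F \<le> S * L2_set (\<lambda>k. cmod (z k)) G"
proof -
  have s0: "0 \<le> s l k" if "l \<in> F" "k \<in> G" for l k
    using order_trans[OF norm_ge_zero s[OF that]] .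
  have "(cmod (\<Sum>k\<in>G. m l k * z k))\<^sup>2 \<le> S * (\<Sum>k\<in>G. s l k * (cmod (z k))\<^sup>2)" if l: "l \<in> F" for l
  proof -
    have "cmod (\<Sum>k\<in>G. m l k * z k) \<le> (\<Sum>k\<in>G. cmod (m l k * z k))"
      by (rule norm_sum)
    also have "\<dots> \<le> (\<Sum>k\<in>G. sqrt (s l k) * (sqrt (s l k) * cmod (z k)))"
      using s0[OF l] s[OF l]
      by (intro sum_mono) (simp add: norm_mult mult.assoc[symmetric] mult_right_mono)
    finally have "(cmod (\<Sum>k\<in>G. m l k * z k))\<^sup>2 \<le> (\<Sum>k\<in>G. sqrt (s l k) * (sqrt (s l k) * cmod (z k)))\<^sup>2"
      by (rule power_mono) simp
    also have "\<dots> \<le> (\<Sum>k\<in>G. (sqrt (s l k))\<^sup>2) * (\<Sum>k\<in>G. (sqrt (s l k) * cmod (z k))\<^sup>2)"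
      by (rule Cauchy_Schwarz_ineq_sum)
    also have "\<dots> = (\<Sum>k\<in>G. s l k) * (\<Sum>k\<in>G. s l k * (cmod (z k))\<^sup>2)"
      using s0[OF l] by (simp add: power_mult_distrib)
    also have "\<dots> \<le> S * (\<Sum>k\<in>G. s l k * (cmod (z k))\<^sup>2)"
      using s0[OF l] by (intro mult_right_mono row[OF l] sum_nonneg) simp
    finally show ?thesis .
  qed
  then have "(\<Sum>l\<in>F. (cmod (\<Sum>k\<in>G. m l k * z k))\<^sup>2) \<le> (\<Sum>l\<in>F. S * (\<Sum>k\<in>G. s l k * (cmod (z k))\<^sup>2))"
    by (rule sum_mono)
  also have "\<dots> = S * (\<Sum>k\<in>G. (\<Sum>l\<in>F. s l k) * (cmod (z k))\<^sup>2)"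
    unfolding sum_distrib_left[symmetric] sum_distrib_right by (subst sum.swap) (rule refl)
  also have "\<dots> \<le> S * (\<Sum>k\<in>G. S * (cmod (z k))\<^sup>2)"
    by (intro mult_left_mono[OF _ S] sum_mono mult_right_mono col) auto
  also have "\<dots> = S\<^sup>2 * (\<Sum>k\<in>G. (cmod (z k))\<^sup>2)"
    by (simp add: sum_distrib_left power2_eq_square mult.assoc)
  finally have "sqrt (\<Sum>l\<in>F. (cmod (\<Sum>k\<in>G. m l k * z k))\<^sup>2) \<le> sqrt (S\<^sup>2 * (\<Sum>k\<in>G. (cmod (z k))\<^sup>2))"
    by (rule real_sqrt_le_mono)
  then show ?thesis
    using S by (simp add: L2_set_def real_sqrt_mult)
qed

lemma Schur_test_bilinear:
  fixes m :: "'i \<Rightarrow> 'j \<Rightarrow> complex"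
  assumes "\<And>l k. l \<in> F \<Longrightarrow> k \<in> G \<Longrightarrow> cmod (m l k) \<le> s l k"
    and "\<And>l. l \<in> F \<Longrightarrow> (\<Sum>k\<in>G. s l k) \<le> S"
    and "\<And>k. k \<in> G \<Longrightarrow> (\<Sum>l\<in>F. s l k) \<le> S"
    and "0 \<le> S"
  shows "cmod (\<Sum>l\<in>F. \<Sum>k\<in>G. m l k * z k * cnj (y l))
    \<le> S * L2_set (\<lambda>k. cmod (z k)) G * L2_set (\<lambda>l. cmod (y l)) F"
proof -
  have "(\<Sum>l\<in>F. \<Sum>k\<in>G. m l k * z k * cnj (y l)) = (\<Sum>l\<in>F. (\<Sum>k\<in>G. m l k * z k) * cnj (y l))"
    by (simp add: sum_distrib_right)
  then have "cmod (\<Sum>l\<in>F. \<Sum>k\<in>G. m l k * z k * cnj (y l))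
      \<le> (\<Sum>l\<in>F. \<bar>cmod (\<Sum>k\<in>G. m l k * z k)\<bar> * \<bar>cmod (y l)\<bar>)"
    using norm_sum[of "\<lambda>l. (\<Sum>k\<in>G. m l k * z k) * cnj (y l)" F] by (simp add: norm_mult)
  also have "\<dots> \<le> L2_set (\<lambda>l. cmod (\<Sum>k\<in>G. m l k * z k)) F * L2_set (\<lambda>l. cmod (y l)) F"
    by (rule L2_set_mult_ineq)
  also have "\<dots> \<le> S * L2_set (\<lambda>k. cmod (z k)) G * L2_set (\<lambda>l. cmod (y l)) F"
    by (intro mult_right_mono Schur_test[OF assms] L2_set_nonneg)
  finally show ?thesis .
qed

text \<open>Here \<open>x\<close> is the difference of a Lipschitz weight at two points of distance
  \<open>s\<close>. Half of the decay rate pays for conjugation: a quarter dominates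
  \<open>exp x\<close>, and in the second bound another quarter absorbs the factor \<open>s\<close>
  that comes from \<open>\<bar>exp x - 1\<bar> \<le> \<bar>x\<bar> * exp \<bar>x\<bar>\<close>. The
  explicit factor \<mu> makes the perturbation small.\<close>

lemma exp_kernel_weight:
  fixes s x \<mu> \<eta> c q :: real
  assumes q: "0 \<le> q" "q \<le> c * exp (- \<eta> * s)" and x: "\<bar>x\<bar> \<le> \<mu> * s" and s: "0 \<le> s"
    and \<mu>: "0 \<le> \<mu>" "\<mu> \<le> \<eta> / 4" and \<eta>: "0 < \<eta>" and c: "0 \<le> c"
  shows "q * exp x \<le> c * exp (- (\<eta> / 2) * s)"
    and "q * \<bar>exp x - 1\<bar> \<le> \<mu> * (c * 4 / \<eta>) * exp (- (\<eta> / 2) * s)"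
proof -
  have \<mu>s: "\<mu> * s \<le> \<eta> / 4 * s" by (rule mult_right_mono[OF \<mu>(2) s])
  have "q * exp x \<le> c * exp (- \<eta> * s) * exp (\<eta> / 4 * s)"
    using q x \<mu>s by (intro mult_mono) auto
  also have "\<dots> = c * exp (- \<eta> * s + \<eta> / 4 * s)"
    by (simp only: exp_add mult.assoc)
  also have "\<dots> \<le> c * exp (- (\<eta> / 2) * s)"
    using s \<eta> c by (intro mult_left_mono) (auto simp: field_simps)
  finally show "q * exp x \<le> c * exp (- (\<eta> / 2) * s)" .
  have "\<bar>exp x - 1\<bar> \<le> \<bar>x\<bar> * exp \<bar>x\<bar>"
  proof (cases "0 \<le> x")
    case True
    have "1 - x \<le> exp (- x)" using exp_ge_add_one_self[of "- x"] by simp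
    then have "(1 - x) * exp x \<le> exp (- x) * exp x" by (intro mult_right_mono) auto
    then have "(1 - x) * exp x \<le> 1" by (simp add: exp_minus)
    then show ?thesis using True by (simp add: algebra_simps)
  next
    case False
    have "\<bar>exp x - 1\<bar> \<le> \<bar>x\<bar>" using False exp_ge_add_one_self[of x] by (simp, linarith)
    also have "\<dots> \<le> \<bar>x\<bar> * exp \<bar>x\<bar>" by (simp add: mult_le_cancel_left1)
    finally show ?thesis .
  qed
  also have "\<dots> \<le> \<mu> * s * exp (\<eta> / 4 * s)"
    using x \<mu>s by (intro mult_mono) auto
  also have "\<dots> \<le> \<mu> * (4 / \<eta> * exp (\<eta> / 4 * s)) * exp (\<eta> / 4 * s)"
  proof -
    have "s \<le> 4 / \<eta> * exp (\<eta> / 4 * s)"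
      using exp_ge_add_one_self[of "\<eta> / 4 * s"] \<eta> by (simp add: field_simps)
    then show ?thesis by (intro mult_right_mono mult_left_mono \<mu>) auto
  qed
  finally have "q * \<bar>exp x - 1\<bar> \<le> c * exp (- \<eta> * s) * (\<mu> * (4 / \<eta> * exp (\<eta> / 4 * s)) * exp (\<eta> / 4 * s))"
    using q c by (intro mult_mono) auto
  also have "\<dots> = \<mu> * (c * 4 / \<eta>) * (exp (- \<eta> * s) * exp (\<eta> / 4 * s) * exp (\<eta> / 4 * s))"
    by simp
  also have "exp (- \<eta> * s) * exp (\<eta> / 4 * s) * exp (\<eta> / 4 * s) = exp (- (\<eta> / 2) * s)"
    by (simp only: exp_add[symmetric]) (simp add: field_simps)
  finally show "q * \<bar>exp x - 1\<bar> \<le> \<mu> * (c * 4 / \<eta>) * exp (- (\<eta> / 2) * s)" .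
qed

section \<open>Riesz bases and dual norms\<close>

locale riesz_setting = form_coefficients a b \<nu> \<sigma> \<Omega> \<alpha>_hi
  for a b :: "real^'n::finite" and \<nu> \<sigma> :: "real^'n \<Rightarrow> real" and \<Omega> and \<alpha>_hi +
  fixes V :: "(real^'n \<Rightarrow> complex) set" and K :: "'n idx set"
    and \<phi> :: "'n idx \<Rightarrow> real^'n \<Rightarrow> complex" and d :: "'n idx \<Rightarrow> real"
    and \<alpha>_lo \<beta>_lo \<beta>_hi :: real
  assumes V_H1: "V \<subseteq> H1 \<Omega>" and V_zero: "(\<lambda>x. 0) \<in> V"
    and V_add: "\<And>v w. v \<in> V \<Longrightarrow> w \<in> V \<Longrightarrow> (\<lambda>x. v x + w x) \<in> V"
    and V_cmult: "\<And>v c. v \<in> V \<Longrightarrow> (\<lambda>x. c * v x) \<in> V"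
    and \<alpha>: "0 < \<alpha>_lo" "\<alpha>_lo \<le> \<alpha>_hi"
    and lower: "\<And>x. x \<in> \<Omega> \<Longrightarrow> \<alpha>_lo \<le> \<nu> x" "\<And>x. x \<in> \<Omega> \<Longrightarrow> \<alpha>_lo \<le> \<sigma> x"
    and riesz: "riesz_basis \<Omega> V K \<phi> d \<beta>_lo \<beta>_hi"
begin

abbreviation "B \<equiv> bilinear_form \<Omega> \<nu> \<sigma>"
abbreviation "N \<equiv> H1_norm \<Omega>"
abbreviation "energy \<equiv> energy_norm \<Omega> \<nu> \<sigma>"
abbreviation "pnorm \<equiv> phi_norm \<Omega> K \<phi> d"
abbreviation "dnorm \<equiv> dual_phi_norm K \<phi> d"
abbreviation "A \<equiv> stiffness \<Omega> \<nu> \<sigma> \<phi> d"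
abbreviation "gspace \<equiv> galerkin_space \<phi>"
abbreviation "coef \<equiv> coeffs \<Omega> K \<phi>"
abbreviation "proj_on \<equiv> proj \<Omega> K \<phi>"
abbreviation "rt k \<equiv> complex_of_real (sqrt (d k))"
abbreviation "gnorm \<equiv> gevrey_norm \<Omega> K \<phi> d"
abbreviation "gclass \<equiv> gevrey_class \<Omega> V K \<phi> d"

sublocale V: hermitian_form V B
  by unfold_locales
    (use V_H1 V_zero V_add V_cmult in \<open>auto intro: form_add_left form_cmult_left form_hermitian nonneg simp: subset_iff\<close>)

lemma \<phi>_mem: "k \<in> K \<Longrightarrow> \<phi> k \<in> V" and d_pos: "k \<in> K \<Longrightarrow> 0 < d k"
  and \<beta>: "0 < \<beta>_lo" "\<beta>_lo \<le> \<beta>_hi"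
  using riesz by (auto simp: riesz_basis_def)

lemma expansion_ex1: "v \<in> V \<Longrightarrow> \<exists>!c. expansion \<Omega> K \<phi> c v"
  using riesz unfolding riesz_basis_def by blast

lemma coeffs_expansion: "v \<in> V \<Longrightarrow> expansion \<Omega> K \<phi> (coef v) v"
  unfolding coeffs_def by (rule theI'[OF expansion_ex1])

lemma coeffs_eqI: "v \<in> V \<Longrightarrow> expansion \<Omega> K \<phi> c v \<Longrightarrow> coef v = c"
  unfolding coeffs_def by (rule the1_equality[OF expansion_ex1])

lemma coeffs_summable: "v \<in> V \<Longrightarrow> (\<lambda>k. (cmod (coef v k))\<^sup>2 * d k) summable_on K"
  and pnorm_bounds: "v \<in> V \<Longrightarrow> \<beta>_lo * N v \<le> pnorm v" "v \<in> V \<Longrightarrow> pnorm v \<le> \<beta>_hi * N v"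
  using riesz by (auto simp: riesz_basis_def)

lemma N_le_pnorm: "v \<in> V \<Longrightarrow> N v \<le> pnorm v / \<beta>_lo"
  using pnorm_bounds(1)[of v] \<beta> by (simp add: field_simps)

lemma N_zero: "N (\<lambda>x. 0) = 0"
  using H1_norm_cmult[of "\<lambda>x. 0" a b 0] V_H1 V_zero by (auto simp: \<Omega>_def)

lemma energy_sq: "v \<in> V \<Longrightarrow> (energy v)\<^sup>2 = Re (B v v)"
  using V.nonneg by (simp add: energy_norm_def)

lemma energy_nonneg: "v \<in> V \<Longrightarrow> 0 \<le> energy v"
  using V.nonneg by (simp add: energy_norm_def)

lemma energy_bounds:
  assumes "v \<in> V"
  shows "sqrt \<alpha>_lo * N v \<le> energy v" "energy v \<le> sqrt \<alpha>_hi * N v"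
proof -
  have "\<alpha>_lo * (N v)\<^sup>2 \<le> Re (B v v)" "Re (B v v) \<le> \<alpha>_hi * (N v)\<^sup>2"
    using form_bounds[of v \<alpha>_lo \<alpha>_hi] assms V_H1 lower bounds by auto
  then have "sqrt (\<alpha>_lo * (N v)\<^sup>2) \<le> energy v" "energy v \<le> sqrt (\<alpha>_hi * (N v)\<^sup>2)"
    unfolding energy_norm_def by (auto intro: real_sqrt_le_mono)
  then show "sqrt \<alpha>_lo * N v \<le> energy v" "energy v \<le> sqrt \<alpha>_hi * N v"
    using H1_norm_nonneg[of \<Omega> v] by (simp_all add: real_sqrt_mult)
qed

lemma B_energy_bound: "u \<in> V \<Longrightarrow> v \<in> V \<Longrightarrow> cmod (B u v) \<le> energy u * energy v"
  using V.Cauchy_Schwarz by (simp add: energy_norm_def)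

lemma B_bound:
  assumes "u \<in> V" "v \<in> V"
  shows "cmod (B u v) \<le> \<alpha>_hi * N u * N v"
proof -
  have "cmod (B u v) \<le> energy u * energy v" by (rule B_energy_bound[OF assms])
  also have "\<dots> \<le> (sqrt \<alpha>_hi * N u) * (sqrt \<alpha>_hi * N v)"
    using \<alpha> by (intro mult_mono energy_bounds energy_nonneg assms mult_nonneg_nonneg H1_norm_nonneg) auto
  also have "\<dots> = \<alpha>_hi * N u * N v"
    using \<alpha> by (simp add: algebra_simps flip: power2_eq_square)
  finally show ?thesis .
qed

text \<open>Coordinates with respect to the rescaled basis \<open>\<phi> k / sqrt (d k)\<close>: in
  them the \<phi>-norm is the Euclidean norm and the bilinear form is the stiffness matrix.\<close>

definition comb :: "('n idx \<Rightarrow> complex) \<Rightarrow> 'n idx set \<Rightarrow> real^'n \<Rightarrow> complex" where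
  "comb e F = (\<lambda>x. \<Sum>k\<in>F. e k / rt k * \<phi> k x)"

lemma comb_mem: "F \<subseteq> K \<Longrightarrow> comb e F \<in> V"
  unfolding comb_def by (rule V.sum_mem) (auto intro: \<phi>_mem)

text \<open>Every partial sum over a set containing \<open>F\<close> is exact, so the approximation
  error is eventually zero, and uniqueness of expansions identifies the coefficients.\<close>

lemma coeffs_finite_sum:
  assumes F: "finite F" "F \<subseteq> K"
  shows "coef (\<lambda>x. \<Sum>k\<in>F. c k * \<phi> k x) = (\<lambda>k. if k \<in> F then c k else 0)"
proof (rule coeffs_eqI)
  show "(\<lambda>x. \<Sum>k\<in>F. c k * \<phi> k x) \<in> V"
    using F by (intro V.sum_mem) (auto intro: \<phi>_mem)
  have eq: "N (\<lambda>x. (\<Sum>k\<in>F. c k * \<phi> k x) - (\<Sum>k\<in>G. (if k \<in> F then c k else 0) * \<phi> k x)) = 0"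
    if "finite G" "F \<subseteq> G" for G
  proof -
    have "(\<Sum>k\<in>G. (if k \<in> F then c k else 0) * \<phi> k x) = (\<Sum>k\<in>F. c k * \<phi> k x)" for x
      using that by (intro sum.mono_neutral_cong_right) auto
    then show ?thesis by (simp add: N_zero)
  qed
  have "\<forall>\<^sub>F G in finite_subsets_at_top K.
      N (\<lambda>x. (\<Sum>k\<in>F. c k * \<phi> k x) - (\<Sum>k\<in>G. (if k \<in> F then c k else 0) * \<phi> k x)) = 0"
    unfolding eventually_finite_subsets_at_top using F eq by blast
  then show "expansion \<Omega> K \<phi> (\<lambda>k. if k \<in> F then c k else 0) (\<lambda>x. \<Sum>k\<in>F. c k * \<phi> k x)"
    unfolding expansion_def using F(2) by (auto intro!: tendsto_eventually)
qed

lemma coeffs_comb: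
  "finite F \<Longrightarrow> F \<subseteq> K \<Longrightarrow>
    coef (comb e F) = (\<lambda>k. if k \<in> F then e k / rt k else 0)"
  unfolding comb_def by (rule coeffs_finite_sum)

lemma pnorm_comb:
  assumes F: "finite F" "F \<subseteq> K"
  shows "pnorm (comb e F) = L2_set (\<lambda>k. cmod (e k)) F"
proof -
  have "(\<Sum>\<^sub>\<infinity>k\<in>K. (cmod (coef (comb e F) k))\<^sup>2 * d k) = (\<Sum>\<^sub>\<infinity>k\<in>F. (cmod (e k))\<^sup>2)"
  proof (rule infsum_cong_neutral)
    fix k assume "k \<in> K \<inter> F"
    then show "(cmod (coef (comb e F) k))\<^sup>2 * d k = (cmod (e k))\<^sup>2"
      using d_pos[of k] by (simp add: coeffs_comb F norm_divide power_divide)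
  qed (use F in \<open>auto simp: coeffs_comb\<close>)
  then show ?thesis
    using F by (simp add: phi_norm_def L2_set_def)
qed

lemma N_comb:
  assumes F: "finite F" "F \<subseteq> K"
  shows "N (comb e F) \<le> L2_set (\<lambda>k. cmod (e k)) F / \<beta>_lo"
    and "L2_set (\<lambda>k. cmod (e k)) F \<le> \<beta>_hi * N (comb e F)"
  using N_le_pnorm[OF comb_mem[OF F(2), of e]] pnorm_bounds(2)[OF comb_mem[OF F(2), of e]]
  by (simp_all add: pnorm_comb[OF F])

lemma B_comb_\<phi>:
  assumes F: "F \<subseteq> K" and l: "l \<in> K"
  shows "B (comb e F) (\<phi> l) / rt l = (\<Sum>k\<in>F. A l k * e k)"
proof -
  have "B (comb e F) (\<phi> l) = (\<Sum>k\<in>F. e k / rt k * B (\<phi> k) (\<phi> l))"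
    unfolding comb_def using F l by (intro V.sum_left) (auto intro: \<phi>_mem)
  then show ?thesis
    by (simp add: stiffness_def sum_divide_distrib mult_ac)
qed

lemma B_comb_comb:
  assumes F: "F \<subseteq> K" and G: "G \<subseteq> K"
  shows "B (comb e F) (comb y G) = (\<Sum>l\<in>G. \<Sum>k\<in>F. A l k * e k * cnj (y l))"
proof -
  have "B (comb e F) (comb y G)
      = (\<Sum>l\<in>G. cnj (y l / rt l) * B (comb e F) (\<phi> l))"
    unfolding comb_def[of y] using F G by (intro V.sum_right) (auto intro: \<phi>_mem comb_mem)
  also have "\<dots> = (\<Sum>l\<in>G. (B (comb e F) (\<phi> l) / rt l) * cnj (y l))"
    by (simp add: mult_ac)
  also have "\<dots> = (\<Sum>l\<in>G. (\<Sum>k\<in>F. A l k * e k) * cnj (y l))"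
    using F G by (intro sum.cong refl) (simp add: B_comb_\<phi> subset_iff)
  finally show ?thesis by (simp add: sum_distrib_right)
qed

text \<open>An element of the dual space with its bound kept explicit, because the constant enters
  the estimates of dual norms.\<close>

definition bounded_antilinear :: "'n functional \<Rightarrow> real \<Rightarrow> bool" where
  "bounded_antilinear g C \<longleftrightarrow> 0 \<le> C \<and>
     (\<forall>v\<in>V. \<forall>w\<in>V. g (\<lambda>x. v x + w x) = g v + g w) \<and>
     (\<forall>v\<in>V. \<forall>c. g (\<lambda>x. c * v x) = cnj c * g v) \<and>
     (\<forall>v\<in>V. cmod (g v) \<le> C * N v)"

lemma antilinear_add:
  "bounded_antilinear g C \<Longrightarrow> v \<in> V \<Longrightarrow> w \<in> V \<Longrightarrow> g (\<lambda>x. v x + w x) = g v + g w"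
  by (simp add: bounded_antilinear_def)

lemma antilinear_cmult:
  "bounded_antilinear g C \<Longrightarrow> v \<in> V \<Longrightarrow> g (\<lambda>x. c * v x) = cnj c * g v"
  by (simp add: bounded_antilinear_def)

lemma antilinear_bound: "bounded_antilinear g C \<Longrightarrow> v \<in> V \<Longrightarrow> cmod (g v) \<le> C * N v"
  by (simp add: bounded_antilinear_def)

lemma bounded_antilinear_B:
  assumes "u \<in> V"
  shows "bounded_antilinear (B u) (\<alpha>_hi * N u)"
  using assms \<alpha> B_bound[OF assms]
  by (auto simp: bounded_antilinear_def V.add_right V.cmult_right H1_norm_nonneg)

lemma antilinear_sum:
  assumes "bounded_antilinear g C" "\<And>k. k \<in> F \<Longrightarrow> f k \<in> V"
  shows "g (\<lambda>x. \<Sum>k\<in>F. c k * f k x) = (\<Sum>k\<in>F. cnj (c k) * g (f k))"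
  using assms(2)
proof (induction F rule: infinite_finite_induct)
  case (insert k F)
  have "g (\<lambda>x. c k * f k x + (\<Sum>k\<in>F. c k * f k x))
      = g (\<lambda>x. c k * f k x) + g (\<lambda>x. \<Sum>k\<in>F. c k * f k x)"
    using assms(1) insert.prems V.cmult_mem V.sum_mem[of F f c] by (simp add: bounded_antilinear_def)
  then show ?case
    using insert assms(1) by (simp add: bounded_antilinear_def)
next
  case empty
  show ?case using antilinear_cmult[OF assms(1) V_zero, of 0] by simp
next
  case (infinite F)
  then show ?case using antilinear_cmult[OF assms(1) V_zero, of 0] by simp
qed

text \<open>Moduli of the rescaled dual coefficients: the dual norm is their square-sum norm, and
  Doerfler marking compares their partial norms.\<close>

definition rho :: "'n functional \<Rightarrow> 'n idx \<Rightarrow> real" where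
  "rho g k = cmod (g (\<phi> k)) / sqrt (d k)"

lemma rho_sq: "k \<in> K \<Longrightarrow> (rho g k)\<^sup>2 = (cmod (g (\<phi> k)))\<^sup>2 / d k"
  using d_pos[of k] by (simp add: rho_def power_divide)

text \<open>The combination is the discrete Riesz representer of \<open>g\<close> restricted to
  \<open>F\<close>; antilinearity pairs each coefficient with its own conjugate. It is the test
  function behind both the dual norm bound and the contraction.\<close>

lemma antilinear_comb_rho:
  assumes g: "bounded_antilinear g C" and F: "finite F" "F \<subseteq> K"
  shows "g (comb (\<lambda>k. g (\<phi> k) / rt k) F) = complex_of_real ((L2_set (rho g) F)\<^sup>2)"
proof -
  have "g (comb (\<lambda>k. g (\<phi> k) / rt k) F)
      = (\<Sum>k\<in>F. cnj (g (\<phi> k) / rt k / rt k) * g (\<phi> k))"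
    unfolding comb_def using F by (intro antilinear_sum[OF g]) (auto intro: \<phi>_mem)
  also have "\<dots> = (\<Sum>k\<in>F. complex_of_real ((rho g k)\<^sup>2))"
  proof (rule sum.cong[OF refl])
    fix k assume "k \<in> F"
    then have "k \<in> K" using F by auto
    then have sq: "rt k * rt k = complex_of_real (d k)"
      using d_pos[of k] by (metis abs_of_pos of_real_mult real_sqrt_mult_self)
    then show "cnj (g (\<phi> k) / rt k / rt k) * g (\<phi> k)
        = complex_of_real ((rho g k)\<^sup>2)"
      unfolding rho_sq[OF \<open>k \<in> K\<close>] by (simp add: of_real_cmod_square mult_ac)
  qed
  also have "\<dots> = complex_of_real ((L2_set (rho g) F)\<^sup>2)"
    by (simp add: L2_set_def sum_nonneg)
  finally show ?thesis .
qed

text \<open>Testing with the representer bounds the squared norm by \<open>C / \<beta>_lo\<close>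
  times the norm itself, and one factor cancels.\<close>

lemma L2_set_rho_bound:
  assumes g: "bounded_antilinear g C" and F: "finite F" "F \<subseteq> K"
  shows "L2_set (rho g) F \<le> C / \<beta>_lo"
proof -
  define e where "e k = g (\<phi> k) / rt k" for k
  have e: "L2_set (\<lambda>k. cmod (e k)) F = L2_set (rho g) F"
    using F d_pos by (intro L2_set_cong) (auto simp: e_def rho_def norm_divide less_imp_le subset_iff)
  have "(L2_set (rho g) F)\<^sup>2 = cmod (g (comb e F))"
    using antilinear_comb_rho[OF g F] unfolding e_def by (simp add: norm_power)
  also have "\<dots> \<le> C * N (comb e F)"
    using g comb_mem[OF F(2)] by (simp add: bounded_antilinear_def)
  also have "\<dots> \<le> C * (L2_set (rho g) F / \<beta>_lo)"
    using g N_comb(1)[OF F, of e] by (intro mult_left_mono) (auto simp: bounded_antilinear_def e)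
  finally have *: "L2_set (rho g) F * L2_set (rho g) F \<le> C / \<beta>_lo * L2_set (rho g) F"
    by (simp add: power2_eq_square)
  have "0 \<le> C / \<beta>_lo" using g \<beta> by (simp add: bounded_antilinear_def)
  then show ?thesis
    using mult_right_le_imp_le[OF *] L2_set_nonneg[of "rho g" F]
    by (cases "L2_set (rho g) F = 0") auto
qed

lemma rho_summable:
  assumes g: "bounded_antilinear g C"
  shows "(\<lambda>k. (rho g k)\<^sup>2) summable_on K"
proof (rule nonneg_bdd_above_summable_on)
  show "bdd_above (sum (\<lambda>k. (rho g k)\<^sup>2) ` {F. F \<subseteq> K \<and> finite F})"
  proof (rule bdd_aboveI2)
    fix F assume "F \<in> {F. F \<subseteq> K \<and> finite F}"
    then have "L2_set (rho g) F \<le> C / \<beta>_lo" using L2_set_rho_bound[OF g] by auto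
    then have "(L2_set (rho g) F)\<^sup>2 \<le> (C / \<beta>_lo)\<^sup>2" by (rule power_mono) (rule L2_set_nonneg)
    then show "(\<Sum>k\<in>F. (rho g k)\<^sup>2) \<le> (C / \<beta>_lo)\<^sup>2" by (simp add: L2_set_def sum_nonneg)
  qed
qed simp

lemma dnorm_sq: "(dnorm g)\<^sup>2 = (\<Sum>\<^sub>\<infinity>k\<in>K. (rho g k)\<^sup>2)"
proof -
  have "(dnorm g)\<^sup>2 = (\<Sum>\<^sub>\<infinity>k\<in>K. (cmod (g (\<phi> k)))\<^sup>2 / d k)"
    unfolding dual_phi_norm_def by (rule real_sqrt_pow2) (auto intro!: infsum_nonneg divide_nonneg_pos d_pos)
  also have "\<dots> = (\<Sum>\<^sub>\<infinity>k\<in>K. (rho g k)\<^sup>2)"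
    by (rule infsum_cong) (simp add: rho_sq)
  finally show ?thesis .
qed

lemma dnorm_nonneg: "0 \<le> dnorm g"
  unfolding dual_phi_norm_def by (auto intro!: real_sqrt_ge_zero infsum_nonneg divide_nonneg_pos d_pos)

lemma dnorm_cong: "(\<And>k. k \<in> K \<Longrightarrow> g (\<phi> k) = h (\<phi> k)) \<Longrightarrow> dnorm g = dnorm h"
  unfolding dual_phi_norm_def by (intro arg_cong[of _ _ sqrt] infsum_cong) simp

lemma L2_set_rho_le_dnorm:
  assumes g: "bounded_antilinear g C" and F: "finite F" "F \<subseteq> K"
  shows "L2_set (rho g) F \<le> dnorm g"
proof (rule power2_le_imp_le[OF _ dnorm_nonneg])
  have "(L2_set (rho g) F)\<^sup>2 = (\<Sum>k\<in>F. (rho g k)\<^sup>2)"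
    by (simp add: L2_set_def sum_nonneg)
  also have "\<dots> \<le> (\<Sum>\<^sub>\<infinity>k\<in>K. (rho g k)\<^sup>2)"
    using F by (intro finite_sum_le_infsum rho_summable[OF g]) auto
  finally show "(L2_set (rho g) F)\<^sup>2 \<le> (dnorm g)\<^sup>2" by (simp add: dnorm_sq)
qed

text \<open>The tail is controlled through its finite parts alone, the form in which the decay
  estimate for residuals is available.\<close>

lemma dnorm_sq_le:
  assumes g: "bounded_antilinear g C" and S: "finite S" "S \<subseteq> K"
    and tail: "\<And>F. finite F \<Longrightarrow> F \<subseteq> K - S \<Longrightarrow> L2_set (rho g) F \<le> \<tau>"
  shows "(dnorm g)\<^sup>2 \<le> (L2_set (rho g) S)\<^sup>2 + \<tau>\<^sup>2"
  unfolding dnorm_sq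
proof (rule infsum_le_finite_sums[OF rho_summable[OF g]])
  fix F assume F: "finite F" "F \<subseteq> K"
  have "(\<Sum>k\<in>F. (rho g k)\<^sup>2) = (\<Sum>k\<in>F \<inter> S. (rho g k)\<^sup>2) + (\<Sum>k\<in>F - S. (rho g k)\<^sup>2)"
    by (rule sum.Int_Diff[OF F(1)])
  also have "(\<Sum>k\<in>F \<inter> S. (rho g k)\<^sup>2) \<le> (\<Sum>k\<in>S. (rho g k)\<^sup>2)"
    using S by (intro sum_mono2) auto
  also have "(\<Sum>k\<in>S. (rho g k)\<^sup>2) = (L2_set (rho g) S)\<^sup>2"
    by (simp add: L2_set_def sum_nonneg)
  also have "(\<Sum>k\<in>F - S. (rho g k)\<^sup>2) = (L2_set (rho g) (F - S))\<^sup>2"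
    by (simp add: L2_set_def sum_nonneg)
  also have "\<dots> \<le> \<tau>\<^sup>2"
    using F tail[of "F - S"] by (intro power_mono L2_set_nonneg) auto
  finally show "(\<Sum>k\<in>F. (rho g k)\<^sup>2) \<le> (L2_set (rho g) S)\<^sup>2 + \<tau>\<^sup>2" by simp
qed

lemma dnorm_le:
  assumes g: "bounded_antilinear g C"
  shows "dnorm g \<le> C / \<beta>_lo"
proof (rule power2_le_imp_le)
  show "0 \<le> C / \<beta>_lo" using g \<beta> by (simp add: bounded_antilinear_def)
  show "(dnorm g)\<^sup>2 \<le> (C / \<beta>_lo)\<^sup>2"
    using dnorm_sq_le[OF g, of "{}" "C / \<beta>_lo"] L2_set_rho_bound[OF g] by simp
qed

lemma dnorm_dual_proj:
  assumes S: "finite S" "S \<subseteq> K"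
  shows "dnorm (dual_proj \<Omega> K \<phi> S g) = L2_set (rho g) S"
proof -
  have val: "dual_proj \<Omega> K \<phi> S g (\<phi> k) = (if k \<in> S then g (\<phi> k) else 0)" if k: "k \<in> K" for k
  proof -
    have "coef (\<phi> k) = (\<lambda>j. if j \<in> {k} then 1 else 0)"
      using coeffs_finite_sum[of "{k}" "\<lambda>_. 1"] k by simp
    then have "dual_proj \<Omega> K \<phi> S g (\<phi> k) = (\<Sum>j\<in>S. if j = k then g (\<phi> k) else 0)"
      unfolding dual_proj_def dual_basis_def by (intro sum.cong) auto
    then show ?thesis using S by simp
  qed
  have "(dnorm (dual_proj \<Omega> K \<phi> S g))\<^sup>2 = (\<Sum>\<^sub>\<infinity>k\<in>S. (rho g k)\<^sup>2)"
    unfolding dnorm_sq using S val by (intro infsum_cong_neutral) (auto simp: rho_def)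
  also have "\<dots> = (L2_set (rho g) S)\<^sup>2"
    using S by (simp add: L2_set_def sum_nonneg)
  finally show ?thesis
    using dnorm_nonneg L2_set_nonneg by (metis power2_eq_imp_eq)
qed

lemma coeffs_partial_le_pnorm:
  assumes v: "v \<in> V" and F: "finite F" "F \<subseteq> K"
  shows "L2_set (\<lambda>k. cmod (coef v k) * sqrt (d k)) F \<le> pnorm v"
proof -
  have "(\<Sum>k\<in>F. (cmod (coef v k) * sqrt (d k))\<^sup>2) = (\<Sum>k\<in>F. (cmod (coef v k))\<^sup>2 * d k)"
    using F d_pos by (intro sum.cong) (auto simp: power_mult_distrib less_imp_le subset_iff)
  also have "\<dots> \<le> (\<Sum>\<^sub>\<infinity>k\<in>K. (cmod (coef v k))\<^sup>2 * d k)"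
    using F d_pos by (intro finite_sum_le_infsum coeffs_summable[OF v]) (auto simp: less_imp_le)
  finally show ?thesis
    unfolding L2_set_def phi_norm_def by (rule real_sqrt_le_mono)
qed

lemma pnorm_nonneg: "0 \<le> pnorm v"
  unfolding phi_norm_def using d_pos by (auto intro!: real_sqrt_ge_zero infsum_nonneg simp: less_imp_le)

text \<open>On partial sums of the expansion this is the finite Cauchy-Schwarz inequality;
  boundedness of \<open>g\<close> in the Sobolev norm lets the remainder tend to zero.\<close>

lemma antilinear_le_dnorm_pnorm:
  assumes g: "bounded_antilinear g C" and v: "v \<in> V"
  shows "cmod (g v) \<le> dnorm g * pnorm v"
proof -
  let ?c = "coef v"
  let ?P = "\<lambda>F x. \<Sum>k\<in>F. ?c k * \<phi> k x"
  have lim: "((\<lambda>F. dnorm g * pnorm v + C * N (\<lambda>x. v x - ?P F x)) \<longlongrightarrow> dnorm g * pnorm v + C * 0) (finite_subsets_at_top K)"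
    using coeffs_expansion[OF v] unfolding expansion_def by (intro tendsto_intros) auto
  have "\<forall>\<^sub>F F in finite_subsets_at_top K. cmod (g v) \<le> dnorm g * pnorm v + C * N (\<lambda>x. v x - ?P F x)"
  proof (rule eventually_finite_subsets_at_top_weakI)
    fix F assume F: "finite F" "F \<subseteq> K"
    have P: "?P F \<in> V" using F by (intro V.sum_mem) (auto intro: \<phi>_mem)
    have D: "(\<lambda>x. v x - ?P F x) \<in> V" by (rule V.diff_mem[OF v P])
    have "g v = g (\<lambda>x. ?P F x + (v x - ?P F x))" by simp
    also have "\<dots> = g (?P F) + g (\<lambda>x. v x - ?P F x)"
      by (rule antilinear_add[OF g P D])
    finally have "cmod (g v) \<le> cmod (g (?P F)) + cmod (g (\<lambda>x. v x - ?P F x))"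
      by (simp only: norm_triangle_ineq)
    also have "cmod (g (\<lambda>x. v x - ?P F x)) \<le> C * N (\<lambda>x. v x - ?P F x)"
      by (rule antilinear_bound[OF g D])
    also have "cmod (g (?P F)) \<le> dnorm g * pnorm v"
    proof -
      have "g (?P F) = (\<Sum>k\<in>F. cnj (?c k) * g (\<phi> k))"
        using F by (intro antilinear_sum[OF g]) (auto intro: \<phi>_mem)
      then have "cmod (g (?P F)) \<le> (\<Sum>k\<in>F. cmod (cnj (?c k) * g (\<phi> k)))"
        by (simp only: norm_sum)
      also have "\<dots> = (\<Sum>k\<in>F. \<bar>rho g k\<bar> * \<bar>cmod (?c k) * sqrt (d k)\<bar>)"
      proof (rule sum.cong[OF refl])
        fix k assume "k \<in> F"
        then have "0 < d k" using F d_pos by auto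
        then show "cmod (cnj (?c k) * g (\<phi> k)) = \<bar>rho g k\<bar> * \<bar>cmod (?c k) * sqrt (d k)\<bar>"
          by (simp add: rho_def norm_mult)
      qed
      also have "\<dots> \<le> L2_set (rho g) F * L2_set (\<lambda>k. cmod (?c k) * sqrt (d k)) F"
        by (rule L2_set_mult_ineq)
      also have "\<dots> \<le> dnorm g * pnorm v"
        by (intro mult_mono L2_set_rho_le_dnorm[OF g F] coeffs_partial_le_pnorm[OF v F] dnorm_nonneg L2_set_nonneg)
      finally show ?thesis .
    qed
    finally show "cmod (g v) \<le> dnorm g * pnorm v + C * N (\<lambda>x. v x - ?P F x)" by simp
  qed
  from tendsto_lowerbound[OF lim this] show ?thesis by simp
qed

text \<open>Equivalence of residual and energy error: the upper bound comes from Cauchy-Schwarz in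
  the energy, the lower one from testing \<open>B w\<close> with \<open>w\<close> itself and
  cancelling one factor.\<close>

lemma dnorm_B_bounds:
  assumes w: "w \<in> V"
  shows "dnorm (B w) \<le> sqrt \<alpha>_hi / \<beta>_lo * energy w" and "energy w \<le> \<beta>_hi / sqrt \<alpha>_lo * dnorm (B w)"
proof -
  have "bounded_antilinear (B w) (energy w * sqrt \<alpha>_hi)"
  proof -
    have "cmod (B w v) \<le> energy w * sqrt \<alpha>_hi * N v" if v: "v \<in> V" for v
      using B_energy_bound[OF w v] mult_left_mono[OF energy_bounds(2)[OF v] energy_nonneg[OF w]] by simp
    then show ?thesis
      using bounded_antilinear_B[OF w] energy_nonneg[OF w] \<alpha> by (simp add: bounded_antilinear_def)
  qed
  from dnorm_le[OF this] show "dnorm (B w) \<le> sqrt \<alpha>_hi / \<beta>_lo * energy w" by (simp add: mult.commute)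
  have "(energy w)\<^sup>2 \<le> cmod (B w w)"
    using energy_sq[OF w] complex_Re_le_cmod[of "B w w"] by simp
  also have "\<dots> \<le> dnorm (B w) * pnorm w"
    by (rule antilinear_le_dnorm_pnorm[OF bounded_antilinear_B[OF w] w])
  also have "\<dots> \<le> dnorm (B w) * (\<beta>_hi * N w)"
    by (intro mult_left_mono pnorm_bounds w dnorm_nonneg)
  also have "\<dots> \<le> dnorm (B w) * (\<beta>_hi * (energy w / sqrt \<alpha>_lo))"
    using energy_bounds(1)[OF w] \<alpha> \<beta> by (intro mult_left_mono dnorm_nonneg) (auto simp: field_simps)
  finally have *: "energy w * energy w \<le> (\<beta>_hi / sqrt \<alpha>_lo * dnorm (B w)) * energy w"
    by (simp add: power2_eq_square mult_ac)
  moreover have "0 \<le> \<beta>_hi / sqrt \<alpha>_lo * dnorm (B w)"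
    using \<alpha> \<beta> dnorm_nonneg by simp
  ultimately show "energy w \<le> \<beta>_hi / sqrt \<alpha>_lo * dnorm (B w)"
    using energy_nonneg[OF w] mult_right_le_imp_le[OF *]
    by (cases "energy w = 0") auto
qed

end

section \<open>Contraction and residual decay\<close>

context riesz_setting
begin

lemma galerkin_space_comb:
  assumes "finite F" "F \<subseteq> K" "U \<in> gspace F"
  obtains e where "U = comb e F"
proof -
  obtain c where c: "U = (\<lambda>x. \<Sum>k\<in>F. c k * \<phi> k x)"
    using assms(3) by (auto simp: galerkin_space_def)
  have "U = comb (\<lambda>k. c k * rt k) F"
    unfolding c comb_def
  proof (intro ext sum.cong refl)
    fix x k assume "k \<in> F"
    then have "sqrt (d k) \<noteq> 0" using assms(2) d_pos[of k] by auto
    then show "c k * \<phi> k x = c k * rt k / rt k * \<phi> k x"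
      by simp
  qed
  then show ?thesis by (rule that)
qed

lemma comb_galerkin_space:
  assumes "finite G" "F \<subseteq> G"
  shows "comb e F \<in> gspace G"
  unfolding galerkin_space_def mem_Collect_eq comb_def
proof (intro exI ext)
  fix x
  show "(\<Sum>k\<in>F. e k / rt k * \<phi> k x)
      = (\<Sum>k\<in>G. (if k \<in> F then e k / rt k else 0) * \<phi> k x)"
    using assms by (intro sum.mono_neutral_cong_left) auto
qed

lemma galerkin_space_mono:
  assumes "finite G" "F \<subseteq> G" "U \<in> gspace F"
  shows "U \<in> gspace G"
proof -
  obtain c where c: "U = (\<lambda>x. \<Sum>k\<in>F. c k * \<phi> k x)"
    using assms(3) by (auto simp: galerkin_space_def)
  have "U = (\<lambda>x. \<Sum>k\<in>G. (if k \<in> F then c k else 0) * \<phi> k x)"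
    unfolding c using assms(1,2) by (intro ext sum.mono_neutral_cong_left) auto
  then show ?thesis by (auto simp: galerkin_space_def)
qed

lemma galerkin_space_diff:
  assumes "U \<in> gspace F" "U' \<in> gspace F"
  shows "(\<lambda>x. U x - U' x) \<in> gspace F"
proof -
  obtain c c' where "U = (\<lambda>x. \<Sum>k\<in>F. c k * \<phi> k x)" "U' = (\<lambda>x. \<Sum>k\<in>F. c' k * \<phi> k x)"
    using assms by (auto simp: galerkin_space_def)
  then have "(\<lambda>x. U x - U' x) = (\<lambda>x. \<Sum>k\<in>F. (c k - c' k) * \<phi> k x)"
    by (simp add: sum_subtractf left_diff_distrib)
  then show ?thesis by (auto simp: galerkin_space_def)
qed

lemma galerkin_space_V: "F \<subseteq> K \<Longrightarrow> U \<in> gspace F \<Longrightarrow> U \<in> V"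
  unfolding galerkin_space_def using V.sum_mem[of F \<phi>] \<phi>_mem by blast

text \<open>Pythagoras for the energy norm combined with the lower bound that the marked part of the
  residual gives for the energy of the correction.\<close>

lemma doerfler_contraction:
  assumes u: "u \<in> V" and G: "finite G" "G \<subseteq> K"
    and U: "U \<in> gspace G" and U': "U' \<in> gspace G"
    and orth: "\<And>v. v \<in> gspace G \<Longrightarrow> B (\<lambda>x. u x - U' x) v = 0"
    and S: "S \<subseteq> G" and \<theta>: "0 \<le> \<theta>"
    and mark: "\<theta> * dnorm (B (\<lambda>x. u x - U x)) \<le> L2_set (rho (B (\<lambda>x. u x - U x))) S"
  shows "(energy (\<lambda>x. u x - U' x))\<^sup>2
    \<le> (1 - (\<theta> * (sqrt (\<alpha>_lo / \<alpha>_hi) * (\<beta>_lo / \<beta>_hi)))\<^sup>2) * (energy (\<lambda>x. u x - U x))\<^sup>2"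
proof -
  define w where "w = (\<lambda>x. u x - U x)"
  define w' where "w' = (\<lambda>x. u x - U' x)"
  define z where "z = (\<lambda>x. U' x - U x)"
  have zG: "z \<in> gspace G" unfolding z_def by (rule galerkin_space_diff[OF U' U])
  have UV: "U \<in> V" "U' \<in> V" and zV: "z \<in> V" using galerkin_space_V[OF G(2)] U U' zG by auto
  have wV: "w \<in> V" and w'V: "w' \<in> V" using V.diff_mem u UV by (auto simp: w_def w'_def)
  have w_eq: "w = (\<lambda>x. w' x + z x)" by (simp add: w_def w'_def z_def)
  have orth': "B w' z = 0" using orth[OF zG] by (simp add: w'_def)
  have "B w w = B w' w' + B z z"
    unfolding w_eq using w'V zV orth' V.hermitian[of z w'] by (simp add: V.add_left V.add_right V.add_mem)
  then have pyth: "(energy w)\<^sup>2 = (energy w')\<^sup>2 + (energy z)\<^sup>2"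
    by (simp add: energy_sq wV w'V zV)
  have S': "finite S" "S \<subseteq> K" using S G finite_subset by auto
  define R where "R = L2_set (rho (B w)) S"
  \<comment> \<open>Representer of the marked residual, a member of the larger Galerkin space.
    Orthogonality of the new error to it leaves only the correction \<open>z\<close> in the pairing,
    which bounds \<open>R\<close> by the energy of \<open>z\<close>.\<close>
  define v where "v = comb (\<lambda>k. B w (\<phi> k) / rt k) S"
  have vG: "v \<in> gspace G" unfolding v_def by (rule comb_galerkin_space[OF G(1) S])
  have vV: "v \<in> V" by (rule galerkin_space_V[OF G(2) vG])
  have "B w v = complex_of_real (R\<^sup>2)"
    unfolding v_def R_def by (rule antilinear_comb_rho[OF bounded_antilinear_B[OF wV] S'])
  moreover have "B w v = B w' v + B z v"
    unfolding w_eq by (rule V.add_left[OF w'V zV vV])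
  moreover have "B w' v = 0" using orth[OF vG] by (simp add: w'_def)
  ultimately have "R\<^sup>2 = cmod (B z v)" by (simp add: norm_power)
  also have "\<dots> \<le> energy z * energy v" by (rule B_energy_bound[OF zV vV])
  also have "\<dots> \<le> energy z * (sqrt \<alpha>_hi * (R / \<beta>_lo))"
  proof (rule mult_left_mono[OF _ energy_nonneg[OF zV]])
    have "L2_set (\<lambda>k. cmod (B w (\<phi> k) / rt k)) S = R"
      unfolding R_def using S' d_pos
      by (intro L2_set_cong) (auto simp: rho_def norm_divide less_imp_le subset_iff)
    then have "N v \<le> R / \<beta>_lo"
      using N_comb(1)[OF S'] unfolding v_def by metis
    then show "energy v \<le> sqrt \<alpha>_hi * (R / \<beta>_lo)"
      using energy_bounds(2)[OF vV] \<alpha> by (meson less_imp_le mult_left_mono order_trans real_sqrt_ge_zero)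
  qed
  finally have *: "R * R \<le> (energy z * sqrt \<alpha>_hi / \<beta>_lo) * R"
    by (simp add: power2_eq_square)
  have "0 \<le> energy z * sqrt \<alpha>_hi / \<beta>_lo"
    using energy_nonneg[OF zV] \<alpha> \<beta> by simp
  then have R: "R \<le> energy z * sqrt \<alpha>_hi / \<beta>_lo"
    using mult_right_le_imp_le[OF *] L2_set_nonneg[of "rho (B w)" S]
    by (cases "R = 0") (auto simp: R_def[symmetric])
  let ?q = "sqrt (\<alpha>_lo / \<alpha>_hi) * (\<beta>_lo / \<beta>_hi)"
  have "\<theta> * (?q * energy w) \<le> energy z"
  proof -
    have "sqrt \<alpha>_lo / \<beta>_hi * energy w \<le> dnorm (B w)"
      using dnorm_B_bounds(2)[OF wV] \<alpha> \<beta> by (simp add: field_simps)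
    then have "\<theta> * (sqrt \<alpha>_lo / \<beta>_hi * energy w) \<le> \<theta> * dnorm (B w)"
      by (rule mult_left_mono[OF _ \<theta>])
    also have "\<dots> \<le> R" using mark by (simp add: w_def R_def)
    also note R
    finally have "\<theta> * (sqrt \<alpha>_lo / \<beta>_hi * energy w) * (\<beta>_lo / sqrt \<alpha>_hi)
        \<le> energy z * sqrt \<alpha>_hi / \<beta>_lo * (\<beta>_lo / sqrt \<alpha>_hi)"
      using \<alpha> \<beta> by (intro mult_right_mono) auto
    then show ?thesis using \<alpha> \<beta> by (simp add: real_sqrt_divide mult_ac)
  qed
  then have "(\<theta> * (?q * energy w))\<^sup>2 \<le> (energy z)\<^sup>2"
    using \<theta> \<alpha> \<beta> energy_nonneg[OF wV] by (intro power_mono) auto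
  then have "(energy w')\<^sup>2 \<le> (1 - (\<theta> * ?q)\<^sup>2) * (energy w)\<^sup>2"
  proof -
    have "(\<theta> * ?q)\<^sup>2 * (energy w)\<^sup>2 = (\<theta> * (?q * energy w))\<^sup>2"
      by (simp only: power_mult_distrib mult.assoc)
    then show ?thesis using pyth \<open>(\<theta> * (?q * energy w))\<^sup>2 \<le> (energy z)\<^sup>2\<close>
      unfolding left_diff_distrib by linarith
  qed
  then show ?thesis by (simp add: w_def w'_def)
qed

section \<open>Best approximation by finitely many coefficients\<close>

lemma pnorm_le_gevrey_norm:
  assumes "u \<in> gclass \<eta> t"
  shows "pnorm u \<le> gnorm \<eta> t u"
proof -
  \<comment> \<open>The term \<open>N = 0\<close> of the supremum: the only competitor is the empty
    set, whose projection is zero.\<close>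
  have "{\<Lambda>. \<Lambda> \<subseteq> K \<and> finite \<Lambda> \<and> card \<Lambda> = 0} = {{}}" by auto
  then have "pnorm u = gevrey_quantity \<Omega> K \<phi> d \<eta> t u 0"
    by (simp add: gevrey_quantity_def best_error_def proj_def)
  also have "\<dots> \<le> gnorm \<eta> t u"
    unfolding gevrey_norm_def using assms by (intro cSUP_upper) (auto simp: gevrey_class_def)
  finally show ?thesis .
qed

text \<open>The infimum in \<open>best_error\<close> need not be attained; the factor 2 gives the
  strict slack for picking an actual index set, which is where positivity of the norm enters.
  Infinity of \<open>K\<close> provides sets of every cardinality.\<close>

lemma gevrey_approximation:
  assumes "infinite K" and u: "u \<in> gclass \<eta> t"
    and pos: "0 < gnorm \<eta> t u"
  obtains T where "T \<subseteq> K" "finite T" "card T = m"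
    "pnorm (\<lambda>x. u x - proj_on T u x) \<le> 2 * gnorm \<eta> t u *
      exp (- (\<eta> * ball_measure TYPE('n) powr (- t / real CARD('n)) * real m powr (t / real CARD('n))))"
proof -
  let ?G = "gnorm \<eta> t u"
  let ?E = "\<eta> * ball_measure TYPE('n) powr (- t / real CARD('n)) * real m powr (t / real CARD('n))"
  let ?S = "{\<Lambda>. \<Lambda> \<subseteq> K \<and> finite \<Lambda> \<and> card \<Lambda> = m}"
  have "gevrey_quantity \<Omega> K \<phi> d \<eta> t u m \<le> ?G"
    unfolding gevrey_norm_def using u by (intro cSUP_upper) (auto simp: gevrey_class_def)
  then have "best_error \<Omega> K \<phi> d m u \<le> ?G * exp (- ?E)"
    by (simp add: gevrey_quantity_def exp_minus field_simps)
  also have "\<dots> < 2 * ?G * exp (- ?E)" using pos by simp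
  finally have "(INF \<Lambda>\<in>?S. pnorm (\<lambda>x. u x - proj_on \<Lambda> u x)) < 2 * ?G * exp (- ?E)"
    by (simp add: best_error_def)
  moreover have "?S \<noteq> {}"
    using infinite_arbitrarily_large[OF assms(1), of m] by blast
  moreover have "bdd_below ((\<lambda>\<Lambda>. pnorm (\<lambda>x. u x - proj_on \<Lambda> u x)) ` ?S)"
    using pnorm_nonneg by (intro bdd_belowI2)
  ultimately obtain T where "T \<in> ?S" "pnorm (\<lambda>x. u x - proj_on T u x) < 2 * ?G * exp (- ?E)"
    by (subst (asm) cINF_less_iff) auto
  then show ?thesis using that by auto
qed

end

locale riesz_decay = riesz_setting a b \<nu> \<sigma> \<Omega> \<alpha>_hi V K \<phi> d \<alpha>_lo \<beta>_lo \<beta>_hi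
  for a b :: "real^'n::finite" and \<nu> \<sigma> \<Omega> \<alpha>_hi V K \<phi> d \<alpha>_lo \<beta>_lo \<beta>_hi +
  fixes c \<eta>L :: real
  assumes c_pos: "0 < c" and \<eta>L_pos: "0 < \<eta>L"
    and decay: "\<And>l k. l \<in> K \<Longrightarrow> k \<in> K \<Longrightarrow> cmod (A l k) \<le> c * exp (- \<eta>L * idx_dist l k)"
begin

text \<open>The argument of Combes and Thomas: conjugating the stiffness matrix by the weight
  \<open>exp (\<mu> * min D (dist (\<cdot>, T)))\<close> perturbs it only by \<open>O(\<mu>)\<close>, so coercivity survives and
  Galerkin solutions with data concentrated on \<open>T\<close>, as well as their residuals, decay
  exponentially away from \<open>T\<close>.  Capping the weight at \<open>D\<close> controls the contribution of the
  remainder \<open>u - proj_on T u\<close>.\<close>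

lemma residual_decay:
  obtains \<mu> C1 where "0 < \<mu>" "0 < C1"
    "\<And>T D u \<Lambda> U F. finite T \<Longrightarrow> T \<subseteq> K \<Longrightarrow> T \<noteq> {} \<Longrightarrow> 0 \<le> D \<Longrightarrow> u \<in> V \<Longrightarrow> finite \<Lambda> \<Longrightarrow> \<Lambda> \<subseteq> K \<Longrightarrow>
      U \<in> gspace \<Lambda> \<Longrightarrow> (\<And>v. v \<in> gspace \<Lambda> \<Longrightarrow> B (\<lambda>x. u x - U x) v = 0) \<Longrightarrow>
      finite F \<Longrightarrow> F \<subseteq> K - enrich K D T \<Longrightarrow>
      L2_set (rho (B (\<lambda>x. u x - U x))) F
        \<le> C1 * (exp (- \<mu> * D) * pnorm u + pnorm (\<lambda>x. u x - proj_on T u x))"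
proof -
  let ?ex = "\<lambda>l k. exp (- (\<eta>L / 2) * idx_dist l k)"
  obtain S where S: "0 < S" "\<And>F (l::'n idx). finite F \<Longrightarrow> (\<Sum>k\<in>F. ?ex l k) \<le> S"
    using sum_exp_idx_dist[of "\<eta>L / 2"] \<eta>L_pos by auto
  define m0 where "m0 = \<alpha>_lo / \<beta>_hi\<^sup>2"
  define M where "M = c * S"
  \<comment> \<open>The first entry lets half of the decay rate absorb the weight; the second keeps
    the perturbation \<kappa> below half of the coercivity constant \<open>m0\<close> of the
    matrix.\<close>
  define \<mu> where "\<mu> = min (\<eta>L / 4) (m0 / (2 * (c * 4 / \<eta>L * S)))"
  define \<kappa> where "\<kappa> = \<mu> * (c * 4 / \<eta>L) * S"
  define a1 where "a1 = \<alpha>_hi / \<beta>_lo\<^sup>2"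
  define C1 where "C1 = M + 2 * M\<^sup>2 / m0 + a1 * (1 + 2 * M / m0)"
  have m0: "0 < m0" using \<alpha> \<beta> by (simp add: m0_def)
  have M: "0 < M" using c_pos S by (simp add: M_def)
  have \<mu>: "0 < \<mu>" "\<mu> \<le> \<eta>L / 4" using \<eta>L_pos c_pos S m0 by (auto simp: \<mu>_def)
  have a1: "0 < a1" using \<alpha> \<beta> by (simp add: a1_def)
  have "\<mu> \<le> m0 / (2 * (c * 4 / \<eta>L * S))" by (simp add: \<mu>_def)
  then have \<kappa>: "\<kappa> \<le> m0 / 2" "0 \<le> \<kappa>"
    using c_pos S \<eta>L_pos \<mu> by (auto simp: \<kappa>_def field_simps)
  have C1: "0 < C1" using M m0 a1 by (simp add: C1_def add_pos_pos)
  have colsum: "(\<Sum>l\<in>F. q * ?ex l k) \<le> q * S"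
    and rowsum: "(\<Sum>l\<in>F. q * ?ex k l) \<le> q * S"
    if "finite F" "0 \<le> q" for F :: "'n idx set" and k q
    using S(2)[OF that(1), of k] that(2)
    by (simp_all add: sum_distrib_left[symmetric] mult_left_mono idx_dist_commute[of _ k])
  show ?thesis
  proof (rule that[OF \<mu>(1) C1])
    fix T :: "'n idx set" and D u \<Lambda> U F
    assume T: "finite T" "T \<subseteq> K" "T \<noteq> {}" and D: "0 \<le> D" and u: "u \<in> V"
      and \<Lambda>: "finite \<Lambda>" "\<Lambda> \<subseteq> K" and U: "U \<in> gspace \<Lambda>"
      and orth: "\<And>v. v \<in> gspace \<Lambda> \<Longrightarrow> B (\<lambda>x. u x - U x) v = 0"
      and F: "finite F" "F \<subseteq> K - enrich K D T"
    \<comment> \<open>The exponent of the weight: zero on \<open>T\<close>, equal to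
      \<open>D\<close> on \<open>F\<close>, and Lipschitz with constant 1.\<close>
    define W where "W k = min D (infdist (idx_embed k) (idx_embed ` T))" for k
    have W_lip: "\<bar>W l - W k\<bar> \<le> idx_dist l k" for l k
      using infdist_triangle_abs[of "idx_embed l" "idx_embed ` T" "idx_embed k"]
      by (auto simp: W_def idx_dist_eq_dist)
    have W_T: "W k = 0" if "k \<in> T" for k
      using that D by (simp add: W_def)
    have W_le: "W k \<le> D" for k by (simp add: W_def)
    have W_F: "W k = D" if "k \<in> F" for k
    proof -
      have "D \<le> dist (idx_embed k) y" if y: "y \<in> idx_embed ` T" for y
      proof -
        obtain l where l: "l \<in> T" "y = idx_embed l" using y by blast
        have "k \<in> K" "k \<notin> enrich K D T" using \<open>k \<in> F\<close> F(2) by auto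
        then have "\<not> idx_dist k l \<le> D" using l(1) by (auto simp: enrich_def)
        then show ?thesis by (simp add: l(2) idx_dist_eq_dist)
      qed
      then have "D \<le> infdist (idx_embed k) (idx_embed ` T)"
        using T(3) by (auto simp: infdist_def intro!: cINF_greatest)
      then show ?thesis by (simp add: W_def)
    qed
    define X where "X l k = exp (\<mu> * W l - \<mu> * W k)" for l k
    define AX where "AX l k = A l k * complex_of_real (X l k)" for l k
    have ker: "cmod (AX l k) \<le> c * ?ex l k"
      "cmod (A l k * complex_of_real (X l k - 1)) \<le> \<mu> * (c * 4 / \<eta>L) * ?ex l k"
      if "l \<in> K" "k \<in> K" for l k
    proof -
      have "\<bar>\<mu> * W l - \<mu> * W k\<bar> \<le> \<mu> * idx_dist l k"
        using W_lip[of l k] \<mu>(1) by (simp add: abs_mult flip: right_diff_distrib)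
      note * = exp_kernel_weight[OF norm_ge_zero decay[OF that] this idx_dist_nonneg
          less_imp_le[OF \<mu>(1)] \<mu>(2) \<eta>L_pos less_imp_le[OF c_pos]]
      show "cmod (AX l k) \<le> c * ?ex l k"
        "cmod (A l k * complex_of_real (X l k - 1)) \<le> \<mu> * (c * 4 / \<eta>L) * ?ex l k"
        using * by (simp_all only: AX_def norm_mult norm_of_real X_def abs_exp_cancel)
    qed
    obtain e where e: "U = comb e \<Lambda>" using galerkin_space_comb[OF \<Lambda> U] by blast
    define g where "g k = coef u k * rt k" for k
    define P where "P = proj_on T u"
    define h where "h = (\<lambda>x. u x - P x)"
    have P: "P = comb g T"
      unfolding P_def proj_def comb_def
    proof (intro ext sum.cong refl)
      fix x k assume "k \<in> T"
      then have "sqrt (d k) \<noteq> 0" using T(2) d_pos[of k] by auto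
      then show "coef u k * \<phi> k x = g k / rt k * \<phi> k x"
        by (simp add: g_def)
    qed
    have PV: "P \<in> V" unfolding P by (rule comb_mem[OF T(2)])
    have hV: "h \<in> V" unfolding h_def by (rule V.diff_mem[OF u PV])
    have UV: "U \<in> V" by (rule galerkin_space_V[OF \<Lambda>(2) U])
    have u_eq: "u = (\<lambda>x. P x + h x)" by (simp add: h_def)
    define gn where "gn = L2_set (\<lambda>k. cmod (g k)) T"
    have gn: "gn \<le> pnorm u" "0 \<le> gn"
    proof -
      have "gn = L2_set (\<lambda>k. cmod (coef u k) * sqrt (d k)) T"
        unfolding gn_def using T(2) d_pos
        by (intro L2_set_cong) (auto simp: g_def norm_mult less_imp_le subset_iff)
      then show "gn \<le> pnorm u" using coeffs_partial_le_pnorm[OF u T(1,2)] by simp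
      show "0 \<le> gn" unfolding gn_def by (rule L2_set_nonneg)
    qed
    define z where "z k = complex_of_real (exp (\<mu> * W k)) * e k" for k
    define zn where "zn = L2_set (\<lambda>k. cmod (z k)) \<Lambda>"
    have zn0: "0 \<le> zn" unfolding zn_def by (rule L2_set_nonneg)
    have e_z: "A l k * e k = complex_of_real (exp (- \<mu> * W l)) * (AX l k * z k)" for l k
    proof -
      have "exp (- \<mu> * W l) * X l k * exp (\<mu> * W k) = 1"
        unfolding X_def exp_add[symmetric] by simp
      then have "complex_of_real (exp (- \<mu> * W l) * X l k * exp (\<mu> * W k)) = 1" by simp
      then have "A l k * e k = A l k * e k * complex_of_real (exp (- \<mu> * W l) * X l k * exp (\<mu> * W k))"
        by simp
      then show ?thesis by (simp only: AX_def z_def of_real_mult mult_ac)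
    qed
    have g_z: "A l k * g k = complex_of_real (exp (- \<mu> * W l)) * (AX l k * g k)"
      if "k \<in> T" for l k
    proof -
      have "exp (- \<mu> * W l) * X l k = 1"
        unfolding X_def exp_add[symmetric] by (simp add: W_T[OF that])
      then have "complex_of_real (exp (- \<mu> * W l) * X l k) = 1" by simp
      then have "A l k * g k = A l k * g k * complex_of_real (exp (- \<mu> * W l) * X l k)"
        by simp
      then show ?thesis by (simp only: AX_def of_real_mult mult_ac)
    qed
    \<comment> \<open>The test function carries twice the weight of \<open>U\<close>: one factor is
      cancelled when rows of the matrix are conjugated, the other completes a quadratic form of the
      conjugated matrix \<open>AX\<close> in \<open>z\<close>.\<close>
    define y where "y l = complex_of_real (exp (\<mu> * W l)) * z l" for l
    define v where "v = comb y \<Lambda>"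
    have cancel: "complex_of_real (exp (- \<mu> * W l)) * complex_of_real (exp (\<mu> * W l)) = 1" for l
      by (simp add: exp_minus flip: of_real_mult)
    have y_z: "complex_of_real (exp (- \<mu> * W l)) * q * cnj (y l) = q * cnj (z l)" for q l
    proof -
      have "complex_of_real (exp (- \<mu> * W l)) * q * cnj (y l)
          = (complex_of_real (exp (- \<mu> * W l)) * complex_of_real (exp (\<mu> * W l))) * (q * cnj (z l))"
        by (simp only: y_def complex_cnj_mult complex_cnj_complex_of_real mult_ac)
      then show ?thesis by (simp only: cancel mult_1)
    qed
    have vG: "v \<in> gspace \<Lambda>" unfolding v_def by (rule comb_galerkin_space[OF \<Lambda>(1)]) simp
    have vV: "v \<in> V" by (rule galerkin_space_V[OF \<Lambda>(2) vG])
    have "B U v = B P v + B h v"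
    proof -
      have "B (\<lambda>x. u x - U x) v = B u v - B U v" by (rule V.diff_left[OF u UV vV])
      then have "B U v = B u v" using orth[OF vG] by simp
      also have "B u v = B P v + B h v"
        by (subst u_eq) (rule V.add_left[OF PV hV vV])
      finally show ?thesis .
    qed
    then have "Re (B U v) \<le> cmod (B P v) + cmod (B h v)"
      using complex_Re_le_cmod[of "B U v"] norm_triangle_ineq[of "B P v" "B h v"] by simp
    \<comment> \<open>The coefficients of \<open>P\<close> sit on \<open>T\<close>, where the weight
      is 1, so this bound does not involve \<open>D\<close>.\<close>
    moreover have "cmod (B P v) \<le> M * gn * zn"
    proof -
      have "B P v = (\<Sum>l\<in>\<Lambda>. \<Sum>k\<in>T. A l k * g k * cnj (y l))"
        unfolding P v_def by (rule B_comb_comb[OF T(2) \<Lambda>(2)])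
      also have "\<dots> = (\<Sum>l\<in>\<Lambda>. \<Sum>k\<in>T. AX l k * g k * cnj (z l))"
        by (intro sum.cong refl) (simp only: g_z y_z)
      finally show ?thesis
        unfolding M_def gn_def zn_def
        using T(1,2) \<Lambda> ker(1) colsum[of _ c] rowsum[of _ c] c_pos S(1)
        by (simp only:) (rule Schur_test_bilinear[where s="\<lambda>l k. c * ?ex l k"]; auto simp: subset_iff)
    qed
    \<comment> \<open>The remainder \<open>h\<close> is not localised, so the full gain
      \<open>exp (\<mu> * D)\<close> of the capped weight has to be paid.\<close>
    moreover have "cmod (B h v) \<le> a1 * exp (\<mu> * D) * pnorm h * zn"
    proof -
      have "L2_set (\<lambda>k. cmod (y k)) \<Lambda> \<le> L2_set (\<lambda>k. exp (\<mu> * D) * cmod (z k)) \<Lambda>"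
        using W_le \<mu>(1) by (intro L2_set_mono) (auto simp: y_def norm_mult intro!: mult_right_mono)
      also have "\<dots> = exp (\<mu> * D) * zn"
        by (simp add: L2_set_right_distrib zn_def)
      finally have "N v \<le> exp (\<mu> * D) * zn / \<beta>_lo"
        using N_comb(1)[OF \<Lambda>, of y] \<beta> unfolding v_def by (meson divide_right_mono less_imp_le order_trans)
      then have "\<alpha>_hi * N h * N v \<le> \<alpha>_hi * (pnorm h / \<beta>_lo) * (exp (\<mu> * D) * zn / \<beta>_lo)"
        using N_le_pnorm[OF hV] \<alpha> H1_norm_nonneg[of \<Omega> h] H1_norm_nonneg[of \<Omega> v] \<beta> pnorm_nonneg[of h]
        by (intro mult_mono) auto
      also have "\<dots> = a1 * exp (\<mu> * D) * pnorm h * zn"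
        by (simp add: a1_def power2_eq_square)
      finally show ?thesis using B_bound[OF hV vV] by simp
    qed
    \<comment> \<open>Splitting \<open>AX\<close> into \<open>A\<close> and
      \<open>A * (X - 1)\<close>: the first part is coercive with constant \<open>m0\<close>, the
      second costs at most half of it.\<close>
    moreover have "m0 / 2 * zn\<^sup>2 \<le> Re (B U v)"
    proof -
      let ?E = "\<Sum>l\<in>\<Lambda>. \<Sum>k\<in>\<Lambda>. A l k * complex_of_real (X l k - 1) * z k * cnj (z l)"
      have "B U v = (\<Sum>l\<in>\<Lambda>. \<Sum>k\<in>\<Lambda>. A l k * e k * cnj (y l))"
        unfolding e v_def by (rule B_comb_comb[OF \<Lambda>(2) \<Lambda>(2)])
      also have "\<dots> = (\<Sum>l\<in>\<Lambda>. \<Sum>k\<in>\<Lambda>. AX l k * z k * cnj (z l))"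
        by (simp only: e_z y_z)
      also have "\<dots> = (\<Sum>l\<in>\<Lambda>. \<Sum>k\<in>\<Lambda>. A l k * z k * cnj (z l)) + ?E"
        by (simp add: AX_def algebra_simps sum.distrib sum_subtractf)
      also have "(\<Sum>l\<in>\<Lambda>. \<Sum>k\<in>\<Lambda>. A l k * z k * cnj (z l)) = B (comb z \<Lambda>) (comb z \<Lambda>)"
        by (rule B_comb_comb[OF \<Lambda>(2) \<Lambda>(2), symmetric])
      finally have "Re (B U v) = Re (B (comb z \<Lambda>) (comb z \<Lambda>)) + Re ?E" by simp
      moreover have "m0 * zn\<^sup>2 \<le> Re (B (comb z \<Lambda>) (comb z \<Lambda>))"
      proof -
        have zV: "comb z \<Lambda> \<in> V" by (rule comb_mem[OF \<Lambda>(2)])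
        have "zn \<le> \<beta>_hi * N (comb z \<Lambda>)"
          unfolding zn_def by (rule N_comb(2)[OF \<Lambda>])
        then have "zn\<^sup>2 \<le> (\<beta>_hi * N (comb z \<Lambda>))\<^sup>2" by (rule power_mono[OF _ zn0])
        then have "m0 * zn\<^sup>2 \<le> m0 * (\<beta>_hi * N (comb z \<Lambda>))\<^sup>2"
          using m0 by (intro mult_left_mono) auto
        also have "\<dots> = (sqrt \<alpha>_lo * N (comb z \<Lambda>))\<^sup>2"
          using \<alpha> \<beta> by (simp add: m0_def power_mult_distrib)
        also have "\<dots> \<le> (energy (comb z \<Lambda>))\<^sup>2"
          using energy_bounds(1)[OF zV] \<alpha> H1_norm_nonneg[of \<Omega> "comb z \<Lambda>"] by (intro power_mono) auto
        finally show ?thesis by (simp add: energy_sq[OF zV])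
      qed
      moreover have "cmod ?E \<le> \<kappa> * zn * zn"
        unfolding \<kappa>_def zn_def
      proof (rule Schur_test_bilinear[where s="\<lambda>l k. \<mu> * (c * 4 / \<eta>L) * ?ex l k"])
        have q: "0 \<le> \<mu> * (c * 4 / \<eta>L)" using c_pos \<eta>L_pos \<mu>(1) by simp
        show "cmod (A l k * complex_of_real (X l k - 1)) \<le> \<mu> * (c * 4 / \<eta>L) * ?ex l k"
          if "l \<in> \<Lambda>" "k \<in> \<Lambda>" for l k
          by (rule ker(2)) (use that \<Lambda>(2) in auto)
        show "(\<Sum>k\<in>\<Lambda>. \<mu> * (c * 4 / \<eta>L) * ?ex l k) \<le> \<mu> * (c * 4 / \<eta>L) * S" for l
          by (rule rowsum[OF \<Lambda>(1) q])
        show "(\<Sum>l\<in>\<Lambda>. \<mu> * (c * 4 / \<eta>L) * ?ex l k) \<le> \<mu> * (c * 4 / \<eta>L) * S" for k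
          by (rule colsum[OF \<Lambda>(1) q])
        show "0 \<le> \<mu> * (c * 4 / \<eta>L) * S" by (rule mult_nonneg_nonneg[OF q less_imp_le[OF S(1)]])
      qed
      moreover have "\<kappa> * zn * zn \<le> m0 / 2 * zn * zn"
        using \<kappa> zn0 by (intro mult_right_mono) auto
      ultimately show ?thesis
        using abs_Re_le_cmod[of ?E] by (simp add: power2_eq_square)
    qed
    ultimately have *: "m0 / 2 * zn * zn \<le> (M * gn + a1 * exp (\<mu> * D) * pnorm h) * zn"
      by (simp add: power2_eq_square algebra_simps)
    have zn: "zn \<le> 2 / m0 * (M * gn + a1 * exp (\<mu> * D) * pnorm h)"
    proof (cases "zn = 0")
      case True
      then show ?thesis using m0 M a1 gn pnorm_nonneg[of h] by simp
    next
      case False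
      then have "m0 / 2 * zn \<le> M * gn + a1 * exp (\<mu> * D) * pnorm h"
        using mult_right_le_imp_le[OF *] zn0 by simp
      then show ?thesis using m0 by (simp add: field_simps)
    qed
    have FK: "F \<subseteq> K" using F by auto
    \<comment> \<open>All rows lie in \<open>F\<close>, where the weight is constant; undoing the
      conjugation there produces the factor \<open>exp (- \<mu> * D)\<close> on the contributions of
      \<open>P\<close> and \<open>U\<close>.\<close>
    have "L2_set (rho (B (\<lambda>x. u x - U x))) F
        \<le> L2_set (\<lambda>l. rho (B h) l + (exp (- \<mu> * D) * cmod (\<Sum>k\<in>T. AX l k * g k)
            + exp (- \<mu> * D) * cmod (\<Sum>k\<in>\<Lambda>. AX l k * z k))) F"
    proof (rule L2_set_mono)
      fix l assume l: "l \<in> F"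
      then have lK: "l \<in> K" using FK by auto
      let ?s = "rt l"
      have s: "cmod (q / ?s) = cmod q / sqrt (d l)" for q
        using d_pos[OF lK] by (simp add: norm_divide)
      have "B (\<lambda>x. u x - U x) (\<phi> l) = B h (\<phi> l) + B P (\<phi> l) - B U (\<phi> l)"
        by (simp only: V.diff_left[OF u UV \<phi>_mem[OF lK]])
          (subst u_eq, simp only: V.add_left[OF PV hV \<phi>_mem[OF lK]] add.commute)
      then have "B (\<lambda>x. u x - U x) (\<phi> l) / ?s = B h (\<phi> l) / ?s + B P (\<phi> l) / ?s - B U (\<phi> l) / ?s"
        by (simp only: add_divide_distrib diff_divide_distrib)
      also have "B P (\<phi> l) / ?s = (\<Sum>k\<in>T. A l k * g k)"
        unfolding P by (rule B_comb_\<phi>[OF T(2) lK])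
      also have "\<dots> = complex_of_real (exp (- \<mu> * D)) * (\<Sum>k\<in>T. AX l k * g k)"
        unfolding sum_distrib_left W_F[OF l, symmetric] by (rule sum.cong[OF refl g_z])
      also have "B U (\<phi> l) / ?s = (\<Sum>k\<in>\<Lambda>. A l k * e k)"
        unfolding e by (rule B_comb_\<phi>[OF \<Lambda>(2) lK])
      also have "\<dots> = complex_of_real (exp (- \<mu> * D)) * (\<Sum>k\<in>\<Lambda>. AX l k * z k)"
        unfolding sum_distrib_left W_F[OF l, symmetric] by (rule sum.cong[OF refl e_z])
      finally have "cmod (B (\<lambda>x. u x - U x) (\<phi> l) / ?s) \<le> cmod (B h (\<phi> l) / ?s)
          + cmod (complex_of_real (exp (- \<mu> * D)) * (\<Sum>k\<in>T. AX l k * g k))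
          + cmod (complex_of_real (exp (- \<mu> * D)) * (\<Sum>k\<in>\<Lambda>. AX l k * z k))"
        by (simp only:) (rule order_trans[OF norm_triangle_ineq4 add_right_mono[OF norm_triangle_ineq]])
      then show "rho (B (\<lambda>x. u x - U x)) l
          \<le> rho (B h) l + (exp (- \<mu> * D) * cmod (\<Sum>k\<in>T. AX l k * g k)
            + exp (- \<mu> * D) * cmod (\<Sum>k\<in>\<Lambda>. AX l k * z k))"
        unfolding s rho_def norm_mult norm_of_real abs_exp_cancel by simp
    qed (use d_pos FK in \<open>auto simp: rho_def less_imp_le\<close>)
    also have "\<dots> \<le> L2_set (rho (B h)) F
        + (L2_set (\<lambda>l. exp (- \<mu> * D) * cmod (\<Sum>k\<in>T. AX l k * g k)) F
          + L2_set (\<lambda>l. exp (- \<mu> * D) * cmod (\<Sum>k\<in>\<Lambda>. AX l k * z k)) F)"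
      by (rule order_trans[OF L2_set_triangle_ineq add_left_mono[OF L2_set_triangle_ineq]])
    also have "\<dots> = L2_set (rho (B h)) F
        + (exp (- \<mu> * D) * L2_set (\<lambda>l. cmod (\<Sum>k\<in>T. AX l k * g k)) F
          + exp (- \<mu> * D) * L2_set (\<lambda>l. cmod (\<Sum>k\<in>\<Lambda>. AX l k * z k)) F)"
      by (simp add: L2_set_right_distrib)
    also have "\<dots> \<le> a1 * pnorm h + (exp (- \<mu> * D) * (M * gn) + exp (- \<mu> * D) * (M * zn))"
    proof (intro add_mono mult_left_mono)
      have "L2_set (rho (B h)) F \<le> \<alpha>_hi * N h / \<beta>_lo"
        by (rule L2_set_rho_bound[OF bounded_antilinear_B[OF hV] F(1) FK])
      also have "\<dots> \<le> \<alpha>_hi * (pnorm h / \<beta>_lo) / \<beta>_lo"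
        using N_le_pnorm[OF hV] \<alpha> \<beta> by (intro divide_right_mono mult_left_mono) auto
      also have "\<dots> = a1 * pnorm h" by (simp add: a1_def power2_eq_square)
      finally show "L2_set (rho (B h)) F \<le> a1 * pnorm h" .
      show "L2_set (\<lambda>l. cmod (\<Sum>k\<in>T. AX l k * g k)) F \<le> M * gn"
        unfolding M_def gn_def
        using T(1,2) F(1) FK ker(1) colsum[of _ c] rowsum[of _ c] c_pos S(1)
        by (intro Schur_test[where s="\<lambda>l k. c * ?ex l k"]) auto
      show "L2_set (\<lambda>l. cmod (\<Sum>k\<in>\<Lambda>. AX l k * z k)) F \<le> M * zn"
        unfolding M_def zn_def
        using \<Lambda> F(1) FK ker(1) colsum[of _ c] rowsum[of _ c] c_pos S(1)
        by (intro Schur_test[where s="\<lambda>l k. c * ?ex l k"]) auto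
    qed auto
    also have "\<dots> \<le> a1 * pnorm h + (exp (- \<mu> * D) * (M * gn)
        + exp (- \<mu> * D) * (M * (2 / m0 * (M * gn + a1 * exp (\<mu> * D) * pnorm h))))"
      using zn M by (intro add_left_mono mult_left_mono) auto
    \<comment> \<open>The gain and the loss of the weight cancel in the terms with \<open>h\<close>,
      so only the contribution of \<open>gn\<close> keeps the exponential factor.\<close>
    also have "\<dots> = (M + 2 * M\<^sup>2 / m0) * (exp (- \<mu> * D) * gn) + a1 * (1 + 2 * M / m0) * pnorm h"
    proof -
      have "exp (- \<mu> * D) * (M * (2 / m0 * (a1 * exp (\<mu> * D) * pnorm h)))
          = (exp (- \<mu> * D) * exp (\<mu> * D)) * (M * (2 / m0 * (a1 * pnorm h)))" by simp
      also have "exp (- \<mu> * D) * exp (\<mu> * D) = 1" by (simp add: exp_minus)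
      finally show ?thesis by (simp add: power2_eq_square algebra_simps)
    qed
    also have "\<dots> \<le> C1 * (exp (- \<mu> * D) * pnorm u) + C1 * pnorm h"
    proof (intro add_mono mult_mono)
      show "M + 2 * M\<^sup>2 / m0 \<le> C1" "a1 * (1 + 2 * M / m0) \<le> C1"
        using M m0 a1 by (simp_all add: C1_def add_nonneg_nonneg)
    qed (use gn C1 pnorm_nonneg in auto)
    finally show "L2_set (rho (B (\<lambda>x. u x - U x))) F
        \<le> C1 * (exp (- \<mu> * D) * pnorm u + pnorm (\<lambda>x. u x - proj_on T u x))"
      by (simp add: distrib_left h_def P_def)
  qed
qed

end

section \<open>Complexity of the algorithm\<close>

lemma ball_measure_pos: "0 < ball_measure TYPE('n::finite)"
  unfolding ball_measure_def by (simp add: content_ball_pos)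

context riesz_decay
begin

text \<open>With \<open>Y\<close> the positive part of \<open>ln (3 * C1 * G / \<tau>)\<close>, the
  number \<open>m\<close> of coefficients and the distance \<open>D = Y / \<mu>\<close> are tuned so
  that truncation by distance contributes \<open>G * exp (- Y)\<close> and approximation twice that;
  hence the 3. The resulting neighbourhood has at most \<open>m * (2 * D + 1)^d\<close> points, a
  polynomial in \<open>Y\<close>.\<close>

lemma residual_compressible:
  fixes \<eta> t :: real
  assumes "infinite K" and \<eta>: "0 < \<eta>" and t: "0 < t"
  obtains C2 Cm :: real and p :: nat where "0 < C2" "0 < Cm"
    "\<And>u \<Lambda> U \<tau>. u \<in> gclass \<eta> t \<Longrightarrow> 0 < gnorm \<eta> t u \<Longrightarrow>
      finite \<Lambda> \<Longrightarrow> \<Lambda> \<subseteq> K \<Longrightarrow> U \<in> gspace \<Lambda> \<Longrightarrow>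
      (\<And>v. v \<in> gspace \<Lambda> \<Longrightarrow> B (\<lambda>x. u x - U x) v = 0) \<Longrightarrow> 0 < \<tau> \<Longrightarrow>
      \<exists>T\<subseteq>K. finite T \<and>
        real (card T) \<le> Cm * (1 + max 0 (ln (C2 * gnorm \<eta> t u / \<tau>))) ^ p \<and>
        (\<forall>F. finite F \<longrightarrow> F \<subseteq> K - T \<longrightarrow> L2_set (rho (B (\<lambda>x. u x - U x))) F \<le> \<tau>)"
proof -
  show ?thesis
  proof (rule residual_decay, goal_cases)
  case (1 \<mu> C1)
  note \<mu> = 1(1) and C1 = 1(2) and resid = 1(3)
  define q where "q = t / real CARD('n)"
  define c\<eta> where "c\<eta> = \<eta> * ball_measure TYPE('n) powr (- t / real CARD('n))"
  have q: "0 < q" using t by (simp add: q_def)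
  have c\<eta>: "0 < c\<eta>" using \<eta> ball_measure_pos[where 'n='n] by (simp add: c\<eta>_def)
  \<comment> \<open>A natural exponent above \<open>1 / q\<close>, so that inverting the Gevrey rate
    still yields a polynomial in \<open>Y\<close>.\<close>
  define p0 where "p0 = nat \<lceil>1 / q\<rceil>"
  define a1 where "a1 = max 1 (1 / c\<eta>)"
  define a2 where "a2 = max 1 (2 / \<mu>)"
  define Cm where "Cm = 3 * a1 ^ p0 * a2 ^ CARD('n)"
  have Cm: "0 < Cm" by (simp add: Cm_def a1_def a2_def)
  show ?thesis
  proof (rule that[of "3 * C1" Cm "p0 + CARD('n)"])
    show "0 < 3 * C1" "0 < Cm" using C1 Cm by auto
    fix u \<Lambda> U and \<tau> :: real
    let ?G = "gnorm \<eta> t u"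
    assume u: "u \<in> gclass \<eta> t" and G: "0 < ?G"
      and \<Lambda>: "finite \<Lambda>" "\<Lambda> \<subseteq> K" and U: "U \<in> gspace \<Lambda>"
      and orth: "\<And>v. v \<in> gspace \<Lambda> \<Longrightarrow> B (\<lambda>x. u x - U x) v = 0" and \<tau>: "0 < \<tau>"
    define Y where "Y = max 0 (ln (3 * C1 * ?G / \<tau>))"
    have Y: "0 \<le> Y" by (simp add: Y_def)
    have expY: "C1 * ?G * exp (- Y) \<le> \<tau> / 3"
    proof -
      have pos: "0 < 3 * C1 * ?G / \<tau>" using C1 G \<tau> by simp
      have "exp (- Y) \<le> exp (- ln (3 * C1 * ?G / \<tau>))" by (simp add: Y_def)
      also have "\<dots> = \<tau> / (3 * C1 * ?G)"
        using pos by (simp add: exp_minus)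
      finally show ?thesis using C1 G by (simp add: field_simps)
    qed
    \<comment> \<open>Chosen so that the Gevrey exponent reaches \<open>Y\<close>; the additional 1
      makes the index set nonempty, as the distance to it must make sense.\<close>
    define m where "m = nat \<lceil>(Y / c\<eta>) powr (1 / q)\<rceil> + 1"
    have m_ge: "(Y / c\<eta>) powr (1 / q) \<le> real m"
      unfolding m_def by linarith
    have m_le: "real m \<le> 3 * (1 + Y / c\<eta>) ^ p0"
    proof -
      have Yc: "0 \<le> Y / c\<eta>" using Y c\<eta> by simp
      have "real m \<le> (Y / c\<eta>) powr (1 / q) + 2"
        unfolding m_def using powr_ge_zero[of "Y / c\<eta>" "1 / q"] by linarith
      also have "(Y / c\<eta>) powr (1 / q) \<le> (1 + Y / c\<eta>) powr (1 / q)"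
        using Yc q by (intro powr_mono2) auto
      also have "\<dots> \<le> (1 + Y / c\<eta>) powr (real p0)"
        using Yc by (intro powr_mono) (auto simp: p0_def, linarith)
      also have "\<dots> = (1 + Y / c\<eta>) ^ p0"
        using Yc by (intro powr_realpow) auto
      also have "(1 + Y / c\<eta>) ^ p0 + 2 \<le> 3 * (1 + Y / c\<eta>) ^ p0"
        using one_le_power[of "1 + Y / c\<eta>" p0] Yc by simp
      finally show ?thesis by simp
    qed
    have expm: "Y \<le> c\<eta> * real m powr q"
    proof -
      have "Y / c\<eta> = ((Y / c\<eta>) powr (1 / q)) powr q"
        using Y c\<eta> q by (simp add: powr_powr)
      also have "\<dots> \<le> real m powr q"
        using m_ge q by (intro powr_mono2) auto
      finally show ?thesis using c\<eta> by (simp add: field_simps)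
    qed
    obtain T where T: "T \<subseteq> K" "finite T" "card T = m"
      and approx: "pnorm (\<lambda>x. u x - proj_on T u x) \<le> 2 * ?G * exp (- (c\<eta> * real m powr q))"
      using gevrey_approximation[OF assms(1) u G, of m] unfolding c\<eta>_def q_def by blast
    have T0: "T \<noteq> {}" using T(3) by (auto simp: m_def)
    define D where "D = Y / \<mu>"
    have D: "0 \<le> D" using Y \<mu> by (simp add: D_def)
    let ?T = "enrich K D T"
    have "real (card ?T) \<le> real m * (2 * D + 1) ^ CARD('n)"
      using enrich_card(2)[OF T(2) D, of K] T(3) by simp
    also have "\<dots> \<le> 3 * (a1 * (1 + Y)) ^ p0 * (a2 * (1 + Y)) ^ CARD('n)"
    proof (rule mult_mono)
      have "1 + Y / c\<eta> \<le> a1 * (1 + Y)"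
        using Y mult_right_mono[of "1 / c\<eta>" a1 Y] by (simp add: a1_def distrib_left)
      then have "(1 + Y / c\<eta>) ^ p0 \<le> (a1 * (1 + Y)) ^ p0"
        using Y c\<eta> by (intro power_mono) auto
      then show "real m \<le> 3 * (a1 * (1 + Y)) ^ p0" using m_le by linarith
      have "2 * D + 1 \<le> a2 * (1 + Y)"
        using Y mult_right_mono[of "2 / \<mu>" a2 Y] by (simp add: a2_def D_def distrib_left)
      then show "(2 * D + 1) ^ CARD('n) \<le> (a2 * (1 + Y)) ^ CARD('n)"
        using D by (intro power_mono) auto
    qed (use Y D in \<open>auto simp: a1_def\<close>)
    also have "\<dots> = Cm * (1 + Y) ^ (p0 + CARD('n))"
      by (simp add: Cm_def power_mult_distrib power_add mult_ac)
    finally have card: "real (card ?T) \<le> Cm * (1 + Y) ^ (p0 + CARD('n))" .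
    have tail: "L2_set (rho (B (\<lambda>x. u x - U x))) F \<le> \<tau>" if F: "finite F" "F \<subseteq> K - ?T" for F
    proof -
      have uV: "u \<in> V" using u by (simp add: gevrey_class_def)
      have "exp (- \<mu> * D) * pnorm u \<le> exp (- Y) * ?G"
        using \<mu> pnorm_le_gevrey_norm[OF u] by (simp add: D_def)
      moreover have "pnorm (\<lambda>x. u x - proj_on T u x) \<le> 2 * ?G * exp (- Y)"
      proof -
        have "2 * ?G * exp (- (c\<eta> * real m powr q)) \<le> 2 * ?G * exp (- Y)"
          using expm G by (intro mult_left_mono) auto
        then show ?thesis using approx by linarith
      qed
      ultimately have "exp (- \<mu> * D) * pnorm u + pnorm (\<lambda>x. u x - proj_on T u x) \<le> 3 * (?G * exp (- Y))"
        by (simp add: algebra_simps)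
      then have "C1 * (exp (- \<mu> * D) * pnorm u + pnorm (\<lambda>x. u x - proj_on T u x))
          \<le> C1 * (3 * (?G * exp (- Y)))"
        using C1 by (intro mult_left_mono) auto
      also have "\<dots> \<le> \<tau>" using expY by (simp add: algebra_simps)
      finally show ?thesis
        using resid[OF T(2,1) T0 D uV \<Lambda> U orth F] by simp
    qed
    have "?T \<subseteq> K" by (auto simp: enrich_def)
    then show "\<exists>T\<subseteq>K. finite T \<and>
        real (card T) \<le> Cm * (1 + max 0 (ln (3 * C1 * ?G / \<tau>))) ^ (p0 + CARD('n)) \<and>
        (\<forall>F. finite F \<longrightarrow> F \<subseteq> K - T \<longrightarrow> L2_set (rho (B (\<lambda>x. u x - U x))) F \<le> \<tau>)"
      using card tail enrich_card(1)[OF T(2) D] unfolding Y_def by blast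
  qed
qed
qed

end

text \<open>One terminated run. Its lemmas express bounds in constants of the setting and in
  \<epsilon>, so that uniformity over all runs can be read off afterwards.\<close>

locale dyn_gal = riesz_setting a b \<nu> \<sigma> \<Omega> \<alpha>_hi V K \<phi> d \<alpha>_lo \<beta>_lo \<beta>_hi
  for a b :: "real^'n::finite" and \<nu> \<sigma> \<Omega> \<alpha>_hi V K \<phi> d \<alpha>_lo \<beta>_lo \<beta>_hi +
  fixes C_Ainv \<eta>_tilde C0 \<epsilon> :: real and f u and n :: nat and \<Lambda> M \<delta> J U r
  assumes C0: "0 < C0" "C0 \<le> 1 / 4 * sqrt (\<alpha>_lo / \<alpha>_hi) * (\<beta>_lo / \<beta>_hi)"
    and \<eta>_tilde: "0 < \<eta>_tilde"
    and f: "\<exists>v\<in>V. f v \<noteq> 0" and sol: "weak_solution \<Omega> V \<nu> \<sigma> f u"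
    and \<epsilon>: "0 < \<epsilon>" "\<epsilon> < 1"
    and run: "dyn_gal_run \<Omega> \<nu> \<sigma> \<alpha>_lo \<alpha>_hi K \<phi> d C_Ainv \<eta>_tilde C0 f \<epsilon> n \<Lambda> M \<delta> J U r"
begin

abbreviation "w i \<equiv> (\<lambda>x. u x - U i x)"
abbreviation "R i \<equiv> dnorm (r i)"
definition "\<theta> i = sqrt (1 - C0\<^sup>2 * (R i)\<^sup>2 / (R 0)\<^sup>2)"
definition "q0 = sqrt (\<alpha>_lo / \<alpha>_hi) * (\<beta>_lo / \<beta>_hi)"
definition "contr = 1 - 15 / 16 * q0\<^sup>2"

lemma uV: "u \<in> V" and B_u: "v \<in> V \<Longrightarrow> B u v = f v"
  using sol by (auto simp: weak_solution_def)

lemma run_init: "\<Lambda> 0 = {}" "U 0 = (\<lambda>x. 0)" "r 0 = f"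
  using run by (auto simp: dyn_gal_run_def)

lemma run_step:
  assumes "i \<le> n"
  shows "minimal_doerfler_marking \<Omega> K \<phi> d (\<theta> i) (r i) (M i)"
    and "\<delta> i < 1" and "0 < J i"
    and "J i = - (1 / \<eta>_tilde) * ln (R i / R 0) +
      (- (1 / \<eta>_tilde) * ln ((1 / sqrt (\<alpha>_lo * \<alpha>_hi)) * (C0 / C_Ainv)) + \<delta> i)"
    and "\<Lambda> (Suc i) = \<Lambda> i \<union> enrich K (J i) (M i)"
    and "galerkin_solution \<Omega> \<nu> \<sigma> \<phi> f (\<Lambda> (Suc i)) (U (Suc i))"
    and "r (Suc i) = residual \<Omega> \<nu> \<sigma> f (U (Suc i))"
  using run assms unfolding dyn_gal_run_def Let_def \<theta>_def by blast+

lemma run_stop: "R (Suc n) \<le> \<epsilon> * R 0" and run_continue: "i < n \<Longrightarrow> \<epsilon> * R 0 < R (Suc i)"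
  using run by (auto simp: dyn_gal_run_def)

lemma M_props:
  assumes "i \<le> n"
  shows "finite (M i)" "M i \<subseteq> K" "\<theta> i * R i \<le> L2_set (rho (r i)) (M i)"
  using run_step(1)[OF assms] dnorm_dual_proj[of "M i" "r i"]
  by (auto simp: minimal_doerfler_marking_def doerfler_marking_def)

lemma \<Lambda>_K: "i \<le> Suc n \<Longrightarrow> \<Lambda> i \<subseteq> K"
proof (induction i)
  case (Suc i)
  then show ?case using run_step(5)[of i] by (auto simp: enrich_def)
qed (simp add: run_init)

lemma iterate_props:
  assumes "i \<le> Suc n"
  shows "finite (\<Lambda> i)" "U i \<in> gspace (\<Lambda> i)" "U i \<in> V"
    and "\<And>v. v \<in> gspace (\<Lambda> i) \<Longrightarrow> B (w i) v = 0"
    and "\<And>v. v \<in> V \<Longrightarrow> r i v = B (w i) v"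
proof -
  have "finite (\<Lambda> i) \<and> U i \<in> gspace (\<Lambda> i) \<and> (\<forall>v\<in>gspace (\<Lambda> i). B (w i) v = 0)
      \<and> (\<forall>v\<in>V. r i v = B (w i) v)"
  proof (cases i)
    case 0
    \<comment> \<open>The start of the run is a Galerkin solution too: its space is trivial, so
      orthogonality holds at index 0 as well.\<close>
    have "gspace {} = {\<lambda>x. 0}" by (auto simp: galerkin_space_def)
    moreover have "B u (\<lambda>x. 0) = 0"
      using V.zero_left[OF uV] V.hermitian[of u "\<lambda>x. 0"] by simp
    ultimately show ?thesis using 0 by (auto simp: run_init B_u)
  next
    case (Suc j)
    then have j: "j \<le> n" using assms by simp
    have fin: "finite (\<Lambda> i)" and UG: "U i \<in> gspace (\<Lambda> i)"
      and gal: "\<And>v. v \<in> gspace (\<Lambda> i) \<Longrightarrow> B (U i) v = f v"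
      using run_step(6)[OF j] by (auto simp: galerkin_solution_def Suc)
    have UV: "U i \<in> V" by (rule galerkin_space_V[OF \<Lambda>_K[OF assms] UG])
    have diff: "B (w i) v = f v - B (U i) v" if "v \<in> V" for v
      using V.diff_left[OF uV UV that] B_u[OF that] by simp
    have "r i v = f v - B (U i) v" for v
      using run_step(7)[OF j] by (simp add: residual_def Suc)
    then show ?thesis
      using fin UG diff gal galerkin_space_V[OF \<Lambda>_K[OF assms]] by auto
  qed
  then show "finite (\<Lambda> i)" "U i \<in> gspace (\<Lambda> i)" "U i \<in> V"
    "\<And>v. v \<in> gspace (\<Lambda> i) \<Longrightarrow> B (w i) v = 0" "\<And>v. v \<in> V \<Longrightarrow> r i v = B (w i) v"
    using galerkin_space_V[OF \<Lambda>_K[OF assms]] by auto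
qed

lemma wV: "i \<le> Suc n \<Longrightarrow> w i \<in> V"
  by (rule V.diff_mem[OF uV iterate_props(3)])

lemma R_eq: "i \<le> Suc n \<Longrightarrow> R i = dnorm (B (w i))"
  by (rule dnorm_cong) (simp add: iterate_props(5) \<phi>_mem)

lemma rho_eq: "i \<le> Suc n \<Longrightarrow> k \<in> K \<Longrightarrow> rho (r i) k = rho (B (w i)) k"
  by (simp add: rho_def iterate_props(5) \<phi>_mem)

lemma R0_pos: "0 < R 0"
proof (rule ccontr)
  assume "\<not> 0 < R 0"
  then have "dnorm (B u) = 0" using dnorm_nonneg[of "r 0"] R_eq[of 0] by (simp add: run_init)
  moreover obtain v where v: "v \<in> V" "f v \<noteq> 0" using f by blast
  ultimately show False
    using antilinear_le_dnorm_pnorm[OF bounded_antilinear_B[OF uV] v(1)] B_u[OF v(1)] by simp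
qed

text \<open>Each step up to \<open>n\<close> was entered because the stopping test had failed
  before; for index 0 it is \<open>\<epsilon> < 1\<close>.\<close>

lemma R_lower: "i \<le> n \<Longrightarrow> \<epsilon> * R 0 < R i"
  using run_continue[of "i - 1"] R0_pos \<epsilon> by (cases i) auto

lemma q0: "0 < q0" "q0 \<le> 1" "C0 \<le> q0 / 4"
proof -
  show "0 < q0" using \<alpha> \<beta> by (simp add: q0_def)
  show "q0 \<le> 1" unfolding q0_def using \<alpha> \<beta> by (intro mult_le_one) auto
  show "C0 \<le> q0 / 4" using C0 by (simp add: q0_def)
qed

lemma contr: "0 < contr" "contr < 1"
proof -
  have "q0\<^sup>2 \<le> 1" using q0 by (simp add: power_le_one)
  then show "0 < contr" by (simp add: contr_def)
  show "contr < 1" using q0 by (simp add: contr_def)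
qed

lemma R_le_energy: "i \<le> Suc n \<Longrightarrow> R i \<le> sqrt \<alpha>_hi / \<beta>_lo * energy (w i)"
  and energy_le_R: "i \<le> Suc n \<Longrightarrow> energy (w i) \<le> \<beta>_hi / sqrt \<alpha>_lo * R i"
  using dnorm_B_bounds[OF wV] R_eq by auto

text \<open>Passing from residual to energy and back costs the two equivalence constants, whose
  product is \<open>1 / q0\<close>.\<close>

lemma R_le_R0:
  assumes "i \<le> Suc n" "energy (w i) \<le> s * energy (w 0)" "0 \<le> s"
  shows "q0 * R i \<le> s * R 0"
proof -
  have "R i \<le> sqrt \<alpha>_hi / \<beta>_lo * energy (w i)" by (rule R_le_energy[OF assms(1)])
  also have "\<dots> \<le> sqrt \<alpha>_hi / \<beta>_lo * (s * (\<beta>_hi / sqrt \<alpha>_lo * R 0))"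
  proof (rule mult_left_mono)
    have "s * energy (w 0) \<le> s * (\<beta>_hi / sqrt \<alpha>_lo * R 0)"
      by (rule mult_left_mono[OF energy_le_R assms(3)]) simp
    then show "energy (w i) \<le> s * (\<beta>_hi / sqrt \<alpha>_lo * R 0)" using assms(2) by linarith
  qed (use \<alpha> \<beta> in auto)
  also have "\<dots> = s * R 0 / q0"
    by (simp add: q0_def real_sqrt_divide mult_ac)
  finally show ?thesis using q0 by (simp add: field_simps)
qed

text \<open>The lower bound for the marking parameter is part of the induction: the energy has not
  grown so far, hence \<open>q0 * R i \<le> R 0\<close>, and \<open>C0 \<le> q0 / 4\<close> turns
  this into \<open>1 - \<theta>^2 \<le> 1 / 16\<close>.\<close>

lemma energy_contraction: "i \<le> Suc n \<Longrightarrow> (energy (w i))\<^sup>2 \<le> contr ^ i * (energy (w 0))\<^sup>2"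
proof (induction i)
  case (Suc i)
  then have i: "i \<le> n" "i \<le> Suc n" and IH: "(energy (w i))\<^sup>2 \<le> contr ^ i * (energy (w 0))\<^sup>2" by auto
  have "contr ^ i \<le> 1" using contr by (intro power_le_one) auto
  then have "contr ^ i * (energy (w 0))\<^sup>2 \<le> 1 * (energy (w 0))\<^sup>2"
    by (intro mult_right_mono) auto
  with IH have "(energy (w i))\<^sup>2 \<le> (energy (w 0))\<^sup>2" by linarith
  then have "energy (w i) \<le> energy (w 0)"
    by (rule power2_le_imp_le[OF _ energy_nonneg[OF wV]]) simp
  then have "energy (w i) \<le> 1 * energy (w 0)" by (simp only: mult_1)
  from R_le_R0[OF i(2) this] have "q0 * R i \<le> R 0" by simp
  then have "C0 * R i \<le> R 0 / 4"
    using mult_right_mono[OF q0(3) dnorm_nonneg[of "r i"]] by simp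
  then have "C0 * R i / R 0 \<le> 1 / 4"
    using R0_pos by (simp add: field_simps)
  then have "(C0 * R i / R 0)\<^sup>2 \<le> (1 / 4)\<^sup>2"
    using C0 R0_pos dnorm_nonneg[of "r i"] by (intro power_mono) auto
  moreover have "(C0 * R i / R 0)\<^sup>2 = C0\<^sup>2 * (R i)\<^sup>2 / (R 0)\<^sup>2" "(1 / 4 :: real)\<^sup>2 = 1 / 16"
    by (simp_all add: power_mult_distrib power_divide)
  ultimately have small: "C0\<^sup>2 * (R i)\<^sup>2 / (R 0)\<^sup>2 \<le> 1 / 16" by simp
  then have "(\<theta> i)\<^sup>2 = 1 - C0\<^sup>2 * (R i)\<^sup>2 / (R 0)\<^sup>2"
    unfolding \<theta>_def by (intro real_sqrt_pow2) linarith
  then have th: "15 / 16 \<le> (\<theta> i)\<^sup>2" using small by linarith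
  have sub: "M i \<subseteq> \<Lambda> (Suc i)"
  proof
    fix k assume "k \<in> M i"
    then have "k \<in> enrich K (J i) (M i)"
      using M_props(2)[OF i(1)] run_step(3)[OF i(1)] idx_dist_self[of k] by (force simp: enrich_def)
    then show "k \<in> \<Lambda> (Suc i)" using run_step(5)[OF i(1)] by simp
  qed
  have mark: "\<theta> i * dnorm (B (w i)) \<le> L2_set (rho (B (w i))) (M i)"
  proof -
    have "L2_set (rho (r i)) (M i) = L2_set (rho (B (w i))) (M i)"
      using M_props(2)[OF i(1)] rho_eq[OF i(2)] by (intro L2_set_cong) auto
    then show ?thesis using M_props(3)[OF i(1)] R_eq[OF i(2)] by simp
  qed
  have \<theta>0: "0 \<le> \<theta> i"
    unfolding \<theta>_def by (rule real_sqrt_ge_zero) (use small in linarith)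
  have "(energy (w (Suc i)))\<^sup>2 \<le> (1 - (\<theta> i * q0)\<^sup>2) * (energy (w i))\<^sup>2"
    unfolding q0_def
  proof (rule doerfler_contraction[OF uV iterate_props(1) \<Lambda>_K])
    show "U i \<in> gspace (\<Lambda> (Suc i))"
      using galerkin_space_mono[OF iterate_props(1)[OF Suc.prems] _ iterate_props(2)[OF i(2)]]
        run_step(5)[OF i(1)] by auto
  qed (use Suc.prems iterate_props(2,4)[OF Suc.prems] sub \<theta>0 mark in auto)
  also have "\<dots> \<le> contr * (energy (w i))\<^sup>2"
  proof (rule mult_right_mono)
    have "15 / 16 * q0\<^sup>2 \<le> (\<theta> i)\<^sup>2 * q0\<^sup>2" by (rule mult_right_mono[OF th]) simp
    then show "1 - (\<theta> i * q0)\<^sup>2 \<le> contr" by (simp add: contr_def power_mult_distrib)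
  qed simp
  also have "\<dots> \<le> contr * (contr ^ i * (energy (w 0))\<^sup>2)"
    using IH contr by (intro mult_left_mono) auto
  finally show ?case by simp
qed simp

text \<open>The residual at index \<open>n\<close> still exceeds \<open>\<epsilon> * R 0\<close>,
  whereas contraction bounds it by \<open>contr ^ (n / 2)\<close> up to the factor
  \<open>1 / q0\<close>. Taking logarithms limits \<open>n\<close>.\<close>

lemma iteration_count:
  "real (Suc n) \<le> (1 + (2 + 2 * ln (1 / q0)) / ln (1 / contr)) * (1 + ln (1 / \<epsilon>))"
proof -
  have L: "0 < ln (1 / contr)" using contr by (simp add: ln_div)
  have lq: "0 \<le> ln (1 / q0)" using q0 by (simp add: ln_div)
  have le: "0 < ln (1 / \<epsilon>)" using \<epsilon> by (simp add: ln_div)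
  let ?s = "sqrt (contr ^ n)"
  have "sqrt ((energy (w n))\<^sup>2) \<le> sqrt (contr ^ n * (energy (w 0))\<^sup>2)"
    by (rule real_sqrt_le_mono[OF energy_contraction]) simp
  then have "energy (w n) \<le> ?s * energy (w 0)"
    using energy_nonneg[OF wV[of n]] energy_nonneg[OF wV[of 0]] by (simp add: real_sqrt_mult)
  from R_le_R0[OF _ this] have "q0 * R n \<le> ?s * R 0" using contr by simp
  moreover have "q0 * (\<epsilon> * R 0) < q0 * R n" using R_lower[of n] q0 by simp
  ultimately have "(q0 * \<epsilon>) * R 0 < ?s * R 0" by (simp add: mult.assoc)
  then have s: "q0 * \<epsilon> < ?s" using R0_pos by simp
  have "ln (q0 * \<epsilon>) < ln ?s" using s q0 \<epsilon> contr by (intro ln_less_cancel_iff[THEN iffD2]) auto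
  also have "ln ?s = real n * ln contr / 2"
    using contr by (simp add: ln_sqrt ln_realpow)
  finally have "real n * ln (1 / contr) < 2 * (ln (1 / q0) + ln (1 / \<epsilon>))"
    using q0 \<epsilon> contr by (simp add: ln_div ln_mult)
  then have "real n < 2 * (ln (1 / q0) + ln (1 / \<epsilon>)) / ln (1 / contr)"
    using L by (simp add: field_simps)
  also have "\<dots> \<le> (2 + 2 * ln (1 / q0)) * (1 + ln (1 / \<epsilon>)) / ln (1 / contr)"
    using L lq le by (intro divide_right_mono) (auto simp: algebra_simps)
  finally have "real (Suc n) \<le> 1 * (1 + ln (1 / \<epsilon>)) + (2 + 2 * ln (1 / q0)) / ln (1 / contr) * (1 + ln (1 / \<epsilon>))"
    using le by simp
  then show ?thesis by (simp only: distrib_right)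
qed

text \<open>The tolerance \<open>?\<tau>\<close> equals \<open>sqrt (1 - \<theta>^2) * R i\<close>,
  exactly what Doerfler marking may omit, and it is at least \<open>C0 * \<epsilon>^2 * R 0\<close>
  before termination. So \<open>T\<close> is an admissible marking, and minimality compares the
  cardinalities.\<close>

lemma marked_card_le:
  assumes i: "i \<le> n" and T: "T \<subseteq> K" "finite T"
    and tail: "\<And>F. finite F \<Longrightarrow> F \<subseteq> K - T \<Longrightarrow> L2_set (rho (B (w i))) F \<le> C0 * \<epsilon>\<^sup>2 * R 0"
  shows "card (M i) \<le> card T"
proof -
  have i': "i \<le> Suc n" using i by simp
  have R: "\<epsilon> * R 0 < R i" by (rule R_lower[OF i])
  let ?\<tau> = "C0 * (R i)\<^sup>2 / R 0"
  have "(\<epsilon> * R 0)\<^sup>2 \<le> (R i)\<^sup>2" using R \<epsilon> R0_pos by (intro power_mono) auto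
  then have "C0 * \<epsilon>\<^sup>2 * R 0 \<le> ?\<tau>"
    using C0 R0_pos by (simp add: power2_eq_square field_simps)
  then have "(dnorm (B (w i)))\<^sup>2 \<le> (L2_set (rho (B (w i))) T)\<^sup>2 + ?\<tau>\<^sup>2"
    using dnorm_sq_le[OF bounded_antilinear_B[OF wV[OF i']] T(2,1), of ?\<tau>] tail by (meson order_trans)
  moreover have "L2_set (rho (B (w i))) T = L2_set (rho (r i)) T"
    using T(1) rho_eq[OF i'] by (intro L2_set_cong) auto
  ultimately have *: "(R i)\<^sup>2 - ?\<tau>\<^sup>2 \<le> (L2_set (rho (r i)) T)\<^sup>2"
    using R_eq[OF i'] by simp
  have eq: "(R i)\<^sup>2 - ?\<tau>\<^sup>2 = (1 - C0\<^sup>2 * (R i)\<^sup>2 / (R 0)\<^sup>2) * (R i)\<^sup>2"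
    using R0_pos by (simp add: power2_eq_square field_simps)
  have "\<theta> i * R i \<le> L2_set (rho (r i)) T"
  proof -
    have "\<theta> i * R i = sqrt ((1 - C0\<^sup>2 * (R i)\<^sup>2 / (R 0)\<^sup>2) * (R i)\<^sup>2)"
      using dnorm_nonneg[of "r i"] by (simp add: \<theta>_def real_sqrt_mult)
    also have "\<dots> \<le> sqrt ((L2_set (rho (r i)) T)\<^sup>2)"
      using * unfolding eq by (rule real_sqrt_le_mono)
    finally show ?thesis by (simp add: L2_set_nonneg)
  qed
  then have "doerfler_marking \<Omega> K \<phi> d (\<theta> i) (r i) T"
    unfolding doerfler_marking_def using T by (simp add: dnorm_dual_proj)
  then show ?thesis
    using run_step(1)[OF i] by (simp add: minimal_doerfler_marking_def)
qed

text \<open>Only the relative residual varies in the radius, and it stays above \<epsilon>. The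
  combination \<open>2 * J + 1\<close> is the side length in the count of lattice points.\<close>

lemma radius_le:
  assumes i: "i \<le> n"
  shows "2 * J i + 1 \<le> (2 / \<eta>_tilde + 2 * \<bar>(1 / \<eta>_tilde) * ln ((1 / sqrt (\<alpha>_lo * \<alpha>_hi)) * (C0 / C_Ainv))\<bar> + 3)
    * (1 + ln (1 / \<epsilon>))"
proof -
  let ?c = "\<bar>(1 / \<eta>_tilde) * ln ((1 / sqrt (\<alpha>_lo * \<alpha>_hi)) * (C0 / C_Ainv))\<bar>"
  have le: "0 < ln (1 / \<epsilon>)" using \<epsilon> by (simp add: ln_div)
  have "\<epsilon> \<le> R i / R 0" using R_lower[OF i] R0_pos by (simp add: field_simps)
  then have "ln \<epsilon> \<le> ln (R i / R 0)" using \<epsilon> by (intro ln_mono) auto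
  then have "- (1 / \<eta>_tilde) * ln (R i / R 0) \<le> 1 / \<eta>_tilde * ln (1 / \<epsilon>)"
    using \<eta>_tilde \<epsilon> by (simp add: ln_div field_simps)
  moreover define c0 where "c0 = (1 / \<eta>_tilde) * ln ((1 / sqrt (\<alpha>_lo * \<alpha>_hi)) * (C0 / C_Ainv))"
  moreover have "J i = - (1 / \<eta>_tilde) * ln (R i / R 0) + (- c0 + \<delta> i)"
    unfolding c0_def using run_step(4)[OF i] by (simp only: mult_minus_left)
  ultimately have "2 * J i + 1 \<le> 2 * (1 / \<eta>_tilde * ln (1 / \<epsilon>)) + (2 * \<bar>c0\<bar> + 3)"
    using run_step(2)[OF i] by linarith
  then have "2 * J i + 1 \<le> 2 / \<eta>_tilde * ln (1 / \<epsilon>) + (2 * ?c + 3)"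
    by (simp only: c0_def times_divide_eq_left mult.assoc[symmetric] mult_1_right mult_1 times_divide_eq_right)
  also have "\<dots> \<le> 2 / \<eta>_tilde * (1 + ln (1 / \<epsilon>)) + (2 * ?c + 3) * (1 + ln (1 / \<epsilon>))"
  proof (rule add_mono)
    show "2 / \<eta>_tilde * ln (1 / \<epsilon>) \<le> 2 / \<eta>_tilde * (1 + ln (1 / \<epsilon>))"
      using \<eta>_tilde by (intro mult_left_mono) auto
    show "2 * ?c + 3 \<le> (2 * ?c + 3) * (1 + ln (1 / \<epsilon>))"
      using le mult_left_mono[of 1 "1 + ln (1 / \<epsilon>)" "2 * ?c + 3"] by simp
  qed
  finally show ?thesis by (simp only: distrib_right add.assoc)
qed

lemma active_card_le:
  assumes m: "\<And>i. i \<le> n \<Longrightarrow> real (card (M i)) \<le> m" and j: "\<And>i. i \<le> n \<Longrightarrow> 2 * J i + 1 \<le> j"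
  shows "i \<le> n \<Longrightarrow> real (card (\<Lambda> (Suc i))) \<le> real (Suc n) * (m * j ^ CARD('n))"
proof -
  have "real (card (\<Lambda> i)) \<le> real i * (m * j ^ CARD('n))" if "i \<le> Suc n" for i
    using that
  proof (induction i)
    case (Suc i)
    then have i: "i \<le> n" by simp
    have "card (\<Lambda> (Suc i)) \<le> card (\<Lambda> i) + card (enrich K (J i) (M i))"
      unfolding run_step(5)[OF i] by (rule card_Un_le)
    then have "real (card (\<Lambda> (Suc i))) \<le> real (card (\<Lambda> i)) + real (card (enrich K (J i) (M i)))"
      by linarith
    also have "real (card (enrich K (J i) (M i))) \<le> real (card (M i)) * (2 * J i + 1) ^ CARD('n)"
      using enrich_card(2)[OF M_props(1)[OF i], of "J i" K] run_step(3)[OF i] by simp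
    also have "\<dots> \<le> m * j ^ CARD('n)"
      using run_step(3)[OF i] m[OF i] order_trans[OF of_nat_0_le_iff m[OF i]]
      by (intro mult_mono power_mono j i) auto
    finally show ?case using Suc by (simp add: algebra_simps)
  qed (simp add: run_init)
  note * = this
  assume i: "i \<le> n"
  have "0 \<le> m * j ^ CARD('n)"
    using order_trans[OF of_nat_0_le_iff m[OF i]] run_step(3)[OF i] j[OF i]
    by (intro mult_nonneg_nonneg zero_le_power) auto
  then have "real (Suc i) * (m * j ^ CARD('n)) \<le> real (Suc n) * (m * j ^ CARD('n))"
    using i by (intro mult_right_mono) auto
  then show "real (card (\<Lambda> (Suc i))) \<le> real (Suc n) * (m * j ^ CARD('n))"
    using *[of "Suc i"] i by simp
qed

lemma final_energy: "energy (w (Suc n)) \<le> \<beta>_hi / sqrt \<alpha>_lo * R 0 * \<epsilon>"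
proof -
  have "energy (w (Suc n)) \<le> \<beta>_hi / sqrt \<alpha>_lo * R (Suc n)" by (rule energy_le_R) simp
  also have "\<dots> \<le> \<beta>_hi / sqrt \<alpha>_lo * (\<epsilon> * R 0)"
    using run_stop \<alpha> \<beta> by (intro mult_left_mono) auto
  finally show ?thesis by (simp add: mult_ac)
qed

text \<open>The initial residual is bounded by the norm of \<open>u\<close>, hence by its Gevrey
  norm. This keeps the ratio \<open>X\<close> away from zero uniformly in the data, so a fixed
  constant can make the logarithms at least 1.\<close>

lemma R0_le_gevrey:
  assumes "u \<in> gclass \<eta> t"
  shows "\<beta>_lo\<^sup>2 / \<alpha>_hi \<le> gnorm \<eta> t u / R 0"
proof -
  have "R 0 = dnorm (B u)" using R_eq[of 0] by (simp add: run_init)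
  also have "\<dots> \<le> \<alpha>_hi * N u / \<beta>_lo" by (rule dnorm_le[OF bounded_antilinear_B[OF uV]])
  also have "\<dots> \<le> \<alpha>_hi * (gnorm \<eta> t u / \<beta>_lo) / \<beta>_lo"
  proof -
    have "N u \<le> gnorm \<eta> t u / \<beta>_lo"
      using N_le_pnorm[OF uV] pnorm_le_gevrey_norm[OF assms] \<beta>
      by (meson divide_right_mono less_imp_le order_trans)
    then show ?thesis using \<alpha> \<beta> by (intro divide_right_mono mult_left_mono) auto
  qed
  finally show ?thesis using \<alpha> \<beta> R0_pos by (simp add: field_simps power2_eq_square)
qed

end

context riesz_decay
begin

text \<open>The constants are obtained before data, tolerance and run are introduced, which is the
  required uniformity; everything is measured by one logarithm.\<close>

lemma dyn_gal_complexity: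
  fixes \<eta> t C_Ainv \<eta>_tilde C0 :: real
  assumes K: "infinite K" and \<eta>: "0 < \<eta>" and t: "0 < t" and \<eta>_tilde: "0 < \<eta>_tilde"
    and C0: "0 < C0" "C0 \<le> 1 / 4 * sqrt (\<alpha>_lo / \<alpha>_hi) * (\<beta>_lo / \<beta>_hi)"
  obtains C_low C5 Cn :: real and P :: nat where "0 < C_low" "0 < C5" "0 < Cn"
    "\<And>f u \<epsilon> n \<Lambda> M \<delta> J U r.
      \<exists>v\<in>V. f v \<noteq> 0 \<Longrightarrow> weak_solution \<Omega> V \<nu> \<sigma> f u \<Longrightarrow> u \<in> gclass \<eta> t \<Longrightarrow>
      0 < \<epsilon> \<Longrightarrow> \<epsilon> < 1 \<Longrightarrow>
      dyn_gal_run \<Omega> \<nu> \<sigma> \<alpha>_lo \<alpha>_hi K \<phi> d C_Ainv \<eta>_tilde C0 f \<epsilon> n \<Lambda> M \<delta> J U r \<Longrightarrow>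
      energy (\<lambda>x. u x - U (Suc n) x) \<le> \<beta>_hi / sqrt \<alpha>_lo * dnorm f * \<epsilon> \<and>
      0 < gnorm \<eta> t u / dnorm f \<and>
      exp 1 \<le> C_low * (gnorm \<eta> t u / dnorm f) / \<epsilon> \<and>
      (\<forall>i\<le>n. real (card (\<Lambda> (Suc i)))
        \<le> C5 * ln (C_low * (gnorm \<eta> t u / dnorm f) / \<epsilon>) ^ P) \<and>
      real (Suc n) \<le> Cn * ln (C_low * (gnorm \<eta> t u / dnorm f) / \<epsilon>)"
proof -
  show ?thesis
  proof (rule residual_compressible[OF K \<eta> t], goal_cases)
  case (1 C2 Cm p)
  note C2 = 1(1) and Cm = 1(2) and compr = 1(3)
  define q where "q = sqrt (\<alpha>_lo / \<alpha>_hi) * (\<beta>_lo / \<beta>_hi)"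
  define Ci where "Ci = 1 + (2 + 2 * ln (1 / q)) / ln (1 / (1 - 15 / 16 * q\<^sup>2))"
  define Cj where "Cj = 2 / \<eta>_tilde + 2 * \<bar>(1 / \<eta>_tilde) * ln ((1 / sqrt (\<alpha>_lo * \<alpha>_hi)) * (C0 / C_Ainv))\<bar> + 3"
  define x0 where "x0 = \<beta>_lo\<^sup>2 / \<alpha>_hi"
  \<comment> \<open>The first entry gives \<open>C_low * X \<ge> exp 1\<close>, the second dominates
    the constant of the compressibility bound at the Doerfler tolerance.\<close>
  define C_low where "C_low = max (exp 1 / x0) (C2 / C0)"
  \<comment> \<open>Number of steps times size of a marked set times number of lattice points in a
    ball, with the powers of \<open>y\<close> removed.\<close>
  define C5 where "C5 = (Ci * 2) * (Cm * 3 ^ p * (Cj * 2) ^ CARD('n))"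
  have q: "0 < q" "q \<le> 1"
  proof -
    show "0 < q" using \<alpha> \<beta> by (simp add: q_def)
    show "q \<le> 1" unfolding q_def using \<alpha> \<beta> by (intro mult_le_one) auto
  qed
  have q2: "0 < 1 - 15 / 16 * q\<^sup>2" "1 - 15 / 16 * q\<^sup>2 < 1"
  proof -
    have "q\<^sup>2 \<le> 1" using q by (simp add: power_le_one)
    then show "0 < 1 - 15 / 16 * q\<^sup>2" by simp
    show "1 - 15 / 16 * q\<^sup>2 < 1" using q by simp
  qed
  have Ci: "1 \<le> Ci"
  proof -
    have "0 \<le> ln (1 / q)" "0 \<le> ln (1 / (1 - 15 / 16 * q\<^sup>2))"
      using q q2 by (auto intro!: ln_ge_zero simp del: ln_div)
    then show ?thesis by (simp only: Ci_def le_add_same_cancel1) (intro divide_nonneg_nonneg add_nonneg_nonneg; simp)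
  qed
  have Cj: "0 < Cj" using \<eta>_tilde by (simp add: Cj_def add_nonneg_pos)
  have x0: "0 < x0" using \<alpha> \<beta> by (simp add: x0_def)
  have C_low: "0 < C_low" using x0 by (simp add: C_low_def less_max_iff_disj)
  have C5: "0 < C5" using Ci Cm Cj by (simp add: C5_def)
  show ?thesis
  proof (rule that[OF C_low C5, of "Ci * 2" "p + CARD('n) + 1"])
    show "0 < Ci * 2" using Ci by simp
    fix f u \<epsilon> n \<Lambda> M \<delta> J U r
    assume f: "\<exists>v\<in>V. f v \<noteq> 0" and sol: "weak_solution \<Omega> V \<nu> \<sigma> f u"
      and u: "u \<in> gclass \<eta> t" and \<epsilon>: "0 < \<epsilon>" "\<epsilon> < 1"
      and run: "dyn_gal_run \<Omega> \<nu> \<sigma> \<alpha>_lo \<alpha>_hi K \<phi> d C_Ainv \<eta>_tilde C0 f \<epsilon> n \<Lambda> M \<delta> J U r"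
    interpret D: dyn_gal a b \<nu> \<sigma> \<Omega> \<alpha>_hi V K \<phi> d \<alpha>_lo \<beta>_lo \<beta>_hi C_Ainv \<eta>_tilde C0 \<epsilon> f u n \<Lambda> M \<delta> J U r
      by unfold_locales (fact C0 \<eta>_tilde f sol[unfolded \<Omega>_def] \<epsilon> run[unfolded \<Omega>_def])+
    define G where "G = gnorm \<eta> t u"
    define X where "X = G / dnorm f"
    define y where "y = ln (C_low * X / \<epsilon>)"
    have R0: "0 < dnorm f" using D.R0_pos by (simp add: D.run_init)
    have X: "x0 \<le> X" using D.R0_le_gevrey[OF u] by (simp add: x0_def X_def G_def D.run_init)
    then have X0: "0 < X" using x0 by simp
    then have G: "0 < G" using R0 by (simp add: X_def zero_less_divide_iff)
    have C_low_X: "exp 1 \<le> C_low * X"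
    proof -
      have "exp 1 = exp 1 / x0 * x0" using x0 by simp
      also have "\<dots> \<le> C_low * X"
        using X x0 C_low by (intro mult_mono) (auto simp: C_low_def)
      finally show ?thesis .
    qed
    have big: "C_low * X \<le> C_low * X / \<epsilon>"
      using \<epsilon> C_low X0 by (simp add: pos_le_divide_eq mult_left_le)
    have Ypos: "0 < C_low * X / \<epsilon>" using C_low X0 \<epsilon> by simp
    have "exp 1 \<le> C_low * X / \<epsilon>" using C_low_X big by linarith
    then have y1: "1 \<le> y" unfolding y_def using Ypos by (simp add: ln_ge_iff)
    have y\<epsilon>: "ln (1 / \<epsilon>) \<le> y"
    proof -
      have "1 \<le> C_low * X" using C_low_X exp_ge_add_one_self[of 1] by linarith
      then have "1 / \<epsilon> \<le> C_low * X / \<epsilon>" using \<epsilon> by (intro divide_right_mono) auto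
      then show ?thesis unfolding y_def using \<epsilon> by (intro ln_mono) auto
    qed
    have l\<epsilon>: "0 < ln (1 / \<epsilon>)" using \<epsilon> by (simp add: ln_div)
    let ?\<tau> = "C0 * \<epsilon>\<^sup>2 * dnorm f"
    have \<tau>: "0 < ?\<tau>" using C0 \<epsilon> R0 by simp
    \<comment> \<open>The tolerance contains \<epsilon> squared: one factor belongs to
      \<open>y\<close>, the other adds \<open>ln (1 / \<epsilon>) \<le> y\<close>, and the summand 1
      is at most \<open>y\<close>.\<close>
    have Ym: "1 + max 0 (ln (C2 * G / ?\<tau>)) \<le> 3 * y"
    proof -
      have "C2 * G / ?\<tau> = (C2 / C0) * X / \<epsilon> * (1 / \<epsilon>)"
        by (simp add: X_def power2_eq_square)
      also have "\<dots> \<le> C_low * X / \<epsilon> * (1 / \<epsilon>)"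
        using X0 \<epsilon> by (intro mult_right_mono divide_right_mono) (auto simp: C_low_def)
      finally have "ln (C2 * G / ?\<tau>) \<le> ln (C_low * X / \<epsilon> * (1 / \<epsilon>))"
        using C2 G \<tau> by (intro ln_mono) auto
      also have "\<dots> = y + ln (1 / \<epsilon>)"
        unfolding y_def using Ypos \<epsilon> by (intro ln_mult_pos) auto
      finally show ?thesis using y1 y\<epsilon> by simp
    qed
    have m: "real (card (M i)) \<le> Cm * (3 * y) ^ p" if i: "i \<le> n" for i
    proof -
      have i': "i \<le> Suc n" using i by simp
      obtain T where T: "T \<subseteq> K" "finite T"
        "real (card T) \<le> Cm * (1 + max 0 (ln (C2 * G / ?\<tau>))) ^ p"
        "\<And>F. finite F \<Longrightarrow> F \<subseteq> K - T \<Longrightarrow> L2_set (rho (B (\<lambda>x. u x - U i x))) F \<le> ?\<tau>"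
        using compr[OF u _ D.iterate_props(1)[OF i'] D.\<Lambda>_K[OF i'] D.iterate_props(2)[OF i']
            D.iterate_props(4)[OF i'] \<tau>] G unfolding G_def by blast
      have "card (M i) \<le> card T"
        by (rule D.marked_card_le[OF i T(1,2)]) (use T(4) in \<open>simp add: D.run_init\<close>)
      then have "real (card (M i)) \<le> Cm * (1 + max 0 (ln (C2 * G / ?\<tau>))) ^ p"
        using T(3) by linarith
      also have "\<dots> \<le> Cm * (3 * y) ^ p"
        using Cm Ym by (intro mult_left_mono power_mono) auto
      finally show ?thesis .
    qed
    have two_y: "1 + ln (1 / \<epsilon>) \<le> 2 * y" using y1 y\<epsilon> by simp
    have j: "2 * J i + 1 \<le> Cj * (2 * y)" if "i \<le> n" for i
      using D.radius_le[OF that] mult_left_mono[OF two_y less_imp_le[OF Cj]] unfolding Cj_def by linarith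
    have iter: "real (Suc n) \<le> Ci * 2 * y"
    proof -
      have "real (Suc n) \<le> Ci * (1 + ln (1 / \<epsilon>))"
        using D.iteration_count unfolding D.contr_def D.q0_def Ci_def q_def .
      also have "\<dots> \<le> Ci * (2 * y)" using Ci two_y by (intro mult_left_mono) auto
      finally show ?thesis by simp
    qed
    have card: "real (card (\<Lambda> (Suc i))) \<le> C5 * y ^ (p + CARD('n) + 1)" if "i \<le> n" for i
    proof -
      have "real (card (\<Lambda> (Suc i))) \<le> real (Suc n) * (Cm * (3 * y) ^ p * (Cj * (2 * y)) ^ CARD('n))"
        by (rule D.active_card_le[OF m j that])
      also have "\<dots> \<le> (Ci * 2 * y) * (Cm * (3 * y) ^ p * (Cj * (2 * y)) ^ CARD('n))"
        using iter Cm Cj y1 by (intro mult_right_mono) auto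
      also have "\<dots> = C5 * y ^ (p + CARD('n) + 1)"
        by (simp add: C5_def power_mult_distrib power_add mult_ac)
      finally show ?thesis .
    qed
    have "energy (\<lambda>x. u x - U (Suc n) x) \<le> \<beta>_hi / sqrt \<alpha>_lo * dnorm f * \<epsilon>"
      using D.final_energy by (simp add: D.run_init)
    then show "energy (\<lambda>x. u x - U (Suc n) x) \<le> \<beta>_hi / sqrt \<alpha>_lo * dnorm f * \<epsilon> \<and>
      0 < gnorm \<eta> t u / dnorm f \<and>
      exp 1 \<le> C_low * (gnorm \<eta> t u / dnorm f) / \<epsilon> \<and>
      (\<forall>i\<le>n. real (card (\<Lambda> (Suc i)))
        \<le> C5 * ln (C_low * (gnorm \<eta> t u / dnorm f) / \<epsilon>) ^ (p + CARD('n) + 1)) \<and>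
      real (Suc n) \<le> Ci * 2 * ln (C_low * (gnorm \<eta> t u / dnorm f) / \<epsilon>)"
      using X0 \<open>exp 1 \<le> C_low * X / \<epsilon>\<close> card iter unfolding y_def X_def G_def by blast
  qed
qed
qed

end

text \<open>Of the \<open>P\<close> factors \<open>1 / e\<close> a single one, available since
  \<open>P\<close> is at least 1, absorbs \<open>C / \<omega>\<close>; as the base is at least 1,
  raising the exponent from \<open>P\<close> to \<open>s\<close> only helps.\<close>

lemma power_le_powr:
  fixes y e \<omega> C s :: real
  assumes "1 \<le> y" "0 < e" "e \<le> 1" "e \<le> \<omega> / C" "0 < C" "1 \<le> P" "real P \<le> s"
  shows "C * y ^ P \<le> \<omega> * (1 / e * y) powr s"
proof -
  have e1: "1 \<le> 1 / e" using assms by simp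
  then have ye: "1 \<le> 1 / e * y" using mult_mono[OF e1 assms(1)] assms(2) by simp
  have Ce: "C \<le> \<omega> * (1 / e)" using assms by (simp add: field_simps)
  have "0 < \<omega>" using assms Ce by (smt (verit) e1 mult_nonpos_nonneg)
  have "C * y ^ P \<le> \<omega> * (1 / e) * y ^ P"
    using Ce assms(1) by (intro mult_right_mono) auto
  also have "1 / e \<le> (1 / e) ^ P"
    using e1 assms(6) by (intro self_le_power) auto
  then have "\<omega> * (1 / e) * y ^ P \<le> \<omega> * (1 / e) ^ P * y ^ P"
    using \<open>0 < \<omega>\<close> assms(1) by (intro mult_right_mono mult_left_mono) auto
  also have "\<dots> = \<omega> * (1 / e * y) powr (real P)"
    using ye powr_realpow[of "1 / e * y" P] by (simp only: power_mult_distrib mult.assoc)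
  also have "\<dots> \<le> \<omega> * (1 / e * y) powr s"
    using ye assms(7) \<open>0 < \<omega>\<close> by (intro mult_left_mono powr_mono) auto
  finally show ?thesis .
qed

text \<open>The number \<rho> keeps \<epsilon> away from \<open>exp (- 1)\<close>, where the
  iterated logarithm vanishes and the argument \<open>Y_upp\<close> would drop to 0; the workload
  constants are chosen after it. The lower bounds by 1 on \<open>Y_low\<close> and
  \<open>Y_upp\<close> make the logarithms in the powers nonnegative.\<close>

theorem theorem5p1:
  fixes a b :: "real^'n::finite"
    and \<Omega> :: "(real^'n) set"
    and V :: "(real^'n \<Rightarrow> complex) set"
    and \<nu> \<sigma> :: "real^'n \<Rightarrow> real"
    and K :: "'n idx set"
    and \<phi> :: "'n idx \<Rightarrow> real^'n \<Rightarrow> complex"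
    and d :: "'n idx \<Rightarrow> real"
    and Ainv :: "'n idx \<Rightarrow> 'n idx \<Rightarrow> complex"
    and \<nu>_lo \<nu>_hi \<sigma>_lo \<sigma>_hi \<alpha>_lo \<alpha>_hi \<beta>_lo \<beta>_hi c_L \<eta>_L c_bar \<eta>_bar C_Ainv \<eta>_tilde C0 \<eta> t :: real
  assumes "\<forall>i. a $ i < b $ i" and "\<Omega> = box a b"
    and "V = H1_zero \<Omega> \<or> V = H1_periodic a b"
    and "continuous_on (cbox a b) \<nu>" and "continuous_on (cbox a b) \<sigma>"
    and "0 < \<nu>_lo" and "\<forall>x\<in>\<Omega>. \<nu>_lo \<le> \<nu> x \<and> \<nu> x \<le> \<nu>_hi"
    and "0 < \<sigma>_lo" and "\<forall>x\<in>\<Omega>. \<sigma>_lo \<le> \<sigma> x \<and> \<sigma> x \<le> \<sigma>_hi"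
    and "\<alpha>_lo = min \<nu>_lo \<sigma>_lo" and "\<alpha>_hi = max \<nu>_hi \<sigma>_hi"
    and "infinite K" and "riesz_basis \<Omega> V K \<phi> d \<beta>_lo \<beta>_hi"
    and "l2_inverse K (stiffness \<Omega> \<nu> \<sigma> \<phi> d) Ainv"
    and "0 < c_L" and "0 < \<eta>_L"
    and "\<forall>l\<in>K. \<forall>k\<in>K. cmod (stiffness \<Omega> \<nu> \<sigma> \<phi> d l k) \<le> c_L * exp (- \<eta>_L * idx_dist l k)"
    and "0 < c_bar" and "0 < \<eta>_bar" and "\<eta>_bar \<le> \<eta>_L"
    and "\<forall>l\<in>K. \<forall>k\<in>K. cmod (Ainv l k) \<le> c_bar * exp (- \<eta>_bar * idx_dist l k)"
    and "0 < C_Ainv" and "0 < \<eta>_tilde" and "\<eta>_tilde < \<eta>_bar"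
    and "\<forall>J\<ge>0. l2_bounded K (\<lambda>l k. Ainv l k - band J Ainv l k) \<and>
           l2_opnorm K (\<lambda>l k. Ainv l k - band J Ainv l k) \<le> C_Ainv * exp (- \<eta>_tilde * J)"
    and "0 < C0" and "C0 \<le> 1 / 4 * sqrt (\<alpha>_lo / \<alpha>_hi) * (\<beta>_lo / \<beta>_hi)"
    and "0 < \<eta>" and "0 < t" and "t \<le> real CARD('n)"
  shows "\<exists>C_low \<eta>_low t_low.
    0 < C_low \<and> 0 < \<eta>_low \<and> \<eta>_low < \<eta> \<and> 0 < t_low \<and> t_low < t \<and>
    (\<forall>C_sharp>0. \<forall>\<rho>>0. \<exists>C_upp \<eta>_upp.
      C_low < C_upp \<and> 0 < \<eta>_upp \<and> \<eta>_upp < \<eta>_low \<and>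
      (\<forall>f u \<epsilon> n \<Lambda> M \<delta> J U r.
        f \<in> dual_space \<Omega> V \<and> (\<exists>v\<in>V. f v \<noteq> 0) \<and>
        weak_solution \<Omega> V \<nu> \<sigma> f u \<and> u \<in> gevrey_class \<Omega> V K \<phi> d \<eta> t \<and>
        0 < \<epsilon> \<and> \<epsilon> < 1 \<and>
        dyn_gal_run \<Omega> \<nu> \<sigma> \<alpha>_lo \<alpha>_hi K \<phi> d C_Ainv \<eta>_tilde C0 f \<epsilon> n \<Lambda> M \<delta> J U r
        \<longrightarrow>
        (let X = gevrey_norm \<Omega> K \<phi> d \<eta> t u / dual_phi_norm K \<phi> d f;
             Y_low = C_low * X / \<epsilon>;
             Y_upp = C_upp * X / (\<epsilon> ^ 4 * inverse \<bar>ln \<bar>ln \<epsilon>\<bar>\<bar>)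
         in energy_norm \<Omega> \<nu> \<sigma> (\<lambda>x. u x - U (Suc n) x)
              \<le> \<beta>_hi / sqrt \<alpha>_lo * dual_phi_norm K \<phi> d f * \<epsilon> \<and>
            1 \<le> Y_low \<and>
            real (card (\<Lambda> (Suc n)))
              \<le> ball_measure TYPE('n) * (1 / \<eta>_low * ln Y_low) powr (real CARD('n) / t_low) \<and>
            (\<rho> \<le> \<bar>ln \<bar>ln \<epsilon>\<bar>\<bar> \<longrightarrow>
               1 \<le> Y_upp \<and>
               workload C_sharp n \<Lambda>
                 \<le> ball_measure TYPE('n) *
                    (1 / \<eta>_upp * ln Y_upp) powr (real CARD('n) / t_low)))))"
proof -
  note \<Omega> = assms(2)
  let ?\<Omega> = "box a b"
  have \<alpha>_bounds: "\<alpha>_lo \<le> \<nu> x" "\<nu> x \<le> \<alpha>_hi" "\<alpha>_lo \<le> \<sigma> x" "\<sigma> x \<le> \<alpha>_hi" if "x \<in> ?\<Omega>" for x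
    using that assms(7,9-11) by (auto simp: \<Omega> min_le_iff_disj le_max_iff_disj)
  have \<alpha>_lo: "0 < \<alpha>_lo" using assms(6,8,10) by simp
  \<comment> \<open>The centre of the box is a point at which both coefficient bounds hold, which
    orders them.\<close>
  have "(\<chi> i. (a $ i + b $ i) / 2) \<in> ?\<Omega>"
    using assms(1) by (simp add: mem_box_cart)
  from \<alpha>_bounds(1,2)[OF this] have \<alpha>_le: "\<alpha>_lo \<le> \<alpha>_hi" by linarith
  have meas: "\<tau> \<in> borel_measurable (lebesgue_on ?\<Omega>)" if "continuous_on (cbox a b) \<tau>" for \<tau> :: "real^'n \<Rightarrow> real"
    by (rule continuous_imp_measurable_on_sets_lebesgue[OF continuous_on_subset[OF that box_subset_cbox]]) simp
  note subspace = energy_space_subspace[OF assms(3)[unfolded \<Omega>]]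
  interpret riesz_decay a b \<nu> \<sigma> ?\<Omega> \<alpha>_hi V K \<phi> d \<alpha>_lo \<beta>_lo \<beta>_hi c_L \<eta>_L
  proof unfold_locales
    show "0 \<le> \<nu> x \<and> \<nu> x \<le> \<alpha>_hi" "0 \<le> \<sigma> x \<and> \<sigma> x \<le> \<alpha>_hi" if "x \<in> ?\<Omega>" for x
      using \<alpha>_bounds[OF that] \<alpha>_lo by auto
    show "cmod (stiffness ?\<Omega> \<nu> \<sigma> \<phi> d l k) \<le> c_L * exp (- \<eta>_L * idx_dist l k)" if "l \<in> K" "k \<in> K" for l k
      using assms(17) that by (simp add: \<Omega>)
    show "riesz_basis ?\<Omega> V K \<phi> d \<beta>_lo \<beta>_hi" using assms(13) by (simp add: \<Omega>)
  qed (fact meas[OF assms(4)] meas[OF assms(5)] subspace \<alpha>_lo \<alpha>_le \<alpha>_bounds(1,3) assms(15,16))+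
  show ?thesis
  proof (rule dyn_gal_complexity[OF assms(12) assms(28) assms(29) assms(23) assms(26,27), where C_Ainv=C_Ainv],
      goal_cases)
  case (1 C_low C5 Cn P)
  note C = 1(1-3) and main = 1(4)
  define \<omega> where "\<omega> = ball_measure TYPE('n)"
  have \<omega>: "0 < \<omega>" unfolding \<omega>_def by (rule ball_measure_pos)
  \<comment> \<open>Half of \<open>t\<close> for strictness; the other entry makes the exponent at
    least \<open>P + 1\<close>, one more than the cardinality needs, so that the same
    \<open>t_low\<close> serves the workload.\<close>
  define t_low where "t_low = min (t / 2) (real CARD('n) / real (P + 1))"
  have t_low: "0 < t_low" "t_low < t" using assms(29) by (auto simp: t_low_def)
  have "t_low \<le> real CARD('n) / real (P + 1)" by (simp add: t_low_def)
  then have expo: "real (P + 1) \<le> real CARD('n) / t_low"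
    using t_low(1) by (simp add: field_simps)
  define \<eta>_low where "\<eta>_low = min (\<eta> / 2) (min 1 (\<omega> / C5))"
  have \<eta>_low: "0 < \<eta>_low" "\<eta>_low < \<eta>" "\<eta>_low \<le> 1" "\<eta>_low \<le> \<omega> / C5"
    using assms(28) \<omega> C by (auto simp: \<eta>_low_def)
  show ?thesis
    unfolding \<Omega>
  proof (rule exI[of _ C_low], rule exI[of _ \<eta>_low], rule exI[of _ t_low],
      intro conjI C(1) \<eta>_low(1,2) t_low allI impI, goal_cases)
    case (1 C_sharp \<rho>)
    note C_sharp = 1(1) and \<rho> = 1(2)
    \<comment> \<open>Cost per unknown times iterations times unknowns; it replaces
      \<open>C5\<close> in the choice of \<open>\<eta>_upp\<close>.\<close>
    define C6 where "C6 = C_sharp * Cn * C5"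
    have C6: "0 < C6" using C_sharp C by (simp add: C6_def)
    define \<eta>_upp where "\<eta>_upp = min (\<eta>_low / 2) (\<omega> / C6)"
    have \<eta>_upp: "0 < \<eta>_upp" "\<eta>_upp < \<eta>_low" "\<eta>_upp \<le> 1" "\<eta>_upp \<le> \<omega> / C6"
      using \<eta>_low \<omega> C6 by (auto simp: \<eta>_upp_def)
    \<comment> \<open>The summand 1 gives strictness; the quotient by \<rho> compensates a small
      iterated logarithm, so that \<open>Yu\<close> dominates
      \<open>C_low * X / \<epsilon>\<close>.\<close>
    define C_upp where "C_upp = max (C_low + 1) (C_low / \<rho>)"
    have C_upp: "C_low < C_upp" "C_low \<le> C_upp * \<rho>"
    proof -
      show "C_low < C_upp" by (simp add: C_upp_def)
      have "C_low / \<rho> * \<rho> \<le> C_upp * \<rho>" using \<rho> by (intro mult_right_mono) (auto simp: C_upp_def)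
      then show "C_low \<le> C_upp * \<rho>" using \<rho> by simp
    qed
    show ?case
      unfolding Let_def \<omega>_def[symmetric]
    proof (rule exI[of _ C_upp], rule exI[of _ \<eta>_upp],
        intro conjI C_upp(1) \<eta>_upp(1,2) allI impI; (elim conjE)?)
      fix f u and \<epsilon> :: real and n \<Lambda> M \<delta> J U r
      assume f: "\<exists>v\<in>V. f v \<noteq> 0" and sol: "weak_solution ?\<Omega> V \<nu> \<sigma> f u"
        and u: "u \<in> gclass \<eta> t" and \<epsilon>: "0 < \<epsilon>" "\<epsilon> < 1"
        and run: "dyn_gal_run ?\<Omega> \<nu> \<sigma> \<alpha>_lo \<alpha>_hi K \<phi> d C_Ainv \<eta>_tilde C0 f \<epsilon> n \<Lambda> M \<delta> J U r"
      define X where "X = gnorm \<eta> t u / dnorm f"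
      define y where "y = ln (C_low * X / \<epsilon>)"
      have energy: "energy (\<lambda>x. u x - U (Suc n) x) \<le> \<beta>_hi / sqrt \<alpha>_lo * dnorm f * \<epsilon>"
        and X: "0 < X" and Y: "exp 1 \<le> C_low * X / \<epsilon>"
        and card: "\<And>i. i \<le> n \<Longrightarrow> real (card (\<Lambda> (Suc i))) \<le> C5 * y ^ P"
        and iter: "real (Suc n) \<le> Cn * y"
        using main[OF f sol u \<epsilon> run] unfolding X_def y_def by blast+
      have Ypos: "1 \<le> C_low * X / \<epsilon>" using Y exp_ge_add_one_self[of 1] by linarith
      then have y1: "1 \<le> y" unfolding y_def using Y by (subst ln_ge_iff) auto
      have CyP: "C5 * y ^ P \<le> C5 * y ^ (P + 1)"
        using C y1 by (intro mult_left_mono power_increasing) auto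
      show "energy (\<lambda>x. u x - U (Suc n) x) \<le> \<beta>_hi / sqrt \<alpha>_lo * dnorm f * \<epsilon>"
        by (rule energy)
      show "1 \<le> C_low * (gnorm \<eta> t u / dnorm f) / \<epsilon>"
        using Ypos by (simp only: X_def)
      show "real (card (\<Lambda> (Suc n))) \<le> \<omega> * (1 / \<eta>_low *
          ln (C_low * (gnorm \<eta> t u / dnorm f) / \<epsilon>)) powr (real CARD('n) / t_low)"
        using order_trans[OF card[of n] order_trans[OF CyP
              power_le_powr[OF y1 \<eta>_low(1,3,4) C(2) _ expo]]]
        by (simp add: X_def y_def)
      assume \<rho>\<epsilon>: "\<rho> \<le> \<bar>ln \<bar>ln \<epsilon>\<bar>\<bar>"
      define Yu where "Yu = C_upp * X / (\<epsilon> ^ 4 * inverse \<bar>ln \<bar>ln \<epsilon>\<bar>\<bar>)"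
      have Yu: "C_low * X / \<epsilon> \<le> Yu"
      proof -
        have "C_low * X \<le> C_upp * \<rho> * X"
          using C_upp(2) X by (intro mult_right_mono) auto
        also have "\<dots> \<le> C_upp * \<bar>ln \<bar>ln \<epsilon>\<bar>\<bar> * X"
          using \<rho>\<epsilon> C(1) C_upp(1) X by (intro mult_right_mono mult_left_mono) auto
        finally have "C_low * X / \<epsilon> \<le> C_upp * \<bar>ln \<bar>ln \<epsilon>\<bar>\<bar> * X / \<epsilon>"
          using \<epsilon> by (intro divide_right_mono) auto
        \<comment> \<open>Since \<epsilon> is below 1, its fourth power in the denominator only
          enlarges the quotient.\<close>
        also have "\<dots> \<le> C_upp * \<bar>ln \<bar>ln \<epsilon>\<bar>\<bar> * X / \<epsilon> ^ 4"
          using \<epsilon> C(1) C_upp(1) X power_decreasing[of 1 4 \<epsilon>]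
          by (intro divide_left_mono mult_pos_pos mult_nonneg_nonneg) auto
        also have "\<dots> = Yu" by (simp add: Yu_def divide_inverse mult_ac)
        finally show ?thesis .
      qed
      then show "1 \<le> C_upp * (gnorm \<eta> t u / dnorm f) / (\<epsilon> ^ 4 * inverse \<bar>ln \<bar>ln \<epsilon>\<bar>\<bar>)"
        using Ypos unfolding Yu_def X_def by linarith
      define y' where "y' = ln Yu"
      have yy': "y \<le> y'"
        unfolding y_def y'_def using Yu Ypos by (intro ln_mono) auto
      have "workload C_sharp n \<Lambda> \<le> (\<Sum>i\<le>n. C_sharp * (C5 * y ^ P))"
        unfolding workload_def using card C_sharp by (intro sum_mono mult_left_mono) auto
      also have "\<dots> = real (Suc n) * (C_sharp * (C5 * y ^ P))" by simp
      also have "\<dots> \<le> (Cn * y) * (C_sharp * (C5 * y ^ P))"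
        using iter C C_sharp y1 by (intro mult_right_mono) auto
      also have "\<dots> = C6 * y ^ (P + 1)" by (simp add: C6_def)
      also have "\<dots> \<le> C6 * y' ^ (P + 1)"
        using yy' y1 C6 by (intro mult_left_mono power_mono) auto
      also have "\<dots> \<le> \<omega> * (1 / \<eta>_upp * y') powr (real CARD('n) / t_low)"
        using yy' y1 by (intro power_le_powr \<eta>_upp C6 expo) auto
      finally show "workload C_sharp n \<Lambda> \<le> \<omega> * (1 / \<eta>_upp *
          ln (C_upp * (gnorm \<eta> t u / dnorm f) / (\<epsilon> ^ 4 * inverse \<bar>ln \<bar>ln \<epsilon>\<bar>\<bar>)))
            powr (real CARD('n) / t_low)"
        by (simp only: y'_def Yu_def X_def)
    qed
  qed
  qed
qed

end
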